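(* Let $\alpha\in\mathbb{S}^1$ be a Liouville number and let $\mathcal{D}$ be the collection of orientation-preserving circle homeomorphisms with regularity $(D)$, where $(D)$ is any degree of regularity from Hölder to $C^{\infty}$. Then there is no complete numerical Borel invariant for the $\mathcal{D}$-conjugacy relation of diffeomorphisms in $\mathcal{H}^{\infty}_{\alpha}$. That is, there is no Borel function $\varphi:\mathcal{H}^{\infty}_{\alpha}\to\mathbb{R}$ such that for all $S,T\in\mathcal{H}^{\infty}_{\alpha}$: $S$ and $T$ are $\mathcal{D}$-conjugate if and only if $\varphi(S)=\varphi(T)$.
   Context: $\mathbb{S}^1=\mathbb{R}/\mathbb{Z}$. $\mathcal{H}$ is the set of orientation-preserving homeomorphisms of $\mathbb{S}^1$. For an integer $k\ge 1$ or $k=\infty$, $\mathcal{H}^k$ is the set of orientation-preserving $C^k$-diffeomorphisms of $\mathbb{S}^1$. For $0<\beta<1$ and an integer $k\ge 0$, $\mathcal{H}^{k+\beta}$ is the set of elements of $\mathcal{H}^k$ (with $\mathcal{H}^0=\mathcal{H}$) whose $k$-th derivative is $\beta$-Hölder continuous. $\mathcal{H}^{\infty}_{\alpha}$ is the set of $f\in\mathcal{H}^\infty$ with rotation number $\alpha$, where the rotation number of $f\in\mathcal{H}$ is the class mod $1$ of $\lim_{n\to\infty}(F^n(x)-x)/n$ for any lift $F:\mathbb{R}\to\mathbb{R}$ of $f$ and any $x\in\mathbb R$. An irrational $\alpha$ is Liouville if for every $C>0$ and $n\in\mathbb{N}$ there are infinitely many pairs $p\in\mathbb{Z}$, $q\in\mathbb{N}$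 with $0<|\alpha-p/q|<C/q^n$. "A degree of regularity from Hölder to $C^\infty$" means that $\mathcal{D}$ is one of: $\bigcup_{0<\beta<1}\mathcal{H}^{0+\beta}$ (Hölder homeomorphisms), $\mathcal{H}^{k+\beta}$ with $k\ge 0$ an integer and $0<\beta<1$, $\mathcal{H}^k$ with $k\ge1$ an integer, or $\mathcal{H}^{\infty}$. $S,T$ are $\mathcal{D}$-conjugate if there is $h\in\mathcal{D}$ with $S=h\circ T\circ h^{-1}$. $\mathcal{H}^{\infty}$ carries the metric $d_{\infty}(f,g)=\sum_{k\ge1}\frac{d_k(f,g)}{2^k(1+d_k(f,g))}$, where $d_k(f,g)=\max\{\|f-g\|_k,\|f^{-1}-g^{-1}\|_k\}$ and $\|f\|_k=\max_{0\le i\le k}\max_{x}|D^if(x)|$ (the order-zero term of a difference being measured by distance on the circle); $\mathcal{H}^\infty_\alpha$ has the subspace topology and Borel structure. *)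

theory Defs
  imports "HOL-Analysis.Analysis"
begin

section \<open>The circle\<close>

quotient_type circle = real / "\<lambda>x y :: real. x - y \<in> \<int>"
  morphisms rep_circle circle_of
proof (rule equivpI)
  show "reflp (\<lambda>x y :: real. x - y \<in> \<int>)"
    by (simp add: reflp_def)
  show "symp (\<lambda>x y :: real. x - y \<in> \<int>)"
  proof (rule sympI)
    fix x y :: real
    assume "x - y \<in> \<int>"
    then show "y - x \<in> \<int>" using Ints_minus[of "x - y"] by simp
  qed
  show "transp (\<lambda>x y :: real. x - y \<in> \<int>)"
  proof (rule transpI)
    fix x y z :: real
    assume "x - y \<in> \<int>" "y - z \<in> \<int>"
    then show "x - z \<in> \<int>" using Ints_add[of "x - y" "y - z"] by simp
  qed
qed

lemma circle_of_eq_iff: "circle_of x = circle_of y \<longleftrightarrow> x - y \<in> \<int>"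
  by (rule circle.abs_eq_iff)

lemma circle_of_rep [simp]: "circle_of (rep_circle z) = z"
  using Quotient_circle by (rule Quotient_abs_rep)

text \<open>The distance on the circle is the distance of \<open>x - y\<close> to the nearest integer.\<close>

instantiation circle :: metric_space
begin

lift_definition dist_circle :: "circle \<Rightarrow> circle \<Rightarrow> real"
  is "\<lambda>x y. \<bar>x - y - of_int (round (x - y))\<bar>"
proof -
  fix x x' y y' :: real
  assume "x - x' \<in> \<int>" "y - y' \<in> \<int>"
  then obtain m n where "x = x' + of_int m" "y = y' + of_int n"
    by (auto elim!: Ints_cases simp: algebra_simps)
  then have eq: "x - y = (x' - y') + of_int (m - n)" by simp
  show "\<bar>x - y - of_int (round (x - y))\<bar> = \<bar>x' - y' - of_int (round (x' - y'))\<bar>"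
  proof (rule antisym)
    show "\<bar>x - y - of_int (round (x - y))\<bar> \<le> \<bar>x' - y' - of_int (round (x' - y'))\<bar>"
      using round_diff_minimal[of "x - y" "round (x' - y') + (m - n)"] eq by simp
    show "\<bar>x' - y' - of_int (round (x' - y'))\<bar> \<le> \<bar>x - y - of_int (round (x - y))\<bar>"
      using round_diff_minimal[of "x' - y'" "round (x - y) - (m - n)"] eq by simp
  qed
qed

definition uniformity_circle :: "(circle \<times> circle) filter"
  where "uniformity_circle = (INF e\<in>{0<..}. principal {(x, y). dist x y < e})"

definition open_circle :: "circle set \<Rightarrow> bool"
  where "open_circle U \<longleftrightarrow> (\<forall>x\<in>U. eventually (\<lambda>(x', y). x' = x \<longrightarrow> y \<in> U) uniformity)"

instance
proof
  show "uniformity = (INF e\<in>{0<..}. principal {(x :: circle, y). dist x y < e})"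
    by (rule uniformity_circle_def)
  show "open U \<longleftrightarrow> (\<forall>x\<in>U. eventually (\<lambda>(x', y). x' = x \<longrightarrow> y \<in> U) uniformity)" for U :: "circle set"
    by (rule open_circle_def)
  show "dist x y = 0 \<longleftrightarrow> x = y" for x y :: circle
  proof (transfer, rule iffI)
    fix x y :: real
    assume "\<bar>x - y - of_int (round (x - y))\<bar> = 0"
    then have "x - y = of_int (round (x - y))" by simp
    then show "x - y \<in> \<int>" by (metis Ints_of_int)
  next
    fix x y :: real
    assume "x - y \<in> \<int>"
    then show "\<bar>x - y - of_int (round (x - y))\<bar> = 0"
      by (auto elim!: Ints_cases)
  qed
  show "dist x y \<le> dist x z + dist y z" for x y z :: circle
  proof transfer
    fix x y z :: real
    have "\<bar>x - y - of_int (round (x - y))\<bar>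
        \<le> \<bar>x - y - of_int (round (x - z) - round (y - z))\<bar>"
      by (rule round_diff_minimal)
    then show "\<bar>x - y - of_int (round (x - y))\<bar>
        \<le> \<bar>x - z - of_int (round (x - z))\<bar> + \<bar>y - z - of_int (round (y - z))\<bar>"
      by simp
  qed
qed

end

lemma dist_circle_le: "dist (circle_of x) (circle_of y) \<le> \<bar>x - y\<bar>"
  using round_diff_minimal[of "x - y" 0] by (simp add: dist_circle.abs_eq)

lemma dist_circle_le_half: "dist (x :: circle) y \<le> 1 / 2"
  by transfer (use of_int_round_abs_le in \<open>simp add: abs_minus_commute\<close>)


section \<open>Lifts and derivatives\<close>

definition is_lift :: "(real \<Rightarrow> real) \<Rightarrow> (circle \<Rightarrow> circle) \<Rightarrow> bool"
  where "is_lift F f \<longleftrightarrow> continuous_on UNIV F \<and> (\<forall>x. circle_of (F x) = f (circle_of x))"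

text \<open>Two lifts of the same map differ by an integer constant, so derivatives and the rotation
  number below do not depend on the lift that is chosen here.\<close>

definition lift_of :: "(circle \<Rightarrow> circle) \<Rightarrow> real \<Rightarrow> real"
  where "lift_of f = (SOME F. is_lift F f)"

definition C_k :: "nat \<Rightarrow> (real \<Rightarrow> real) \<Rightarrow> bool"
  where "C_k k F \<longleftrightarrow>
    (\<forall>i<k. (deriv ^^ i) F differentiable_on UNIV) \<and> continuous_on UNIV ((deriv ^^ k) F)"

text \<open>For \<open>i \<ge> 1\<close> the \<open>i\<close>-th derivative of a lift is 1-periodic, hence a real function on the
  circle. (For \<open>i = 0\<close> this is not meaningful and is never used.)\<close>

definition circle_deriv :: "nat \<Rightarrow> (circle \<Rightarrow> circle) \<Rightarrow> circle \<Rightarrow> real"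
  where "circle_deriv i f z = (deriv ^^ i) (lift_of f) (rep_circle z)"

definition hoelder :: "real \<Rightarrow> ('a::metric_space \<Rightarrow> 'b::metric_space) \<Rightarrow> bool"
  where "hoelder \<beta> f \<longleftrightarrow> (\<exists>C. \<forall>x y. dist (f x) (f y) \<le> C * dist x y powr \<beta>)"


section \<open>Classes of circle homeomorphisms and diffeomorphisms\<close>

definition H_homeo :: "(circle \<Rightarrow> circle) set"
  where "H_homeo = {f. homeomorphism UNIV UNIV f (inv f) \<and> (\<exists>F. is_lift F f \<and> strict_mono F)}"

definition H_diff :: "nat \<Rightarrow> (circle \<Rightarrow> circle) set"
  where "H_diff k = {f \<in> H_homeo. C_k k (lift_of f) \<and> C_k k (lift_of (inv f))}"

definition H_inf :: "(circle \<Rightarrow> circle) set"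
  where "H_inf = (\<Inter>k\<in>{1..}. H_diff k)"

definition H_hoelder :: "nat \<Rightarrow> real \<Rightarrow> (circle \<Rightarrow> circle) set"
  where "H_hoelder k \<beta> =
    {f \<in> H_diff k. if k = 0 then hoelder \<beta> f else hoelder \<beta> (circle_deriv k f)}"

definition regularity_classes :: "(circle \<Rightarrow> circle) set set"
  where "regularity_classes =
      {\<Union>\<beta>\<in>{0<..<1}. H_hoelder 0 \<beta>}
    \<union> {H_hoelder k \<beta> | k \<beta>. 0 < \<beta> \<and> \<beta> < 1}
    \<union> {H_diff k | k. 1 \<le> k}
    \<union> {H_inf}"

definition conjugate_in ::
    "(circle \<Rightarrow> circle) set \<Rightarrow> (circle \<Rightarrow> circle) \<Rightarrow> (circle \<Rightarrow> circle) \<Rightarrow> bool"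
  where "conjugate_in D S T \<longleftrightarrow> (\<exists>h\<in>D. S = h \<circ> T \<circ> inv h)"

text \<open>For \<open>f\<close> in \<open>H_homeo\<close> the limit exists and its class mod 1 depends neither on the
  lift nor on the base point, taken to be \<open>0\<close>.\<close>

definition rotation_number :: "(circle \<Rightarrow> circle) \<Rightarrow> circle"
  where "rotation_number f =
    circle_of (lim (\<lambda>n. ((lift_of f ^^ n) 0 - 0) / real n))"

definition H_inf_rot :: "circle \<Rightarrow> (circle \<Rightarrow> circle) set"
  where "H_inf_rot \<alpha> = {f \<in> H_inf. rotation_number f = \<alpha>}"


section \<open>Liouville numbers\<close>

definition liouville_real :: "real \<Rightarrow> bool"
  where "liouville_real a \<longleftrightarrow> a \<notin> \<rat> \<and>
    (\<forall>C>0. \<forall>n::nat. infinite {(p::int, q::nat). 0 < q \<and>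
        0 < \<bar>a - of_int p / of_nat q\<bar> \<and> \<bar>a - of_int p / of_nat q\<bar> < C / of_nat q ^ n})"

lemma liouville_real_shift:
  assumes "liouville_real a"
  shows "liouville_real (a + of_int m)"
  unfolding liouville_real_def
proof (intro conjI allI impI)
  show "a + of_int m \<notin> \<rat>"
    using assms Rats_diff[OF _ Rats_of_int, of "a + of_int m" m] by (auto simp: liouville_real_def)
next
  fix C :: real and n :: nat
  assume "0 < C"
  let ?A = "\<lambda>a. {(p::int, q::nat). 0 < q \<and>
        0 < \<bar>a - of_int p / of_nat q\<bar> \<and> \<bar>a - of_int p / of_nat q\<bar> < C / of_nat q ^ n}"
  let ?g = "\<lambda>(p, q). (p + m * int q, q :: nat)"
  have "inj_on ?g (?A a)" by (auto simp: inj_on_def)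
  moreover have "infinite (?A a)" using assms \<open>0 < C\<close> by (simp add: liouville_real_def)
  moreover have "?g ` ?A a \<subseteq> ?A (a + of_int m)"
    by (auto simp: add_divide_distrib)
  ultimately show "infinite (?A (a + of_int m))"
    using finite_subset finite_imageD by blast
qed

lift_definition liouville :: "circle \<Rightarrow> bool" is liouville_real
proof -
  fix a b :: real
  assume "a - b \<in> \<int>"
  then obtain m where "a = b + of_int m"
    by (auto elim!: Ints_cases simp: algebra_simps)
  then show "liouville_real a = liouville_real b"
    using liouville_real_shift[of b m] liouville_real_shift[of a "- m"] by auto
qed


section \<open>The metric and the Borel structure\<close>

text \<open>\<open>sup_diff i f g\<close> is the supremum norm of the \<open>i\<close>-th derivative of \<open>f - g\<close>, where for
  \<open>i = 0\<close> the distance on the circle is used.\<close>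

definition sup_diff :: "nat \<Rightarrow> (circle \<Rightarrow> circle) \<Rightarrow> (circle \<Rightarrow> circle) \<Rightarrow> real"
  where "sup_diff i f g =
    (if i = 0 then (SUP x. dist (f x) (g x)) else (SUP x. \<bar>circle_deriv i f x - circle_deriv i g x\<bar>))"

definition norm_diff :: "nat \<Rightarrow> (circle \<Rightarrow> circle) \<Rightarrow> (circle \<Rightarrow> circle) \<Rightarrow> real"
  where "norm_diff k f g = Max ((\<lambda>i. sup_diff i f g) ` {0..k})"

definition d_k :: "nat \<Rightarrow> (circle \<Rightarrow> circle) \<Rightarrow> (circle \<Rightarrow> circle) \<Rightarrow> real"
  where "d_k k f g = max (norm_diff k f g) (norm_diff k (inv f) (inv g))"

text \<open>The locale \<^locale>\<open>Metric_space\<close> demands nonnegativity also off the carrier, hence the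
  case distinction.\<close>

definition d_inf :: "(circle \<Rightarrow> circle) \<Rightarrow> (circle \<Rightarrow> circle) \<Rightarrow> real"
  where "d_inf f g = (if f \<in> H_inf \<and> g \<in> H_inf
    then (\<Sum>k. d_k (Suc k) f g / (2 ^ Suc k * (1 + d_k (Suc k) f g))) else 0)"

definition H_inf_rot_topology :: "circle \<Rightarrow> (circle \<Rightarrow> circle) topology"
  where "H_inf_rot_topology \<alpha> = subtopology (Metric_space.mtopology H_inf d_inf) (H_inf_rot \<alpha>)"

definition borel_of_topology :: "'a topology \<Rightarrow> 'a measure"
  where "borel_of_topology X = sigma (topspace X) {U. openin X U}"


subsection \<open>\<open>d_inf\<close> is a metric\<close>

lemma is_lift_step:
  assumes "is_lift F f"
  obtains m :: int where "\<And>x. F (x + 1) = F x + of_int m"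
proof -
  have cont: "continuous_on UNIV (\<lambda>x. F (x + 1) - F x)"
  proof -
    have F: "continuous_on UNIV F" using assms by (simp add: is_lift_def)
    have "continuous_on UNIV (\<lambda>x :: real. x + 1)" by (intro continuous_intros)
    with F have "continuous_on UNIV (\<lambda>x. F (x + 1))" by (rule continuous_on_compose2) auto
    then show ?thesis using F by (rule continuous_on_diff)
  qed
  have int: "F (x + 1) - F x \<in> \<int>" for x
  proof -
    have "circle_of (x + 1) = circle_of x" by (simp add: circle_of_eq_iff)
    then have "circle_of (F (x + 1)) = circle_of (F x)"
      using assms by (simp add: is_lift_def)
    then show ?thesis by (simp add: circle_of_eq_iff)
  qed
  have "(\<lambda>x. F (x + 1) - F x) constant_on UNIV"
  proof (rule continuous_discrete_range_constant[OF connected_UNIV cont])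
    fix x :: real
    show "\<exists>e>0. \<forall>y. y \<in> UNIV \<and> F (y + 1) - F y \<noteq> F (x + 1) - F x
        \<longrightarrow> e \<le> norm (F (y + 1) - F y - (F (x + 1) - F x))"
    proof (intro exI[of _ 1] conjI allI impI)
      fix y
      assume "y \<in> UNIV \<and> F (y + 1) - F y \<noteq> F (x + 1) - F x"
      then show "1 \<le> norm (F (y + 1) - F y - (F (x + 1) - F x))"
        using Ints_nonzero_abs_ge1[of "F (y + 1) - F y - (F (x + 1) - F x)"] int by auto
    qed simp
  qed
  then obtain c where c: "\<And>x. F (x + 1) - F x = c" by (auto simp: constant_on_def)
  moreover obtain m where "c = of_int m" using int[of 0] c[of 0] by (auto elim: Ints_cases)
  ultimately have "F (x + 1) = F x + of_int m" for x using c[of x] by linarith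
  then show thesis by (rule that)
qed

lemma is_lift_lift_of:
  assumes "f \<in> H_homeo"
  shows "is_lift (lift_of f) f"
proof -
  have "\<exists>F. is_lift F f" using assms by (auto simp: H_homeo_def)
  then show ?thesis unfolding lift_of_def by (rule someI_ex)
qed

lemma bij_H_homeo: "f \<in> H_homeo \<Longrightarrow> bij f"
  unfolding H_homeo_def homeomorphism_def bij_def
  by (metis (mono_tags, lifting) UNIV_I inj_on_inverseI mem_Collect_eq)

lemma inv_H_homeo:
  assumes "f \<in> H_homeo"
  shows "inv f \<in> H_homeo"
proof -
  have bij: "bij f" using assms by (rule bij_H_homeo)
  obtain F where F: "is_lift F f" "strict_mono F" using assms by (auto simp: H_homeo_def)
  have contF: "continuous_on UNIV F" and Ff: "\<And>x. circle_of (F x) = f (circle_of x)"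
    using F by (auto simp: is_lift_def)
  obtain m :: int where m: "\<And>x. F (x + 1) = F x + of_int m" using is_lift_step[OF F(1)] by blast
  have "F 0 < F 1" using F(2) by (simp add: strict_mono_def)
  then have m1: "1 \<le> m" using m[of 0] by simp
  have up: "F (real n) \<ge> F 0 + real n" for n
  proof (induction n)
    case (Suc n)
    then show ?case using m[of "real n"] m1 by (simp add: add.commute)
  qed simp
  have down: "F (- real n) \<le> F 0 - real n" for n
  proof (induction n)
    case (Suc n)
    then show ?case using m[of "- real (Suc n)"] m1 by simp
  qed simp
  have "surj F"
  proof (rule surjI[of F "\<lambda>y. SOME x. F x = y"])
    fix y
    obtain n :: nat where "\<bar>y - F 0\<bar> \<le> real n" using real_arch_simple by blast
    then have "F (- real n) \<le> y" "y \<le> F (real n)" using up[of n] down[of n] by auto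
    then have "\<exists>x. - real n \<le> x \<and> x \<le> real n \<and> F x = y"
      by (intro IVT') (auto intro: continuous_on_subset[OF contF])
    then show "F (SOME x. F x = y) = y" by (metis (mono_tags, lifting) someI)
  qed
  define G where "G = inv F"
  have FG: "F (G y) = y" for y using \<open>surj F\<close> by (simp add: G_def surj_f_inv_f)
  have smG: "strict_mono G"
    unfolding strict_mono_def using F(2) FG by (metis strict_mono_less)
  have "range G = UNIV"
    using F(2) by (simp add: G_def inj_imp_surj_inv strict_mono_imp_inj_on)
  then have "continuous_on UNIV G"
    using smG by (intro continuous_onI_mono) (auto simp: strict_mono_less_eq)
  moreover have "circle_of (G y) = inv f (circle_of y)" for y
    using Ff[of "G y"] FG bij by (metis bij_inv_eq_iff)
  ultimately have "is_lift G (inv f)" by (simp add: is_lift_def)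
  moreover have "homeomorphism UNIV UNIV (inv f) (inv (inv f))"
    using assms bij by (simp add: H_homeo_def inv_inv_eq homeomorphism_symD)
  ultimately show ?thesis using smG by (auto simp: H_homeo_def)
qed

lemma H_diff_0: "H_diff 0 = H_homeo"
  using is_lift_lift_of inv_H_homeo by (auto simp: H_diff_def C_k_def is_lift_def)

lemma inv_H_inf: "f \<in> H_inf \<Longrightarrow> inv f \<in> H_inf"
  by (auto simp: H_inf_def H_diff_def inv_H_homeo inv_inv_eq bij_H_homeo)

lemma deriv_iterate_periodic:
  assumes "is_lift F f"
  shows "(deriv ^^ Suc i) F (x + 1) = (deriv ^^ Suc i) F x"
proof -
  obtain m :: int where m: "\<And>x. F (x + 1) = F x + of_int m" using is_lift_step[OF assms] by blast
  have *: "deriv G (x + 1) = deriv G x" if "\<And>x. G (x + 1) = G x + c" for G :: "real \<Rightarrow> real" and c x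
  proof -
    have "(G has_field_derivative D) (at (x + 1)) \<longleftrightarrow> (G has_field_derivative D) (at x)" for D
    proof -
      have "(G has_field_derivative D) (at (x + 1))
          \<longleftrightarrow> ((\<lambda>x. G x + c) has_field_derivative D) (at x)"
        using that by (simp add: DERIV_shift)
      also have "\<dots> \<longleftrightarrow> (G has_field_derivative D) (at x)"
      proof
        assume "((\<lambda>x. G x + c) has_field_derivative D) (at x)"
        from DERIV_diff[OF this DERIV_const[of c]]
        show "(G has_field_derivative D) (at x)" by simp
      next
        assume "(G has_field_derivative D) (at x)"
        from DERIV_add[OF this DERIV_const[of c]]
        show "((\<lambda>x. G x + c) has_field_derivative D) (at x)" by simp
      qed
      finally show ?thesis .
    qed
    then show ?thesis by (simp add: deriv_def)
  qed
  show ?thesis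
  proof (induction i arbitrary: x)
    case 0
    show ?case using *[of F "of_int m" x] m by simp
  next
    case (Suc i)
    show ?case using *[of "(deriv ^^ Suc i) F" 0 x] Suc.IH by simp
  qed
qed

lemma circle_deriv_bounded:
  assumes "f \<in> H_inf" "0 < i"
  obtains B where "\<And>z. \<bar>circle_deriv i f z\<bar> \<le> B"
proof -
  let ?G = "(deriv ^^ i) (lift_of f)"
  obtain j where j: "i = Suc j" using assms(2) by (cases i) auto
  have fd: "f \<in> H_diff i" using assms by (auto simp: H_inf_def)
  then have "is_lift (lift_of f) f" and cont: "continuous_on UNIV ?G"
    by (auto simp: H_diff_def C_k_def is_lift_lift_of)
  then have per: "?G (x + 1) = ?G x" for x unfolding j by (intro deriv_iterate_periodic)
  have pern: "?G (x + real n) = ?G x" for x n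
  proof (induction n)
    case (Suc n)
    then show ?case using per[of "x + real n"] by (simp add: add_ac)
  qed simp
  have perz: "?G (frac x) = ?G x" for x
  proof (cases "0 \<le> \<lfloor>x\<rfloor>")
    case True
    then show ?thesis using pern[of "frac x" "nat \<lfloor>x\<rfloor>"] by (simp add: frac_def)
  next
    case False
    then show ?thesis using pern[of x "nat (- \<lfloor>x\<rfloor>)"] by (simp add: frac_def)
  qed
  have "compact (?G ` {0..1})"
    by (intro compact_continuous_image continuous_on_subset[OF cont]) auto
  then obtain B where B: "\<And>x. x \<in> {0..1} \<Longrightarrow> \<bar>?G x\<bar> \<le> B"
    using compact_imp_bounded bounded_iff by (metis image_eqI real_norm_def)
  have "\<bar>circle_deriv i f z\<bar> \<le> B" for z
    using B[of "frac (rep_circle z)"] perz[of "rep_circle z"]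
    by (simp add: circle_deriv_def frac_lt_1 less_imp_le)
  then show thesis using that by blast
qed

lemma
  assumes "f \<in> H_inf" "g \<in> H_inf"
  shows sup_diff_upper_0: "dist (f x) (g x) \<le> sup_diff 0 f g"
    and sup_diff_upper: "0 < i \<Longrightarrow> \<bar>circle_deriv i f x - circle_deriv i g x\<bar> \<le> sup_diff i f g"
proof -
  have "bdd_above (range (\<lambda>x. dist (f x) (g x)))"
    using dist_circle_le_half by (intro bdd_aboveI[of _ "1 / 2"]) blast
  then show "dist (f x) (g x) \<le> sup_diff 0 f g"
    using cSUP_upper[of x UNIV "\<lambda>x. dist (f x) (g x)"] by (simp add: sup_diff_def)
next
  assume i: "0 < i"
  obtain A B where "\<And>z. \<bar>circle_deriv i f z\<bar> \<le> A" "\<And>z. \<bar>circle_deriv i g z\<bar> \<le> B"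
    using circle_deriv_bounded assms i by metis
  then have "\<bar>circle_deriv i f z - circle_deriv i g z\<bar> \<le> A + B" for z
    using abs_triangle_ineq4 add_mono order_trans by meson
  then have "bdd_above (range (\<lambda>x. \<bar>circle_deriv i f x - circle_deriv i g x\<bar>))"
    by (intro bdd_aboveI[of _ "A + B"]) auto
  then show "\<bar>circle_deriv i f x - circle_deriv i g x\<bar> \<le> sup_diff i f g"
    using i cSUP_upper[OF UNIV_I] by (fastforce simp: sup_diff_def)
qed

lemma sup_diff_nonneg:
  assumes "f \<in> H_inf" "g \<in> H_inf"
  shows "0 \<le> sup_diff i f g"
  using sup_diff_upper_0[OF assms] sup_diff_upper[OF assms, of i]
  by (cases "i = 0") (meson order_trans zero_le_dist abs_ge_zero, meson neq0_conv order_trans abs_ge_zero)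

lemma sup_diff_commute: "sup_diff i f g = sup_diff i g f"
  by (simp add: sup_diff_def dist_commute abs_minus_commute)

lemma sup_diff_self: "sup_diff i f f = 0"
  by (simp add: sup_diff_def)

lemma sup_diff_triangle:
  assumes "f \<in> H_inf" "g \<in> H_inf" "h \<in> H_inf"
  shows "sup_diff i f h \<le> sup_diff i f g + sup_diff i g h"
proof (cases "i = 0")
  case True
  have "dist (f x) (h x) \<le> sup_diff 0 f g + sup_diff 0 g h" for x
    using sup_diff_upper_0[OF assms(1,2), of x] sup_diff_upper_0[OF assms(2,3), of x]
      dist_triangle[of "f x" "h x" "g x"] by linarith
  then show ?thesis
    using True by (simp add: sup_diff_def[of 0 f h] cSUP_least)
next
  case False
  have "\<bar>circle_deriv i f x - circle_deriv i h x\<bar> \<le> sup_diff i f g + sup_diff i g h" for x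
    using False sup_diff_upper[OF assms(1,2), of i x] sup_diff_upper[OF assms(2,3), of i x]
    by linarith
  then show ?thesis
    using False by (simp add: sup_diff_def[of i f h] cSUP_least)
qed

lemma norm_diff_upper: "i \<le> k \<Longrightarrow> sup_diff i f g \<le> norm_diff k f g"
  by (simp add: norm_diff_def)

lemma norm_diff_nonneg: "f \<in> H_inf \<Longrightarrow> g \<in> H_inf \<Longrightarrow> 0 \<le> norm_diff k f g"
  using sup_diff_nonneg norm_diff_upper[of 0 k] order_trans by blast

lemma norm_diff_triangle:
  assumes "f \<in> H_inf" "g \<in> H_inf" "h \<in> H_inf"
  shows "norm_diff k f h \<le> norm_diff k f g + norm_diff k g h"
proof -
  have "sup_diff i f h \<le> norm_diff k f g + norm_diff k g h" if "i \<le> k" for i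
    using sup_diff_triangle[OF assms, of i] norm_diff_upper[OF that, of f g]
      norm_diff_upper[OF that, of g h] by linarith
  then show ?thesis by (simp add: norm_diff_def[of k f h])
qed

lemma d_k_nonneg: "f \<in> H_inf \<Longrightarrow> g \<in> H_inf \<Longrightarrow> 0 \<le> d_k k f g"
  by (simp add: d_k_def norm_diff_nonneg le_max_iff_disj)

lemma d_k_commute: "d_k k f g = d_k k g f"
  by (simp add: d_k_def norm_diff_def sup_diff_commute[of _ f] sup_diff_commute[of _ "inv f"])

lemma d_k_triangle:
  assumes "f \<in> H_inf" "g \<in> H_inf" "h \<in> H_inf"
  shows "d_k k f h \<le> d_k k f g + d_k k g h"
  using norm_diff_triangle[OF assms, of k] norm_diff_triangle[OF assms[THEN inv_H_inf], of k]
  unfolding d_k_def by linarith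

lemma d_k_eq_0:
  assumes "f \<in> H_inf" "g \<in> H_inf" "d_k k f g = 0"
  shows "f = g"
proof
  fix x
  have "dist (f x) (g x) \<le> norm_diff k f g"
    using sup_diff_upper_0[OF assms(1,2)] norm_diff_upper[of 0 k f g] order_trans by blast
  also have "\<dots> \<le> 0" using assms(3) by (simp add: d_k_def max_def split: if_splits)
  finally show "f x = g x" by simp
qed

lemma bounded_metric_triangle:
  fixes a b c :: real
  assumes "0 \<le> a" "0 \<le> b" "0 \<le> c" "c \<le> a + b"
  shows "c / (1 + c) \<le> a / (1 + a) + b / (1 + b)"
proof -
  have "c / (1 + c) \<le> (a + b) / (1 + (a + b))"
    using assms by (simp add: divide_simps algebra_simps)
  also have "\<dots> = a / (1 + (a + b)) + b / (1 + (a + b))" by (simp add: add_divide_distrib)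
  also have "\<dots> \<le> a / (1 + a) + b / (1 + b)"
    using assms by (intro add_mono divide_left_mono) auto
  finally show ?thesis .
qed

lemma d_inf_summable:
  assumes "f \<in> H_inf" "g \<in> H_inf"
  shows "summable (\<lambda>k. d_k (Suc k) f g / (2 ^ Suc k * (1 + d_k (Suc k) f g)))"
proof (rule summable_comparison_test[OF _ summable_geometric[of "1 / 2 :: real"]])
  have "d_k (Suc k) f g / (2 ^ Suc k * (1 + d_k (Suc k) f g)) \<le> (1 / 2) ^ k" for k
  proof -
    have "d_k (Suc k) f g / (1 + d_k (Suc k) f g) \<le> 1"
      using d_k_nonneg[OF assms, of "Suc k"] by simp
    then have "d_k (Suc k) f g / (1 + d_k (Suc k) f g) / 2 ^ Suc k \<le> 1 / 2 ^ Suc k"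
      by (intro divide_right_mono) auto
    also have "\<dots> \<le> (1 / 2) ^ k" by (simp add: power_one_over field_simps)
    finally show ?thesis by (simp add: mult.commute)
  qed
  then show "\<exists>N. \<forall>k\<ge>N. norm (d_k (Suc k) f g / (2 ^ Suc k * (1 + d_k (Suc k) f g))) \<le> (1 / 2) ^ k"
    using d_k_nonneg[OF assms] by (intro exI[of _ 0]) auto
qed simp

lemma Metric_space_d_inf: "Metric_space H_inf d_inf"
proof
  fix f g
  show "0 \<le> d_inf f g"
  proof (cases "f \<in> H_inf \<and> g \<in> H_inf")
    case True
    then have fg: "f \<in> H_inf" "g \<in> H_inf" by auto
    then have "0 \<le> (\<Sum>k. d_k (Suc k) f g / (2 ^ Suc k * (1 + d_k (Suc k) f g)))"
      using d_k_nonneg[OF fg] by (intro suminf_nonneg d_inf_summable) auto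
    then show ?thesis using True by (simp add: d_inf_def)
  qed (auto simp: d_inf_def)
  show "d_inf f g = d_inf g f"
    by (simp add: d_inf_def d_k_commute[of _ f g])
next
  fix f g
  assume fg: "f \<in> H_inf" "g \<in> H_inf"
  let ?s = "\<lambda>k. d_k (Suc k) f g / (2 ^ Suc k * (1 + d_k (Suc k) f g))"
  show "d_inf f g = 0 \<longleftrightarrow> f = g"
  proof
    assume "d_inf f g = 0"
    then have sum0: "suminf ?s = 0" using fg by (simp add: d_inf_def)
    have nn: "0 \<le> ?s k" for k using d_k_nonneg[OF fg] by simp
    have "\<forall>k. ?s k = 0" using suminf_eq_zero_iff[OF d_inf_summable[OF fg] nn] sum0 by blast
    then have "?s 0 = 0" by blast
    then have "d_k 1 f g = 0" using d_k_nonneg[OF fg, of "Suc 0"] by auto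
    then show "f = g" using d_k_eq_0 fg by blast
  next
    assume "f = g"
    have "d_k k f f = 0" for k
      by (simp add: d_k_def norm_diff_def sup_diff_self image_constant_conv)
    then show "d_inf f g = 0" using \<open>f = g\<close> by (simp add: d_inf_def)
  qed
next
  fix f g h
  assume fgh: "f \<in> H_inf" "g \<in> H_inf" "h \<in> H_inf"
  let ?s = "\<lambda>f g k. d_k (Suc k) f g / (2 ^ Suc k * (1 + d_k (Suc k) f g))"
  have "?s f h k \<le> ?s f g k + ?s g h k" for k
  proof -
    have "d_k (Suc k) f h / (1 + d_k (Suc k) f h) / 2 ^ Suc k
        \<le> (d_k (Suc k) f g / (1 + d_k (Suc k) f g) + d_k (Suc k) g h / (1 + d_k (Suc k) g h)) / 2 ^ Suc k"
      using fgh by (intro divide_right_mono bounded_metric_triangle d_k_nonneg d_k_triangle) auto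
    then show ?thesis by (simp only: divide_divide_eq_left add_divide_distrib mult.commute)
  qed
  then have "suminf (?s f h) \<le> (\<Sum>k. ?s f g k + ?s g h k)"
    using fgh by (intro suminf_le d_inf_summable summable_add) auto
  also have "\<dots> = suminf (?s f g) + suminf (?s g h)"
    using fgh by (intro suminf_add[symmetric] d_inf_summable) auto
  finally show "d_inf f h \<le> d_inf f g + d_inf g h"
    using fgh by (simp add: d_inf_def)
qed

end

theory Submission
  imports Defs "HOL-Probability.Probability"
begin

text \<open>The idea is an Anosov--Katok construction parametrised by coin tosses. For
  \<open>x : nat \<Rightarrow> bool\<close> let \<open>h\<^sub>n\<close> be the composition of those maps \<open>A\<^sub>i\<close>, \<open>i < n\<close>, for which \<open>x i\<close>
  holds, where \<open>A\<^sub>i\<close> is the lift of a strongly hyperbolic Moebius map of the circle to the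
  \<open>q\<^sub>i\<close>-fold cover. Since \<open>A\<^sub>n\<close> commutes with the rotation by \<open>p/q\<^sub>n\<close> and its \<open>C\<^sup>k\<close> norms are
  polynomial in \<open>q\<^sub>n\<close>, the Liouville property lets one choose \<open>q\<^sub>n\<close> such that passing from \<open>h\<^sub>n\<close>
  to \<open>h\<^sub>n\<close> composed with \<open>A\<^sub>n\<close> barely moves the conjugate of the rotation by \<open>\<alpha>\<close> in the
  smooth topology. The limits \<open>Phi x\<close> are smooth and depend continuously on \<open>x\<close>. Sequences that
  eventually agree give smoothly conjugate diffeomorphisms. For all other pairs, one of the two
  possible directions has no Hoelder conjugacy: the centraliser of an irrational rotation consists
  of rotations, so a conjugacy is \<open>H\<^sub>x\<close> composed with a rotation and the inverse of \<open>H\<^sub>y\<close>, and at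
  infinitely many scales it expands an interval of length about \<open>1/q\<^sub>n\<^sup>n\<close> to one of length
  about \<open>1/q\<^sub>n\<^sup>2\<close>. Hence a complete Borel invariant would give one for eventual agreement of
  coin tosses, which Kolmogorov's zero-one law excludes.\<close>

section \<open>Bounds on derivatives\<close>

text \<open>The partial conjugacies are controlled only uniformly, whereas the conjugated rotations
  converge with all derivatives; every estimate is arranged around this gap. Moebius maps suit it
  because the inverse has the same form with the opposite parameter, the displacement is bounded
  independently of the parameter, and the derivative is a Poisson kernel, which is polynomially
  large when the parameter is polynomially close to 1. That polynomial rate gets faster from stage
  to stage, so a single family defeats every Hoelder exponent. Only finitely many partial
  conjugacies exist at each stage, so one scale serves all coin sequences. The stretching shows at
  indices where the target sequence has a stage that the source sequence lacks; at the opposite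
  indices the conjugacy contracts, which a Hoelder bound does not forbid. This is why a single
  direction is refuted. An unknown rotation sits between the two limit conjugacies, so the stretched
  interval is found by pulling back through them.\<close>

primrec deriv_bound :: "nat \<Rightarrow> (real \<Rightarrow> real) \<Rightarrow> real \<Rightarrow> bool" where
  "deriv_bound 0 f C \<longleftrightarrow> continuous_on UNIV f \<and> (\<forall>x. \<bar>f x\<bar> \<le> C)"
| "deriv_bound (Suc k) f C \<longleftrightarrow> (\<forall>x. \<bar>f x\<bar> \<le> C) \<and> (\<forall>x. f differentiable (at x)) \<and> deriv_bound k (deriv f) C"

lemma deriv_eqI:
  assumes "\<And>x. (f has_field_derivative f' x) (at x)"
  shows "deriv f = f'"
  using assms by (auto intro!: ext DERIV_imp_deriv)

lemma deriv_bound_SucI: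
  assumes "\<And>x. \<bar>f x\<bar> \<le> C" "\<And>x. (f has_field_derivative f' x) (at x)" "deriv_bound k f' C"
  shows "deriv_bound (Suc k) f C"
  using assms deriv_eqI[OF assms(2)] by (auto simp: real_differentiable_def)

lemma deriv_bound_SucD: "deriv_bound (Suc k) f C \<Longrightarrow> (f has_field_derivative deriv f x) (at x)"
  by (simp add: DERIV_deriv_iff_real_differentiable)

lemma deriv_bound_abs: "deriv_bound k f C \<Longrightarrow> \<bar>f x\<bar> \<le> C"
  by (cases k) auto

lemma deriv_bound_nonneg: "deriv_bound k f C \<Longrightarrow> 0 \<le> C"
  using deriv_bound_abs[of k f C 0] by linarith

lemma deriv_bound_mono: "deriv_bound k f C \<Longrightarrow> C \<le> C' \<Longrightarrow> deriv_bound k f C'"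
  by (induction k arbitrary: f) (auto intro: order_trans)

lemma deriv_bound_continuous: "deriv_bound k f C \<Longrightarrow> continuous_on UNIV f"
  by (cases k) (auto intro!: continuous_at_imp_continuous_on differentiable_imp_continuous_within)

lemma deriv_bound_Suc_imp: "deriv_bound (Suc k) f C \<Longrightarrow> deriv_bound k f C"
proof (induction k arbitrary: f)
  case 0
  from deriv_bound_continuous[OF this] 0 show ?case by simp
next
  case (Suc k)
  then show ?case by simp
qed

lemma deriv_bound_le: "deriv_bound k f C \<Longrightarrow> i \<le> k \<Longrightarrow> deriv_bound i f C"
  by (induction k) (auto simp del: deriv_bound.simps(2) dest: deriv_bound_Suc_imp simp: le_Suc_eq)

lemma one_le_pow2_mult: "1 \<le> K \<Longrightarrow> 1 \<le> 2 ^ k * (K :: real)"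
  using mult_mono[of 1 "2 ^ k :: real" 1 K] by (simp del: power_Suc)

lemma deriv_bound_const: "\<bar>c\<bar> \<le> C \<Longrightarrow> deriv_bound k (\<lambda>x. c) C"
proof (induction k arbitrary: c)
  case (Suc k)
  show ?case by (rule deriv_bound_SucI[where f' = "\<lambda>x. 0"]) (use Suc in auto)
qed auto

lemma deriv_bound_add:
  "deriv_bound k f A \<Longrightarrow> deriv_bound k g B \<Longrightarrow> deriv_bound k (\<lambda>x. f x + g x) (A + B)"
proof (induction k arbitrary: f g)
  case 0
  then show ?case by (auto intro!: continuous_intros abs_triangle_ineq[THEN order_trans] add_mono)
next
  case (Suc k)
  show ?case
  proof (rule deriv_bound_SucI[where f' = "\<lambda>x. deriv f x + deriv g x"])
    show "\<bar>f x + g x\<bar> \<le> A + B" for x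
      using Suc.prems[THEN deriv_bound_abs, of x] by linarith
    show "((\<lambda>x. f x + g x) has_field_derivative deriv f x + deriv g x) (at x)" for x
      by (rule DERIV_add; rule deriv_bound_SucD; fact)
    show "deriv_bound k (\<lambda>x. deriv f x + deriv g x) (A + B)"
      using Suc by simp
  qed
qed

lemma deriv_bound_cmult: "deriv_bound k f A \<Longrightarrow> deriv_bound k (\<lambda>x. c * f x) (\<bar>c\<bar> * A)"
proof (induction k arbitrary: f)
  case 0
  then show ?case by (auto intro!: continuous_intros mult_left_mono simp: abs_mult)
next
  case (Suc k)
  show ?case
  proof (rule deriv_bound_SucI[where f' = "\<lambda>x. c * deriv f x"])
    show "\<bar>c * f x\<bar> \<le> \<bar>c\<bar> * A" for x
      using Suc.prems[THEN deriv_bound_abs, of x] by (auto simp: abs_mult intro: mult_left_mono)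
    show "((\<lambda>x. c * f x) has_field_derivative c * deriv f x) (at x)" for x
      by (rule DERIV_cmult; rule deriv_bound_SucD; fact)
    show "deriv_bound k (\<lambda>x. c * deriv f x) (\<bar>c\<bar> * A)"
      using Suc by simp
  qed
qed

lemma deriv_bound_diff:
  assumes "deriv_bound k f A" "deriv_bound k g B"
  shows "deriv_bound k (\<lambda>x. f x - g x) (A + B)"
  using deriv_bound_add[OF assms(1) deriv_bound_cmult[OF assms(2), of "-1"]] by simp

text \<open>The factor \<open>2 ^ k\<close> counts the terms of the Leibniz rule: each
  differentiation of a product doubles their number.\<close>

lemma deriv_bound_mult:
  "deriv_bound k f A \<Longrightarrow> deriv_bound k g B \<Longrightarrow> deriv_bound k (\<lambda>x. f x * g x) (2 ^ k * A * B)"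
proof (induction k arbitrary: f g)
  case 0
  then show ?case by (auto intro!: continuous_intros mult_mono simp: abs_mult intro: order_trans[OF abs_ge_zero])
next
  case (Suc k)
  have AB: "0 \<le> A * B" using Suc.prems[THEN deriv_bound_nonneg] by simp
  show ?case
  proof (rule deriv_bound_SucI[where f' = "\<lambda>x. f x * deriv g x + deriv f x * g x"])
    show "\<bar>f x * g x\<bar> \<le> 2 ^ Suc k * A * B" for x
    proof -
      have "\<bar>f x * g x\<bar> \<le> A * B"
        using Suc.prems[THEN deriv_bound_abs, of x] Suc.prems[THEN deriv_bound_nonneg] by (auto simp: abs_mult intro: mult_mono)
      also have "\<dots> \<le> 2 ^ Suc k * (A * B)"
        using AB mult_right_mono[of 1 "2 ^ Suc k :: real" "A * B"] by (simp del: power_Suc)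
      finally show ?thesis by (simp add: mult.assoc)
    qed
    show "((\<lambda>x. f x * g x) has_field_derivative f x * deriv g x + deriv f x * g x) (at x)" for x
      by (rule DERIV_mult'; rule deriv_bound_SucD; fact)
    have "deriv_bound k (\<lambda>x. f x * deriv g x) (2 ^ k * A * B)" "deriv_bound k (\<lambda>x. deriv f x * g x) (2 ^ k * A * B)"
      using Suc.prems[THEN deriv_bound_Suc_imp] Suc.prems Suc.IH by auto
    from deriv_bound_add[OF this]
    show "deriv_bound k (\<lambda>x. f x * deriv g x + deriv f x * g x) (2 ^ Suc k * A * B)"
      by (simp add: algebra_simps)
  qed
qed

text \<open>A crude form of the formula of Faa di Bruno: each differentiation costs a factor
  \<open>K\<close> from the inner derivative and a power of 2 from the product rule. Bounding
  \<open>g'\<close> instead of \<open>g\<close> admits lifts of circle maps, which are unbounded.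
  The result is linear in \<open>F\<close> and polynomial in \<open>K\<close>.\<close>

lemma deriv_bound_compose:
  assumes "\<And>x. (g has_field_derivative g' x) (at x)" "deriv_bound k g' K" "1 \<le> K" "deriv_bound k f F"
  shows "deriv_bound k (\<lambda>x. f (g x)) (F * (2 ^ k * K) ^ k)"
  using assms(2,4)
proof (induction k arbitrary: f)
  case 0
  have "continuous_on UNIV g"
    using assms(1) by (meson DERIV_isCont continuous_at_imp_continuous_on)
  with 0 show ?case
    by (auto intro: continuous_on_compose2)
next
  case (Suc k)
  have F: "0 \<le> F" using Suc.prems(2) by (rule deriv_bound_nonneg)
  have g'k: "deriv_bound k g' K" using Suc.prems(1) by (rule deriv_bound_Suc_imp)
  have one: "1 \<le> (2 ^ Suc k * K) ^ Suc k"
    using assms(3) by (intro one_le_power one_le_pow2_mult)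
  show ?case
  proof (rule deriv_bound_SucI[where f' = "\<lambda>x. deriv f (g x) * g' x"])
    show "\<bar>f (g x)\<bar> \<le> F * (2 ^ Suc k * K) ^ Suc k" for x
      using deriv_bound_abs[OF Suc.prems(2), of "g x"] mult_left_mono[OF one F] by simp
    show "((\<lambda>x. f (g x)) has_field_derivative deriv f (g x) * g' x) (at x)" for x
      using DERIV_chain2[OF deriv_bound_SucD[OF Suc.prems(2)] assms(1)] .
    have "deriv_bound k (\<lambda>x. deriv f (g x)) (F * (2 ^ k * K) ^ k)"
      using Suc.IH[OF g'k] Suc.prems(2) by simp
    from deriv_bound_mult[OF this g'k]
    show "deriv_bound k (\<lambda>x. deriv f (g x) * g' x) (F * (2 ^ Suc k * K) ^ Suc k)"
    proof (rule deriv_bound_mono)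
      have "2 ^ k * (F * (2 ^ k * K) ^ k) * K = F * (2 ^ k * K) ^ Suc k" by simp
      also have "\<dots> \<le> F * (2 ^ Suc k * K) ^ Suc k"
        using F assms(3) by (intro mult_left_mono power_mono) auto
      finally show "2 ^ k * (F * (2 ^ k * K) ^ k) * K \<le> F * (2 ^ Suc k * K) ^ Suc k" .
    qed
  qed
qed

text \<open>The bound is linear in the distance \<open>e\<close> of the inner maps, at the price of
  one more derivative of \<open>f\<close>. The derivative of the difference splits into
  \<open>(f' (g x) - f' (h x)) * g' x\<close>, which is the same problem for \<open>f'\<close>, and
  \<open>f' (h x) * (g' x - h' x)\<close>, which is small by hypothesis.\<close>

lemma deriv_bound_compose_diff:
  assumes g: "\<And>x. (g has_field_derivative g' x) (at x)" "deriv_bound k g' K" 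
    and h: "\<And>x. (h has_field_derivative h' x) (at x)" "deriv_bound k h' K" 
    and f: "\<And>x. (f has_field_derivative f' x) (at x)" "deriv_bound k f' F" 
    and "deriv_bound k (\<lambda>x. g x - h x) e" "1 \<le> K"
  shows "deriv_bound k (\<lambda>x. f (g x) - f (h x)) (F * e * (2 ^ Suc k * K) ^ Suc k)"
  using assms(2,4,5,6,7)
proof (induction k arbitrary: f f')
  case 0
  have F: "0 \<le> F" using "0.prems"(4) by (rule deriv_bound_nonneg)
  have e: "0 \<le> e" using "0.prems"(5) by (rule deriv_bound_nonneg)
  have c: "continuous_on UNIV g" "continuous_on UNIV h" "continuous_on UNIV f"
    using g h "0.prems"(3) by (meson DERIV_isCont continuous_at_imp_continuous_on)+
  have "\<bar>f (g x) - f (h x)\<bar> \<le> F * e * (2 ^ Suc 0 * K) ^ Suc 0" for x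
  proof -
    have "norm (f (g x) - f (h x)) \<le> F * norm (g x - h x)"
      by (rule field_differentiable_bound[of UNIV f f'])
         (use "0.prems" in \<open>auto intro: has_field_derivative_at_within\<close>)
    also have "\<dots> \<le> F * e"
      using "0.prems"(5) F by (intro mult_left_mono) auto
    also have "\<dots> \<le> F * e * (2 ^ Suc 0 * K) ^ Suc 0"
      using F e \<open>1 \<le> K\<close> mult_left_mono[of 1 "2 * K" "F * e"] by simp
    finally show ?thesis by simp
  qed
  moreover have "continuous_on UNIV (\<lambda>x. f (g x) - f (h x))"
    by (intro continuous_on_diff continuous_on_compose2[OF c(3)] c) auto
  ultimately show ?case by simp
next
  case (Suc k)
  have F: "0 \<le> F" using Suc.prems(4) by (rule deriv_bound_nonneg)
  have e: "0 \<le> e" using Suc.prems(5) by (rule deriv_bound_nonneg)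
  have g'k: "deriv_bound k g' K" and h'k: "deriv_bound k h' K" and f'k: "deriv_bound k f' F" and gh: "deriv_bound k (\<lambda>x. g x - h x) e"
    using Suc.prems by (auto intro: deriv_bound_Suc_imp simp del: deriv_bound.simps(2))
  have ghd: "deriv (\<lambda>x. g x - h x) = (\<lambda>x. g' x - h' x)"
    by (rule deriv_eqI) (intro DERIV_diff g h)
  have gh': "deriv_bound k (\<lambda>x. g' x - h' x) e"
    using Suc.prems(5) ghd by simp
  let ?C = "F * e * (2 ^ Suc (Suc k) * K) ^ Suc (Suc k)"
  have P: "deriv_bound k (\<lambda>x. f (g x) - f (h x)) (F * e * (2 ^ Suc k * K) ^ Suc k)"
    using Suc.IH[OF g'k h'k Suc.prems(3) f'k gh] .
  have le: "(2 ^ Suc k * K) ^ Suc k \<le> (2 ^ Suc (Suc k) * K) ^ Suc (Suc k)"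
  proof -
    have "(2 ^ Suc k * K) ^ Suc k \<le> (2 ^ Suc (Suc k) * K) ^ Suc k"
      using \<open>1 \<le> K\<close> by (intro power_mono) auto
    also have "\<dots> \<le> (2 ^ Suc (Suc k) * K) ^ Suc (Suc k)"
      using \<open>1 \<le> K\<close> by (intro power_increasing one_le_pow2_mult) auto
    finally show ?thesis .
  qed
  show ?case
  proof (rule deriv_bound_SucI[where f' = "\<lambda>x. (f' (g x) - f' (h x)) * g' x + f' (h x) * (g' x - h' x)"])
    show "\<bar>f (g x) - f (h x)\<bar> \<le> ?C" for x
      using deriv_bound_abs[OF P, of x] mult_left_mono[OF le, of "F * e"] F e by (meson mult_nonneg_nonneg order_trans)
    show "((\<lambda>x. f (g x) - f (h x)) has_field_derivative
        (f' (g x) - f' (h x)) * g' x + f' (h x) * (g' x - h' x)) (at x)" for x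
      using DERIV_diff[OF DERIV_chain2[OF Suc.prems(3) g(1)] DERIV_chain2[OF Suc.prems(3) h(1)], of x]
      by (simp add: algebra_simps)
    have "deriv_bound k (\<lambda>x. f' (g x) - f' (h x)) (F * e * (2 ^ Suc k * K) ^ Suc k)"
      using Suc.IH[OF g'k h'k deriv_bound_SucD[OF Suc.prems(4)] _ gh] Suc.prems(4) by simp
    from deriv_bound_mult[OF this g'k] deriv_bound_mult[OF deriv_bound_compose[OF h(1) h'k \<open>1 \<le> K\<close> f'k] gh']
    have "deriv_bound k (\<lambda>x. (f' (g x) - f' (h x)) * g' x + f' (h x) * (g' x - h' x))
        (2 ^ k * (F * e * (2 ^ Suc k * K) ^ Suc k) * K + 2 ^ k * (F * (2 ^ k * K) ^ k) * e)"
      by (rule deriv_bound_add)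
    then show "deriv_bound k (\<lambda>x. (f' (g x) - f' (h x)) * g' x + f' (h x) * (g' x - h' x)) ?C"
    proof (rule deriv_bound_mono)
      define X where "X = (2 ^ Suc (Suc k) * K) ^ Suc k"
      have a: "(2 ^ Suc k * K) ^ Suc k \<le> X"
        unfolding X_def using \<open>1 \<le> K\<close> by (intro power_mono) auto
      have "(2 ^ k * K) ^ k \<le> (2 ^ Suc (Suc k) * K) ^ k"
        using \<open>1 \<le> K\<close> by (intro power_mono mult_right_mono power_increasing) auto
      also have "\<dots> \<le> X"
        unfolding X_def using \<open>1 \<le> K\<close> by (intro power_increasing one_le_pow2_mult) auto
      finally have b: "(2 ^ k * K) ^ k \<le> X" .
      have X: "0 \<le> X" unfolding X_def using \<open>1 \<le> K\<close> by simp
      have "2 ^ k * ((2 ^ Suc k * K) ^ Suc k) * K + 2 ^ k * ((2 ^ k * K) ^ k) * 1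
          \<le> 2 ^ k * X * K + 2 ^ k * X * K"
        using a b X \<open>1 \<le> K\<close> by (intro add_mono mult_mono) auto
      also have "\<dots> \<le> (2 ^ Suc (Suc k) * K) * X"
        using X \<open>1 \<le> K\<close> by simp
      finally have "2 ^ k * ((2 ^ Suc k * K) ^ Suc k) * K + 2 ^ k * ((2 ^ k * K) ^ k)
          \<le> (2 ^ Suc (Suc k) * K) ^ Suc (Suc k)" by (simp add: X_def)
      from mult_left_mono[OF this, of "F * e"]
      show "2 ^ k * (F * e * (2 ^ Suc k * K) ^ Suc k) * K + 2 ^ k * (F * (2 ^ k * K) ^ k) * e \<le> ?C"
        using F e by (simp add: algebra_simps)
    qed
  qed
qed

lemma deriv_bound_sin_cos:
  assumes "1 \<le> b"
  shows "deriv_bound k (\<lambda>x. sin (b * x)) (b ^ k)" "deriv_bound k (\<lambda>x. cos (b * x)) (b ^ k)"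
proof (induction k)
  case 0
  {
    case 1
    then show ?case by (auto intro!: continuous_intros)
  next
    case 2
    then show ?case by (auto intro!: continuous_intros)
  }
next
  case (Suc k)
  have one: "1 \<le> b ^ Suc k" using assms by (rule one_le_power)
  {
    case 1
    show ?case
    proof (rule deriv_bound_SucI[where f' = "\<lambda>x. b * cos (b * x)"])
      show "\<bar>sin (b * x)\<bar> \<le> b ^ Suc k" for x using one abs_sin_le_one[of "b * x"] by linarith
      show "((\<lambda>x. sin (b * x)) has_field_derivative b * cos (b * x)) (at x)" for x
        by (auto intro!: derivative_eq_intros)
      show "deriv_bound k (\<lambda>x. b * cos (b * x)) (b ^ Suc k)"
        using deriv_bound_cmult[OF Suc(2), of b] assms by simp
    qed
  next
    case 2
    show ?case
    proof (rule deriv_bound_SucI[where f' = "\<lambda>x. (- b) * sin (b * x)"])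
      show "\<bar>cos (b * x)\<bar> \<le> b ^ Suc k" for x using one abs_cos_le_one[of "b * x"] by linarith
      show "((\<lambda>x. cos (b * x)) has_field_derivative (- b) * sin (b * x)) (at x)" for x
        by (auto intro!: derivative_eq_intros)
      show "deriv_bound k (\<lambda>x. (- b) * sin (b * x)) (b ^ Suc k)"
        using deriv_bound_cmult[OF Suc(1), of "- b"] assms by simp
    qed
  }
qed

text \<open>Completeness of the C^k norm with an explicit rate. The induction passes to the
  derivatives, whose uniform limit is identified as the derivative of \<open>F\<close> by
  \<open>has_derivative_sequence\<close>.\<close>

lemma deriv_bound_limit:
  assumes cauchy: "\<And>n m. n \<le> m \<Longrightarrow> deriv_bound k (\<lambda>x. f m x - f n x) (e n)"
    and diff: "\<And>n. \<exists>C. deriv_bound k (\<lambda>x. f n x) C"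
    and e: "e \<longlonglongrightarrow> 0"
    and lim: "\<And>x. (\<lambda>n. f n x) \<longlonglongrightarrow> F x"
  shows "deriv_bound k (\<lambda>x. F x - f n x) (e n)"
  using cauchy diff lim
proof (induction k arbitrary: f F n)
  case 0
  have bd: "\<bar>F x - f n x\<bar> \<le> e n" for n x
  proof (rule tendsto_upperbound)
    show "(\<lambda>m. \<bar>f m x - f n x\<bar>) \<longlonglongrightarrow> \<bar>F x - f n x\<bar>"
      by (intro tendsto_intros "0.prems")
    show "\<forall>\<^sub>F m in sequentially. \<bar>f m x - f n x\<bar> \<le> e n"
      using eventually_ge_at_top[of n] by eventually_elim (use "0.prems"(1) in auto)
  qed auto
  have "uniform_limit UNIV f F sequentially"
  proof (rule uniform_limitI)
    fix r :: real assume "0 < r"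
    then have "\<forall>\<^sub>F n in sequentially. e n < r" by (rule order_tendstoD[OF e])
    then show "\<forall>\<^sub>F n in sequentially. \<forall>x\<in>UNIV. dist (f n x) (F x) < r"
    proof eventually_elim
      case (elim n)
      then show ?case using bd[of _ n] by (auto simp: dist_real_def abs_minus_commute intro: le_less_trans)
    qed
  qed
  then have "continuous_on UNIV F"
    by (rule uniform_limit_theorem[rotated]) (use "0.prems"(2) in auto)
  then show ?case using bd "0.prems"(2)[of n] by (auto intro: continuous_on_diff)
next
  case (Suc k)
  have fd: "(f n has_field_derivative deriv (f n) x) (at x)" for n x
    using Suc.prems(2)[of n] by (auto simp: DERIV_deriv_iff_real_differentiable)
  have dd: "deriv (\<lambda>x. f m x - f n x) = (\<lambda>x. deriv (f m) x - deriv (f n) x)" for m n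
    by (rule deriv_eqI) (intro DERIV_diff fd)
  have c': "deriv_bound k (\<lambda>x. deriv (f m) x - deriv (f n) x) (e n)" if "n \<le> m" for n m
    using Suc.prems(1)[OF that] dd by simp
  have c0: "\<bar>deriv (f m) x - deriv (f n) x\<bar> \<le> e n" if "n \<le> m" for n m x
    using deriv_bound_abs[OF c'[OF that]] .
  have Cau: "\<exists>N. \<forall>m\<ge>N. \<forall>n\<ge>N. \<forall>x. \<bar>deriv (f m) x - deriv (f n) x\<bar> < r" if "r > 0" for r
  proof -
    have "\<forall>\<^sub>F n in sequentially. e n < r/2" using that by (intro order_tendstoD[OF e]) auto
    then obtain N where N: "e N < r/2" by (auto simp: eventually_sequentially)
    show ?thesis
    proof (intro exI allI impI)
      fix m n x assume "N \<le> m" "N \<le> n"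
      then show "\<bar>deriv (f m) x - deriv (f n) x\<bar> < r"
        using c0[of N m x] c0[of N n x] N by linarith
    qed
  qed
  have "\<exists>l. (\<lambda>n. deriv (f n) x) \<longlonglongrightarrow> l" for x
    by (rule convergentD, rule Cauchy_convergent, rule metric_CauchyI)
       (use Cau in \<open>auto simp: dist_real_def; meson\<close>)
  then obtain G where G: "(\<lambda>n. deriv (f n) x) \<longlonglongrightarrow> G x" for x by metis
  have DF: "(F has_field_derivative G x) (at x)" for x
  proof -
    have "\<exists>g. \<forall>x\<in>UNIV. (\<lambda>n. f n x) \<longlonglongrightarrow> g x \<and> (g has_derivative (\<lambda>h. G x * h)) (at x within UNIV)"
    proof (rule has_derivative_sequence[of UNIV f "\<lambda>n x h. deriv (f n) x * h"])
      show "(f n has_derivative (*) (deriv (f n) x)) (at x within UNIV)" for n x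
        using fd[of n x] by (simp add: has_field_derivative_def)
      show "\<forall>\<^sub>F n in sequentially. \<forall>x\<in>UNIV. \<forall>h. norm (deriv (f n) x * h - G x * h) \<le> r * norm h" if "r > 0" for r
      proof -
        have bd: "\<bar>G x - deriv (f n) x\<bar> \<le> e n" for n x
        proof (rule tendsto_upperbound)
          show "(\<lambda>m. \<bar>deriv (f m) x - deriv (f n) x\<bar>) \<longlonglongrightarrow> \<bar>G x - deriv (f n) x\<bar>"
            by (intro tendsto_intros G)
          show "\<forall>\<^sub>F m in sequentially. \<bar>deriv (f m) x - deriv (f n) x\<bar> \<le> e n"
            using eventually_ge_at_top[of n] by eventually_elim (use c0 in auto)
        qed auto
        have "\<forall>\<^sub>F n in sequentially. e n < r" using that by (rule order_tendstoD[OF e])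
        then show ?thesis
        proof eventually_elim
          case (elim n)
          show ?case
          proof (intro ballI allI)
            fix x h
            have "norm (deriv (f n) x * h - G x * h) = \<bar>G x - deriv (f n) x\<bar> * norm h"
              by (metis abs_minus_commute abs_mult left_diff_distrib real_norm_def)
            also have "\<dots> \<le> r * norm h" using bd[of x n] elim by (intro mult_right_mono) auto
            finally show "norm (deriv (f n) x * h - G x * h) \<le> r * norm h" .
          qed
        qed
      qed
      show "(\<lambda>n. f n 0) \<longlonglongrightarrow> F 0" by (rule Suc.prems)
    qed auto
    then obtain g where g: "\<And>x. (\<lambda>n. f n x) \<longlonglongrightarrow> g x" "\<And>x. (g has_derivative (\<lambda>h. G x * h)) (at x)"
      by auto
    have "g = F" using LIMSEQ_unique[OF g(1) Suc.prems(3)] by auto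
    then show ?thesis using g(2) by (simp add: has_field_derivative_def)
  qed
  show ?case
  proof (rule deriv_bound_SucI[where f' = "\<lambda>x. G x - deriv (f n) x"])
    show "((\<lambda>x. F x - f n x) has_field_derivative G x - deriv (f n) x) (at x)" for x
      by (intro DERIV_diff DF fd)
    show "deriv_bound k (\<lambda>x. G x - deriv (f n) x) (e n)"
    proof (rule Suc.IH)
      show "\<exists>C. deriv_bound k (deriv (f n)) C" for n
        using Suc.prems(2)[of n] by auto
    qed (use c' G in auto)
    have "deriv_bound k (\<lambda>x. F x - f n x) (e n)"
    proof (rule Suc.IH)
      show "deriv_bound k (\<lambda>x. f m x - f n x) (e n)" if "n \<le> m" for m n
        using Suc.prems(1)[OF that] by (rule deriv_bound_Suc_imp)
      show "\<exists>C. deriv_bound k (f n) C" for n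
        using Suc.prems(2)[of n] deriv_bound_Suc_imp by blast
    qed (rule Suc.prems(3))
    then show "\<bar>F x - f n x\<bar> \<le> e n" for x by (rule deriv_bound_abs)
  qed
qed

section \<open>Smooth lifts of degree one\<close>

definition smooth_lift :: "(real \<Rightarrow> real) \<Rightarrow> bool" where
  "smooth_lift f \<longleftrightarrow> strict_mono f \<and> (\<forall>x. f (x + 1) = f x + 1) \<and>
    (\<forall>x. f differentiable (at x)) \<and> (\<forall>k. \<exists>C. deriv_bound k (deriv f) C)"

text \<open>Carrying the inverse along replaces a lower bound on the derivative: the maps here come
  with explicit inverses, and the inverse of a limit is smooth by the same limit argument.\<close>

definition smooth_lift_pair :: "(real \<Rightarrow> real) \<Rightarrow> (real \<Rightarrow> real) \<Rightarrow> bool" where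
  "smooth_lift_pair f g \<longleftrightarrow> smooth_lift f \<and> smooth_lift g \<and> (\<forall>x. f (g x) = x) \<and> (\<forall>x. g (f x) = x)"

lemma smooth_liftI:
  assumes "strict_mono f" "\<And>x. f (x + 1) = f x + 1"
    "\<And>x. (f has_field_derivative f' x) (at x)" "\<And>k. \<exists>C. deriv_bound k f' C"
  shows "smooth_lift f"
  using assms deriv_eqI[OF assms(3)] by (auto simp: smooth_lift_def real_differentiable_def)

lemma smooth_lift_deriv: "smooth_lift f \<Longrightarrow> (f has_field_derivative deriv f x) (at x)"
  by (simp add: smooth_lift_def DERIV_deriv_iff_real_differentiable)

lemma smooth_lift_continuous: "smooth_lift f \<Longrightarrow> continuous_on S f"
  by (meson smooth_lift_deriv DERIV_isCont continuous_at_imp_continuous_on)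

lemma smooth_lift_deriv_bound: "smooth_lift f \<Longrightarrow> \<exists>C\<ge>1. deriv_bound k (deriv f) C"
proof -
  assume "smooth_lift f"
  then obtain C where "deriv_bound k (deriv f) C" unfolding smooth_lift_def by blast
  then have "deriv_bound k (deriv f) (max 1 C)" by (rule deriv_bound_mono) simp
  then show ?thesis by (intro exI[of _ "max 1 C"]) simp
qed

lemma smooth_lift_rotation: "smooth_lift (\<lambda>x. x + a)"
  by (rule smooth_liftI[where f' = "\<lambda>x. 1"])
     (auto simp: strict_mono_def intro!: derivative_eq_intros exI[of _ 1] deriv_bound_const)

lemma smooth_lift_comp:
  assumes "smooth_lift f" "smooth_lift g"
  shows "smooth_lift (f \<circ> g)"
proof (rule smooth_liftI[where f' = "\<lambda>x. deriv f (g x) * deriv g x"])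
  show "strict_mono (f \<circ> g)"
    using assms by (auto simp: smooth_lift_def intro: strict_mono_compose simp: strict_mono_o)
  show "(f \<circ> g) (x + 1) = (f \<circ> g) x + 1" for x
    using assms by (simp add: smooth_lift_def)
  show "((f \<circ> g) has_field_derivative deriv f (g x) * deriv g x) (at x)" for x
    by (rule DERIV_chain) (intro smooth_lift_deriv assms)+
  show "\<exists>C. deriv_bound k (\<lambda>x. deriv f (g x) * deriv g x) C" for k
  proof -
    obtain F K where F: "deriv_bound k (deriv f) F" and K: "1 \<le> K" "deriv_bound k (deriv g) K"
      using assms[THEN smooth_lift_deriv_bound] by metis
    show ?thesis
      using deriv_bound_mult[OF deriv_bound_compose[OF smooth_lift_deriv[OF assms(2)] K(2,1) F] K(2)] by blast
  qed
qed

lemma smooth_lift_pair_sym: "smooth_lift_pair f g \<Longrightarrow> smooth_lift_pair g f"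
  by (simp add: smooth_lift_pair_def)

lemma smooth_lift_pair_comp:
  "smooth_lift_pair f f' \<Longrightarrow> smooth_lift_pair g g' \<Longrightarrow> smooth_lift_pair (f \<circ> g) (g' \<circ> f')"
  by (simp add: smooth_lift_pair_def smooth_lift_comp)

lemma smooth_lift_pair_rotation: "smooth_lift_pair (\<lambda>x. x + a) (\<lambda>x. x - a)"
  using smooth_lift_rotation[of a] smooth_lift_rotation[of "- a"] by (simp add: smooth_lift_pair_def)

lemma smooth_lift_pair_id: "smooth_lift_pair id id"
  using smooth_lift_pair_rotation[of 0] by (simp add: id_def)

lemma smooth_lift_lipschitz:
  assumes "smooth_lift f"
  shows "\<exists>L\<ge>1. \<forall>x y. \<bar>f x - f y\<bar> \<le> L * \<bar>x - y\<bar>"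
proof -
  obtain C where C: "C \<ge> 1" "deriv_bound 0 (deriv f) C" using smooth_lift_deriv_bound[OF assms] by blast
  have "norm (f x - f y) \<le> C * norm (x - y)" for x y
    by (rule field_differentiable_bound[of UNIV f "deriv f"])
       (use C smooth_lift_deriv[OF assms] in \<open>auto intro: has_field_derivative_at_within\<close>)
  then show ?thesis using C(1) by auto
qed

section \<open>Moebius maps of the circle\<close>

text \<open>The lift, fixing \<open>0\<close>, of \<open>w \<mapsto> (w - k) / (1 - k w)\<close> on the unit circle,
  where \<open>w = exp (2 \<pi> i x)\<close>.\<close>

definition moebius :: "real \<Rightarrow> real \<Rightarrow> real" where
  "moebius k x = x + arctan (k * sin (2 * pi * x) / (1 - k * cos (2 * pi * x))) / pi"

context
  fixes k :: real assumes k: "\<bar>k\<bar> < 1"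
begin

lemma moebius_denom1: "0 < 1 - k * cos t"
proof -
  have "\<bar>k * cos t\<bar> \<le> \<bar>k\<bar> * 1" unfolding abs_mult by (intro mult_left_mono) auto
  then show ?thesis using k by linarith
qed

text \<open>The right-hand side is the square of the modulus of 1 - k w for w = exp (i t), and this
  modulus is at least 1 - |k|.\<close>

lemma moebius_denom2: "(1 - \<bar>k\<bar>)\<^sup>2 \<le> 1 - 2 * k * cos t + k\<^sup>2"
proof -
  have "\<bar>k * cos t\<bar> \<le> \<bar>k\<bar> * 1" unfolding abs_mult by (intro mult_left_mono) auto
  then have "2 * k * cos t \<le> 2 * \<bar>k\<bar>" by simp
  moreover have "(1 - \<bar>k\<bar>)\<^sup>2 = 1 - 2 * \<bar>k\<bar> + k\<^sup>2" by (simp add: power2_eq_square algebra_simps)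
  ultimately show ?thesis by linarith
qed

lemma moebius_denom2_pos: "0 < 1 - 2 * k * cos t + k\<^sup>2"
  using moebius_denom2[of t] k zero_less_power[of "1 - \<bar>k\<bar>" 2] by linarith

lemma moebius_split: "(1 - k * cos t)\<^sup>2 + (k * sin t)\<^sup>2 = 1 - 2 * k * cos t + k\<^sup>2"
proof -
  have "(1 - k * cos t)\<^sup>2 + (k * sin t)\<^sup>2 = 1 - 2 * k * cos t + k\<^sup>2 * ((sin t)\<^sup>2 + (cos t)\<^sup>2)"
    by algebra
  then show ?thesis by simp
qed

text \<open>This is the Poisson kernel, as for every disc automorphism on the unit circle. In the
  computation, 1 plus the square of the tangent is \<open>W / (1 - k * c)\<^sup>2\<close>, so that
  the factors \<open>1 - k * c\<close> cancel.\<close>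

lemma moebius_deriv:
  "(moebius k has_field_derivative (1 - k\<^sup>2) / (1 - 2 * k * cos (2 * pi * x) + k\<^sup>2)) (at x)"
proof -
  define c s where "c = cos (2 * pi * x)" and "s = sin (2 * pi * x)"
  define W where "W = 1 - 2 * k * c + k\<^sup>2"
  have p: "1 - k * c > 0" "W > 0" and sp: "(1 - k * c)\<^sup>2 + (k * s)\<^sup>2 = W" and cs: "s\<^sup>2 + c\<^sup>2 = 1"
    using moebius_denom1[of "2 * pi * x"] moebius_denom2_pos[of "2 * pi * x"] moebius_split[of "2 * pi * x"]
    by (auto simp: c_def s_def W_def)
  have d: "((\<lambda>x. k * sin (2 * pi * x) / (1 - k * cos (2 * pi * x))) has_field_derivative
      2 * pi * k * (c - k) / (1 - k * c)\<^sup>2) (at x)"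
  proof -
    have "(k * (c * (2 * pi))) * (1 - k * c) - (k * s) * (k * (s * (2 * pi)))
        = 2 * pi * k * (c - k * (s\<^sup>2 + c\<^sup>2))"
      by (simp add: algebra_simps power2_eq_square)
    moreover have "((\<lambda>x. k * sin (2 * pi * x) / (1 - k * cos (2 * pi * x))) has_field_derivative
        ((k * (c * (2 * pi))) * (1 - k * c) - (k * s) * (k * (s * (2 * pi)))) / ((1 - k * c) * (1 - k * c))) (at x)"
      unfolding c_def s_def
      by (rule DERIV_divide; (auto intro!: derivative_eq_intros; fail)?) (use p(1) in \<open>simp add: c_def\<close>)
    ultimately show ?thesis unfolding cs by (simp add: power2_eq_square)
  qed
  have "(moebius k has_field_derivative 1 + inverse (1 + (k * s / (1 - k * c))\<^sup>2) * (2 * pi * k * (c - k) / (1 - k * c)\<^sup>2) / pi) (at x)"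
    unfolding moebius_def[abs_def] c_def s_def
    by (rule DERIV_add[OF DERIV_ident DERIV_cdivide[OF DERIV_chain2[OF DERIV_arctan d[unfolded c_def]]]])
  also have "1 + (k * s / (1 - k * c))\<^sup>2 = W / (1 - k * c)\<^sup>2"
    using p(1) sp by (simp add: power_divide divide_simps)
  also have "1 + inverse (W / (1 - k * c)\<^sup>2) * (2 * pi * k * (c - k) / (1 - k * c)\<^sup>2) / pi = 1 + 2 * k * (c - k) / W"
    using p by (simp add: field_simps)
  also have "\<dots> = (1 - k\<^sup>2) / W"
    using p(2) by (simp add: W_def field_simps power2_eq_square)
  finally show ?thesis by (simp add: W_def c_def)
qed

text \<open>The real part of (w - k) / (1 - k w), obtained from the formulas for twice an
  arctangent. It evaluates the outer Poisson kernel in the chain rule for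
  \<open>moebius (- k)\<close> after \<open>moebius k\<close>.\<close>

lemma cos_moebius:
  "cos (2 * pi * moebius k x) =
    (cos (2 * pi * x) * (1 + k\<^sup>2) - 2 * k) / (1 - 2 * k * cos (2 * pi * x) + k\<^sup>2)"
proof -
  define c s where "c = cos (2 * pi * x)" and "s = sin (2 * pi * x)"
  define W where "W = 1 - 2 * k * c + k\<^sup>2"
  define t where "t = k * s / (1 - k * c)"
  have p: "1 - k * c > 0" "W > 0" and sp: "(1 - k * c)\<^sup>2 + (k * s)\<^sup>2 = W" and cs: "s\<^sup>2 + c\<^sup>2 = 1"
    using moebius_denom1[of "2 * pi * x"] moebius_denom2_pos[of "2 * pi * x"] moebius_split[of "2 * pi * x"]
    by (auto simp: c_def s_def W_def)
  have t1: "1 + t\<^sup>2 = W / (1 - k * c)\<^sup>2"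
    unfolding t_def using p(1) sp by (simp add: power_divide divide_simps)
  have pos: "1 + t\<^sup>2 > 0" by (smt (verit) zero_le_power2)
  have c2: "cos (2 * arctan t) = (1 - t\<^sup>2) / (1 + t\<^sup>2)"
    using pos by (simp add: cos_double sin_arctan cos_arctan power_divide real_sqrt_pow2 diff_divide_distrib)
  have s2: "sin (2 * arctan t) = 2 * t / (1 + t\<^sup>2)"
    using pos by (simp add: sin_double sin_arctan cos_arctan)
  have "2 * pi * moebius k x = 2 * pi * x + 2 * arctan t"
    by (simp add: moebius_def t_def c_def s_def field_simps)
  then have "cos (2 * pi * moebius k x) = c * ((1 - t\<^sup>2) / (1 + t\<^sup>2)) - s * (2 * t / (1 + t\<^sup>2))"
    by (simp add: cos_add c2 s2 c_def s_def)
  also have "\<dots> = (c * (1 - t\<^sup>2) - s * (2 * t)) * (1 - k * c)\<^sup>2 / W"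
    using p by (simp add: t1 field_simps)
  also have "(c * (1 - t\<^sup>2) - s * (2 * t)) * (1 - k * c)\<^sup>2
      = c * ((1 - k * c)\<^sup>2 - (k * s)\<^sup>2) - 2 * s * (k * s) * (1 - k * c)"
  proof -
    have td: "t * (1 - k * c) = k * s" unfolding t_def using p(1) by simp
    show ?thesis unfolding td[symmetric] by (simp add: algebra_simps power2_eq_square)
  qed
  also have "\<dots> = c * ((1 - k * c)\<^sup>2 - k\<^sup>2 * s\<^sup>2) - 2 * k * s\<^sup>2 * (1 - k * c)"
    by (simp add: algebra_simps power2_eq_square)
  also have "s\<^sup>2 = 1 - c\<^sup>2" using cs by simp
  also have "c * ((1 - k * c)\<^sup>2 - k\<^sup>2 * (1 - c\<^sup>2)) - 2 * k * (1 - c\<^sup>2) * (1 - k * c) = c * (1 + k\<^sup>2) - 2 * k"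
    by (simp add: algebra_simps power2_eq_square)
  finally show ?thesis by (simp add: c_def W_def)
qed

end

text \<open>The two Poisson kernels multiply to 1, so the composition minus the identity has
  derivative zero; it vanishes at 0, which both maps fix. No branch of the argument has to be
  followed.\<close>

lemma moebius_inverse:
  assumes "\<bar>k\<bar> < 1"
  shows "moebius (- k) (moebius k x) = x"
proof -
  have d: "((\<lambda>x. moebius (- k) (moebius k x) - x) has_field_derivative 0) (at x)" for x
  proof -
    define c where "c = cos (2 * pi * x)"
    define W where "W = 1 - 2 * k * c + k\<^sup>2"
    have W: "W > 0" unfolding W_def c_def by (rule moebius_denom2_pos[OF assms])
    have k1: "(1 - k\<^sup>2) > 0" using assms by (simp add: abs_square_less_1)
    have e: "1 - 2 * (- k) * cos (2 * pi * moebius k x) + (- k)\<^sup>2 = (1 - k\<^sup>2)\<^sup>2 / W"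
      unfolding cos_moebius[OF assms] c_def[symmetric] W_def[symmetric]
      using W by (simp add: field_simps) (simp add: W_def power2_eq_square algebra_simps)
    have "((\<lambda>x. moebius (- k) (moebius k x) - x) has_field_derivative
       (1 - (- k)\<^sup>2) / (1 - 2 * (- k) * cos (2 * pi * moebius k x) + (- k)\<^sup>2) * ((1 - k\<^sup>2) / W) - 1) (at x)"
      unfolding W_def c_def
      by (intro DERIV_diff DERIV_chain2[OF moebius_deriv] moebius_deriv assms DERIV_ident) (use assms in auto)
    also have "(1 - (- k)\<^sup>2) / (1 - 2 * (- k) * cos (2 * pi * moebius k x) + (- k)\<^sup>2) * ((1 - k\<^sup>2) / W) - 1 = 0"
      unfolding e using k1 W by (simp add: power2_eq_square)
    finally show ?thesis .
  qed
  have "moebius (- k) (moebius k x) - x = moebius (- k) (moebius k 0) - 0"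
    using DERIV_isconst_all[of "\<lambda>x. moebius (- k) (moebius k x) - x"] d by blast
  then show ?thesis by (simp add: moebius_def)
qed

lemma moebius_shift: "moebius k (x + of_int p) = moebius k x + of_int p"
proof -
  have "2 * pi * (x + of_int p) = 2 * pi * x + 2 * pi * of_int p" by (simp add: algebra_simps)
  then show ?thesis by (simp add: moebius_def sin_add cos_add)
qed

text \<open>The arctangent stays within pi / 2, so the bound is uniform in the parameter, however
  strong the hyperbolicity. On the q-fold cover it becomes 1 / (2 q), which is what makes the
  partial conjugacies converge uniformly.\<close>

lemma moebius_near: "\<bar>moebius k x - x\<bar> \<le> 1 / 2"
proof -
  define t where "t = k * sin (2 * pi * x) / (1 - k * cos (2 * pi * x))"
  have "\<bar>arctan t\<bar> \<le> pi / 2" using arctan_lbound[of t] arctan_ubound[of t] by linarith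
  then have "\<bar>arctan t / pi\<bar> \<le> 1 / 2" by (simp add: field_simps)
  then show ?thesis by (simp add: moebius_def t_def)
qed

lemma moebius_strict_mono:
  assumes "\<bar>k\<bar> < 1"
  shows "strict_mono (moebius k)"
proof (rule strict_monoI)
  fix x y :: real assume "x < y"
  then show "moebius k x < moebius k y"
  proof (rule DERIV_pos_imp_increasing)
    fix z
    have "1 - k\<^sup>2 > 0" using assms by (simp add: abs_square_less_1)
    then show "\<exists>y. (moebius k has_field_derivative y) (at z) \<and> 0 < y"
      using moebius_deriv[OF assms, of z] moebius_denom2_pos[OF assms] by (blast intro: divide_pos_pos)
  qed
qed

text \<open>The argument of the arctangent is at least 1 at the point \<open>d\<close>, which
  therefore moves by at least (pi / 4) / pi = 1/4. From 3 < pi < 4 one has 6 d \<le> t \<le> 8 d;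
  then 1 - cos t \<le> 32 d^2 \<le> 4/5 d, where the bound 1/40 enters, and numerator and
  denominator are compared with 9/5 d.\<close>

lemma moebius_expands:
  assumes "0 < d" "d \<le> 1 / 40"
  shows "1 / 4 \<le> moebius (1 - d) d"
proof -
  define t where "t = 2 * pi * d"
  have pi: "3 < pi" "pi < 4" using pi_gt3 pi_less_4 by auto
  have t0: "0 < t" using assms by (simp add: t_def)
  have tb: "6 * d \<le> t" "t \<le> 8 * d" using assms pi by (auto simp: t_def)
  have "t \<le> 1/5" using tb assms by simp
  have sn: "t / 2 \<le> sin t"
  proof -
    have "\<bar>sin t - (\<Sum>m<3. sin_coeff m * t ^ m)\<bar> \<le> inverse (fact 3) * \<bar>t\<bar> ^ 3"
      by (rule Maclaurin_sin_bound)
    then have "\<bar>sin t - t\<bar> \<le> t ^ 3 / 6"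
      using t0 by (simp add: eval_nat_numeral sin_coeff_def)
    moreover have "t ^ 3 / 6 \<le> t / 2"
    proof -
      have "t * (t * t) \<le> t * (1 * 1)"
        using \<open>t \<le> 1/5\<close> t0 by (intro mult_left_mono mult_mono) auto
      then show ?thesis using t0 by (simp add: power3_eq_cube mult.assoc)
    qed
    ultimately show ?thesis by linarith
  qed
  have cs: "1 - cos t \<le> t\<^sup>2 / 2"
  proof -
    have "\<bar>sin (t / 2)\<bar> \<le> \<bar>t / 2\<bar>" by (rule abs_sin_x_le_abs_x)
    then have "(sin (t / 2))\<^sup>2 \<le> (t / 2)\<^sup>2" by (simp only: abs_le_square_iff)
    then show ?thesis using cos_double_sin[of "t / 2"] by (simp add: power_divide)
  qed
  have "t\<^sup>2 \<le> (8 * d)\<^sup>2" using tb t0 by (intro power_mono) auto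
  also have "\<dots> \<le> 64 * (d * (1 / 40))"
    using assms by (auto simp: power2_eq_square intro!: mult_left_mono)
  finally have t2: "1 - cos t \<le> 4 / 5 * d" using cs by simp
  have "1 - (1 - d) * cos t = d + (1 - d) * (1 - cos t)" by (simp add: algebra_simps)
  also have "\<dots> \<le> d + 1 * (1 - cos t)" using assms by (intro add_left_mono mult_right_mono) auto
  finally have rhs: "1 - (1 - d) * cos t \<le> 9 / 5 * d" using t2 by simp
  have "9 / 5 * d \<le> 39 / 40 * (3 * d)" using assms by simp
  also have "\<dots> \<le> (1 - d) * sin t"
    using assms sn tb by (intro mult_mono) auto
  finally have lhs: "9 / 5 * d \<le> (1 - d) * sin t" .
  have "0 < 1 - (1 - d) * cos t" using assms by (intro moebius_denom1) auto
  then have "1 \<le> (1 - d) * sin t / (1 - (1 - d) * cos t)"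
    using lhs rhs by (simp add: le_divide_eq)
  then have "pi / 4 \<le> arctan ((1 - d) * sin t / (1 - (1 - d) * cos t))"
    unfolding arctan_one[symmetric] arctan_le_iff .
  from divide_right_mono[OF this, of pi]
  have "1 / 4 \<le> arctan ((1 - d) * sin t / (1 - (1 - d) * cos t)) / pi"
    by (simp del: arctan_le_iff)
  then show ?thesis using \<open>0 < d\<close> unfolding moebius_def t_def by linarith
qed


text \<open>The kernel satisfies V' = s V^2 with s a sine of frequency and amplitude proportional to
  q, so all derivatives are polynomial in q once V is, and V is at most q^(2 N) by
  \<open>moebius_denom2\<close>. The order of the quantifiers matters: \<open>c\<close> and
  \<open>e\<close> are fixed before \<open>q\<close>, so a Liouville approximation can beat the
  exponent \<open>e\<close>.\<close>

lemma deriv_bound_poisson_kernel: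
  "\<exists>c\<ge>1. \<exists>e. \<forall>q\<ge>1. \<forall>k. \<bar>k\<bar> = 1 - 1 / q ^ N \<longrightarrow>
    deriv_bound n (\<lambda>x. 1 / (1 - 2 * k * cos (2 * pi * q * x) + k\<^sup>2)) (c * q ^ e)"
proof (induction n)
  case 0
  show ?case
  proof (intro exI[of _ "1 :: real"] exI[of _ "2 * N"] conjI allI impI)
    fix q k :: real assume q: "1 \<le> q" and k: "\<bar>k\<bar> = 1 - 1 / q ^ N"
    have k1: "\<bar>k\<bar> < 1" using q k by simp
    have pos: "0 < 1 - 2 * k * cos t + k\<^sup>2" for t by (rule moebius_denom2_pos[OF k1])
    have lb: "(1 / q ^ N)\<^sup>2 \<le> 1 - 2 * k * cos t + k\<^sup>2" for t using moebius_denom2[OF k1, of t] k by simp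
    have "\<bar>1 / (1 - 2 * k * cos t + k\<^sup>2)\<bar> \<le> 1 * q ^ (2 * N)" for t
    proof -
      have "1 / (1 - 2 * k * cos t + k\<^sup>2) \<le> 1 / (1 / q ^ N)\<^sup>2"
        by (rule divide_left_mono[OF lb]) (use pos q in \<open>auto intro!: mult_pos_pos\<close>)
      then show ?thesis using pos[of t] by (simp add: power_divide power_even_eq)
    qed
    moreover have "continuous_on UNIV (\<lambda>x. 1 / (1 - 2 * k * cos (2 * pi * q * x) + k\<^sup>2))"
      by (intro continuous_intros) (use pos in \<open>auto simp: less_le\<close>)
    ultimately show "deriv_bound 0 (\<lambda>x. 1 / (1 - 2 * k * cos (2 * pi * q * x) + k\<^sup>2)) (1 * q ^ (2 * N))"
      by simp
  qed simp
next
  case (Suc n)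
  then obtain c e where c: "1 \<le> c" and IH: "\<And>q k. 1 \<le> q \<Longrightarrow> \<bar>k\<bar> = 1 - 1 / q ^ N \<Longrightarrow>
    deriv_bound n (\<lambda>x. 1 / (1 - 2 * k * cos (2 * pi * q * x) + k\<^sup>2)) (c * q ^ e)" by blast
  \<comment> \<open>Two products give \<open>2 ^ n\<close> twice, the sine term gives
    \<open>2 * 8 ^ Suc n\<close> because 2 pi < 8, and the square of the kernel gives the square of
    \<open>c\<close>. Likewise \<open>e'\<close> collects \<open>Suc n\<close> from the sine and
    \<open>e\<close> twice.\<close>
  define c' where "c' = 2 ^ n * 2 ^ n * (2 * 8 ^ Suc n) * c\<^sup>2"
  define e' where "e' = Suc n + 2 * e"
  have c': "c \<le> c'"
  proof -
    have "1 * c \<le> (2 ^ n * 2 ^ n * (2 * 8 ^ Suc n) * c) * c"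
      using c one_le_power[of "8 :: real" "Suc n"] by (intro mult_right_mono mult_ge1_I) auto
    then show ?thesis by (simp add: c'_def power2_eq_square mult.assoc)
  qed
  show ?case
  proof (intro exI[of _ c'] exI[of _ e'] conjI allI impI)
    show "1 \<le> c'" using c c' by simp
    fix q k :: real assume q: "1 \<le> q" and k: "\<bar>k\<bar> = 1 - 1 / q ^ N"
    have k1: "\<bar>k\<bar> < 1" using q k by simp
    define V where "V = (\<lambda>x. 1 / (1 - 2 * k * cos (2 * pi * q * x) + k\<^sup>2))"
    have pos: "0 < 1 - 2 * k * cos t + k\<^sup>2" for t by (rule moebius_denom2_pos[OF k1])
    have V: "deriv_bound n V (c * q ^ e)" unfolding V_def using IH[OF q k] .
    have ce: "c * q ^ e \<le> c' * q ^ e'"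
      using c c' q by (intro mult_mono power_increasing) (auto simp: e'_def)
    have b1: "1 \<le> 2 * pi * q" using q pi_gt3 mult_mono[of 1 "2 * pi" 1 q] by simp
    have "deriv_bound n (\<lambda>x. (- 2 * k * (2 * pi * q)) * sin (2 * pi * q * x)) (\<bar>- 2 * k * (2 * pi * q)\<bar> * (2 * pi * q) ^ n)"
      by (rule deriv_bound_cmult[OF deriv_bound_sin_cos(1)[OF b1]])
    then have "deriv_bound n (\<lambda>x. (- 2 * k * (2 * pi * q)) * sin (2 * pi * q * x)) (2 * 8 ^ Suc n * q ^ Suc n)"
    proof (rule deriv_bound_mono)
      have b8: "2 * pi * q \<le> 8 * q" using pi_less_4 q by (intro mult_right_mono) auto
      have "\<bar>- 2 * k * (2 * pi * q)\<bar> * (2 * pi * q) ^ n = \<bar>k\<bar> * (2 * (2 * pi * q) ^ Suc n)"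
        using q by (simp add: abs_mult)
      also have "\<dots> \<le> 1 * (2 * (8 * q) ^ Suc n)"
        using k1 b1 q power_mono[OF b8, of "Suc n"] by (intro mult_mono) auto
      finally show "\<bar>- 2 * k * (2 * pi * q)\<bar> * (2 * pi * q) ^ n \<le> 2 * 8 ^ Suc n * q ^ Suc n"
        by (simp only: power_mult_distrib mult_1 mult.assoc)
    qed
    from deriv_bound_mult[OF this deriv_bound_mult[OF V V]]
    have "deriv_bound n (\<lambda>x. - 2 * k * (2 * pi * q) * sin (2 * pi * q * x) * (V x * V x)) (c' * q ^ e')"
      by (simp add: c'_def e'_def power_add power2_eq_square power_mult mult_ac)
    moreover have "(V has_field_derivative - 2 * k * (2 * pi * q) * sin (2 * pi * q * x) * (V x * V x)) (at x)" for x
    proof -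
      have p: "1 - 2 * k * cos (2 * pi * q * x) + k\<^sup>2 \<noteq> 0" using pos[of "2 * pi * q * x"] by simp
      have "((\<lambda>x. 1 - 2 * k * cos (2 * pi * q * x) + k\<^sup>2) has_field_derivative
          2 * k * (2 * pi * q) * sin (2 * pi * q * x)) (at x)"
        by (auto intro!: derivative_eq_intros)
      from DERIV_inverse_fun[OF this p] show ?thesis
        by (simp add: V_def field_simps power2_eq_square)
    qed
    moreover have "\<bar>V x\<bar> \<le> c' * q ^ e'" for x using deriv_bound_abs[OF V, of x] ce by simp
    ultimately show "deriv_bound (Suc n) (\<lambda>x. 1 / (1 - 2 * k * cos (2 * pi * q * x) + k\<^sup>2)) (c' * q ^ e')"
      unfolding V_def[symmetric] by (intro deriv_bound_SucI[where f = V])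
  qed
qed

section \<open>Moebius maps lifted to q-fold covers\<close>

definition moebius_cover :: "real \<Rightarrow> nat \<Rightarrow> real \<Rightarrow> real" where
  "moebius_cover k q x = moebius k (real q * x) / real q"

lemma moebius_cover_deriv:
  assumes "\<bar>k\<bar> < 1" "0 < q"
  shows "(moebius_cover k q has_field_derivative
    (1 - k\<^sup>2) * (1 / (1 - 2 * k * cos (2 * pi * real q * x) + k\<^sup>2))) (at x)"
proof -
  have "((\<lambda>x. real q * x) has_field_derivative real q) (at x)"
    by (auto intro!: derivative_eq_intros)
  from DERIV_cdivide[OF DERIV_chain2[OF moebius_deriv[OF assms(1)] this], of "real q"]
  show ?thesis using assms(2) by (simp add: moebius_cover_def[abs_def] mult.assoc)
qed

lemma moebius_cover_deriv_bound:
  "\<exists>c\<ge>1. \<exists>e. \<forall>q>0. \<forall>k. \<bar>k\<bar> = 1 - 1 / real q ^ N \<longrightarrow> deriv_bound n (deriv (moebius_cover k q)) (c * real q ^ e)"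
proof -
  obtain c e where c: "1 \<le> c" and *: "\<And>q k. 1 \<le> q \<Longrightarrow> \<bar>k\<bar> = 1 - 1 / q ^ N \<Longrightarrow>
    deriv_bound n (\<lambda>x. 1 / (1 - 2 * k * cos (2 * pi * q * x) + k\<^sup>2)) (c * q ^ e)"
    using deriv_bound_poisson_kernel[of N n] by blast
  show ?thesis
  proof (intro exI[of _ c] exI[of _ e] conjI allI impI)
    fix q :: nat and k :: real assume q: "0 < q" and k: "\<bar>k\<bar> = 1 - 1 / real q ^ N"
    have q1: "1 \<le> real q" using q by simp
    have k1: "\<bar>k\<bar> < 1" using q k by simp
    have "k\<^sup>2 \<le> 1" using k1 by (simp add: abs_square_le_1)
    then have k2: "\<bar>1 - k\<^sup>2\<bar> \<le> 1" using zero_le_power2[of k] by linarith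
    have "deriv_bound n (\<lambda>x. (1 - k\<^sup>2) * (1 / (1 - 2 * k * cos (2 * pi * real q * x) + k\<^sup>2))) (c * real q ^ e)"
      by (rule deriv_bound_mono[OF deriv_bound_cmult[OF *[OF q1 k]]])
         (use k2 c mult_right_mono[OF k2, of "c * real q ^ e"] in simp)
    then show "deriv_bound n (deriv (moebius_cover k q)) (c * real q ^ e)"
      using deriv_eqI[OF moebius_cover_deriv[OF k1 q]] by simp
  qed (fact c)
qed

lemma moebius_cover_shift:
  assumes "0 < q"
  shows "moebius_cover k q (x + of_int p / real q) = moebius_cover k q x + of_int p / real q"
proof -
  have "real q * (x + of_int p / real q) = real q * x + of_int p" using assms by (simp add: field_simps)
  then show ?thesis by (simp add: moebius_cover_def moebius_shift add_divide_distrib)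
qed

lemma moebius_cover_near:
  assumes "0 < q"
  shows "\<bar>moebius_cover k q x - x\<bar> \<le> 1 / (2 * real q)"
proof -
  have "moebius_cover k q x - x = (moebius k (real q * x) - real q * x) / real q"
    using assms by (simp add: moebius_cover_def field_simps)
  then have "\<bar>moebius_cover k q x - x\<bar> = \<bar>moebius k (real q * x) - real q * x\<bar> / real q" by simp
  also have "\<dots> \<le> 1 / 2 / real q" by (intro divide_right_mono moebius_near) simp
  finally show ?thesis by simp
qed

lemma moebius_cover_smooth_lift:
  assumes "\<bar>k\<bar> = 1 - 1 / real q ^ N" "0 < q"
  shows "smooth_lift (moebius_cover k q)"
proof -
  have k1: "\<bar>k\<bar> < 1" using assms by simp
  show ?thesis unfolding smooth_lift_def
  proof (intro conjI allI)
    show "strict_mono (moebius_cover k q)"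
      using moebius_strict_mono[OF k1] assms(2)
      by (auto simp: strict_mono_def moebius_cover_def divide_strict_right_mono)
    show "moebius_cover k q (x + 1) = moebius_cover k q x + 1" for x
      using moebius_cover_shift[OF assms(2), of k x "int q"] assms(2) by simp
    show "moebius_cover k q differentiable at x" for x
      using moebius_cover_deriv[OF k1 assms(2)] by (auto simp: real_differentiable_def)
    show "\<exists>C. deriv_bound n (deriv (moebius_cover k q)) C" for n
      using moebius_cover_deriv_bound[of N n] assms by blast
  qed
qed

lemma moebius_cover_smooth_lift_pair:
  assumes "\<bar>k\<bar> = 1 - 1 / real q ^ N" "0 < q"
  shows "smooth_lift_pair (moebius_cover k q) (moebius_cover (- k) q)"
proof -
  have k1: "\<bar>k\<bar> < 1" using assms by simp
  show ?thesis
    using moebius_cover_smooth_lift[of k q N] moebius_cover_smooth_lift[of "- k" q N] assms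
      moebius_inverse[OF k1] moebius_inverse[of "- k"] k1
    by (simp add: smooth_lift_pair_def moebius_cover_def)
qed

lemma moebius_cover_0: "moebius_cover k q 0 = 0"
  by (simp add: moebius_cover_def moebius_def)

lemma moebius_cover_expands:
  assumes "0 < q" "0 < d" "d \<le> 1 / 40"
  shows "1 / (4 * real q) \<le> moebius_cover (1 - d) q (d / real q)"
  using moebius_expands[OF assms(2,3)] assms(1) by (simp add: moebius_cover_def field_simps)

section \<open>From lifts to circle maps\<close>

text \<open>Meaningful for \<open>F\<close> of degree one: by \<open>circ_of\<close> the result is
  then independent of the chosen representative.\<close>

definition circ :: "(real \<Rightarrow> real) \<Rightarrow> circle \<Rightarrow> circle" where
  "circ F z = circle_of (F (rep_circle z))"

lemma degree1_int:
  fixes F :: "real \<Rightarrow> real"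
  assumes "\<And>x. F (x + 1) = F x + 1"
  shows "F (x + of_int m) = F x + of_int m"
proof (induction m arbitrary: x rule: int_induct[where k = 0])
  case (step1 i)
  show ?case using step1(2)[of x] assms[of "x + of_int i"] by (simp add: add.assoc)
next
  case (step2 i)
  show ?case using step2(2)[of x] assms[of "x + of_int (i - 1)"] by (simp add: add.assoc)
qed simp

lemma circ_of:
  assumes "\<And>x. F (x + 1) = F x + 1"
  shows "circ F (circle_of x) = circle_of (F x)"
proof -
  have "rep_circle (circle_of x) - x \<in> \<int>" by (simp flip: circle_of_eq_iff)
  then obtain m where "rep_circle (circle_of x) = x + of_int m" by (auto elim!: Ints_cases simp: algebra_simps)
  then have "F (rep_circle (circle_of x)) - F x \<in> \<int>" using degree1_int[of F, OF assms] by simp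
  then show ?thesis by (simp add: circ_def circle_of_eq_iff)
qed

lemma circle_cases: obtains x where "z = circle_of x"
  by (metis circle_of_rep)

text \<open>An integer shift of one representative realises the distance; with such representatives,
  estimates on the line descend to the circle.\<close>

lemma circle_dist_cases:
  obtains x y where "z = circle_of x" "w = circle_of y" "dist z w = \<bar>x - y\<bar>"
proof -
  obtain x y where xy: "z = circle_of x" "w = circle_of y" by (metis circle_of_rep)
  then have "dist z w = \<bar>x - (y + of_int (round (x - y)))\<bar>"
    by (simp add: dist_circle.abs_eq algebra_simps)
  moreover have "w = circle_of (y + of_int (round (x - y)))"
    using xy by (simp add: circle_of_eq_iff)
  ultimately show thesis using xy that by blast
qed

text \<open>The difference is continuous and integer valued. This makes the arbitrary choice in
  \<open>lift_of\<close> harmless.\<close>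

lemma lifts_differ_by_int:
  assumes "is_lift F f" "is_lift G f"
  obtains m :: int where "\<And>x. F x = G x + of_int m"
proof -
  have int: "F x - G x \<in> \<int>" for x using assms by (simp add: is_lift_def flip: circle_of_eq_iff)
  have "(\<lambda>x. F x - G x) constant_on UNIV"
  proof (rule continuous_discrete_range_constant[OF connected_UNIV])
    show "continuous_on UNIV (\<lambda>x. F x - G x)"
      using assms by (auto simp: is_lift_def intro: continuous_on_diff)
    show "\<exists>e>0. \<forall>y. y \<in> UNIV \<and> F y - G y \<noteq> F x - G x \<longrightarrow> e \<le> norm (F y - G y - (F x - G x))" for x
      using Ints_nonzero_abs_ge1[OF Ints_diff[OF int int], of _ x] by (intro exI[of _ 1]) auto
  qed
  then obtain c where c: "\<And>x. F x - G x = c" by (auto simp: constant_on_def)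
  then obtain m where "c = of_int m" using int[of 0] by (auto elim: Ints_cases)
  then show thesis using c that[of m] by (metis add.commute diff_add_cancel)
qed

lemma smooth_lift_step: "smooth_lift f \<Longrightarrow> f (x + 1) = f x + 1"
  by (simp add: smooth_lift_def)

lemma is_lift_circ:
  assumes "smooth_lift f" shows "is_lift f (circ f)"
  using assms by (simp add: is_lift_def smooth_lift_continuous circ_of smooth_lift_step)

lemma circ_comp:
  assumes "\<And>x. f (x + 1) = f x + 1"
  shows "circ (f \<circ> g) = circ f \<circ> circ g"
  by (rule ext) (simp add: circ_def[of "f \<circ> g"] circ_def[of g] circ_of[of f, OF assms])

lemma circ_id: "circ id = id"
  by (auto simp: circ_def)

lemma lipschitz_circ:
  assumes "\<And>x. F (x + 1) = F x + 1" "\<And>x y. \<bar>F x - F y\<bar> \<le> L * \<bar>x - y\<bar>"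
  shows "dist (circ F z) (circ F w) \<le> L * dist z w"
proof -
  obtain x y where "z = circle_of x" "w = circle_of y" "dist z w = \<bar>x - y\<bar>" by (rule circle_dist_cases)
  then show ?thesis
    using dist_circle_le[of "F x" "F y"] assms(2)[of x y] by (simp add: circ_of[of F, OF assms(1)])
qed

lemma continuous_circ: 
  assumes "smooth_lift f" shows "continuous_on UNIV (circ f)"
proof -
  obtain L where L: "1 \<le> L" "\<And>x y. \<bar>f x - f y\<bar> \<le> L * \<bar>x - y\<bar>" using smooth_lift_lipschitz[OF assms] by blast
  have "L-lipschitz_on UNIV (circ f)"
    using L lipschitz_circ[OF smooth_lift_step[OF assms] L(2)] by (intro lipschitz_onI) auto
  then show ?thesis by (rule lipschitz_on_continuous_on)
qed

lemma circ_inverse: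
  assumes "smooth_lift_pair f g"
  shows "circ f (circ g z) = z"
proof -
  have "circ f \<circ> circ g = circ (f \<circ> g)" 
    using assms by (intro circ_comp[symmetric]) (auto simp: smooth_lift_pair_def smooth_lift_def)
  also have "f \<circ> g = id" using assms by (auto simp: smooth_lift_pair_def)
  finally show ?thesis by (metis circ_id comp_apply id_apply)
qed

lemma inv_circ:
  assumes "smooth_lift_pair f g"
  shows "inv (circ f) = circ g"
  using circ_inverse[OF assms] circ_inverse[OF smooth_lift_pair_sym[OF assms]]
  by (intro inv_equality) auto

lemma circ_H_homeo:
  assumes "smooth_lift_pair f g"
  shows "circ f \<in> H_homeo"
proof -
  have fg: "smooth_lift f" "smooth_lift g" using assms by (auto simp: smooth_lift_pair_def)
  have "homeomorphism UNIV UNIV (circ f) (circ g)"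
    by (rule homeomorphismI)
       (use continuous_circ fg circ_inverse[OF assms] circ_inverse[OF smooth_lift_pair_sym[OF assms]] in auto)
  then show ?thesis
    using is_lift_circ[OF fg(1)] fg(1) by (auto simp: H_homeo_def inv_circ[OF assms] smooth_lift_def)
qed

text \<open>\<open>deriv_bound\<close> peels off the innermost derivative while the function classes
  iterate on the outside; \<open>funpow_Suc_right\<close> reconciles the two.\<close>

lemma deriv_bound_higher:
  assumes "deriv_bound k f C"
  shows "i \<le> k \<Longrightarrow> \<bar>(deriv ^^ i) f x\<bar> \<le> C" "i < k \<Longrightarrow> (deriv ^^ i) f differentiable (at x)"
    "continuous_on UNIV ((deriv ^^ k) f)"
  using assms
proof (induction k arbitrary: f i)
  case (Suc k)
  {
    case 1
    then show ?case
      by (cases i) (use Suc.IH(1)[of _ "deriv f"] in \<open>auto simp: funpow_Suc_right simp del: funpow.simps(2)\<close>)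
  next
    case 2
    then show ?case
      by (cases i) (use Suc.IH(2)[of _ "deriv f"] in \<open>auto simp: funpow_Suc_right simp del: funpow.simps(2)\<close>)
  next
    case 3
    then show ?case
      using Suc.IH(3)[of "deriv f"] by (simp add: funpow_Suc_right del: funpow.simps(2))
  }
qed auto

lemma smooth_lift_higher:
  assumes "smooth_lift f"
  shows "(deriv ^^ i) f differentiable (at x)" "continuous_on UNIV ((deriv ^^ i) f)"
proof -
  show d: "(deriv ^^ i) f differentiable (at x)" for i x
  proof (cases i)
    case 0
    then show ?thesis using assms by (simp add: smooth_lift_def)
  next
    case (Suc j)
    obtain C where "deriv_bound (Suc j) (deriv f) C" using assms unfolding smooth_lift_def by blast
    from deriv_bound_higher(2)[OF this, of j] Suc show ?thesis by (simp add: funpow_Suc_right del: funpow.simps(2))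
  qed
  show "continuous_on UNIV ((deriv ^^ i) f)"
    by (intro continuous_at_imp_continuous_on ballI differentiable_imp_continuous_within d)
qed

lemma lift_of_circ:
  assumes "smooth_lift_pair f g"
  obtains m :: int where "lift_of (circ f) = (\<lambda>x. f x + of_int m)"
proof -
  have f: "smooth_lift f" using assms by (simp add: smooth_lift_pair_def)
  obtain m :: int where "\<And>x. lift_of (circ f) x = f x + of_int m"
    using lifts_differ_by_int[OF is_lift_lift_of[OF circ_H_homeo[OF assms]] is_lift_circ[OF f]] by blast
  then show thesis using that by blast
qed

lemma deriv_iterate_add_const:
  assumes "\<And>x. f differentiable (at x)"
  shows "(deriv ^^ i) (\<lambda>x. f x + c) = (\<lambda>x. (deriv ^^ i) f x + (if i = 0 then c else (0 :: real)))"
proof (cases i)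
  case (Suc j)
  have "deriv (\<lambda>x. f x + c) = deriv f"
    by (rule deriv_eqI)
       (auto intro!: derivative_eq_intros assms simp: DERIV_deriv_iff_real_differentiable)
  then show ?thesis using Suc by (simp add: funpow_Suc_right del: funpow.simps(2))
qed simp

lemma deriv_iterate_lift_of_circ:
  assumes "smooth_lift_pair f g"
  obtains m :: int where
    "\<And>i. (deriv ^^ i) (lift_of (circ f)) = (\<lambda>x. (deriv ^^ i) f x + (if i = 0 then of_int m else 0))"
proof -
  have d: "\<And>x. f differentiable (at x)" using assms by (simp add: smooth_lift_pair_def smooth_lift_def)
  obtain m :: int where "lift_of (circ f) = (\<lambda>x. f x + of_int m)" by (rule lift_of_circ[OF assms])
  then show thesis using deriv_iterate_add_const[OF d] that by metis
qed

lemma circle_deriv_circ: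
  assumes "smooth_lift_pair f g" "0 < i"
  shows "circle_deriv i (circ f) z = (deriv ^^ i) f (rep_circle z)"
proof -
  obtain m where "\<And>i. (deriv ^^ i) (lift_of (circ f)) = (\<lambda>x. (deriv ^^ i) f x + (if i = 0 then of_int m else 0))"
    using deriv_iterate_lift_of_circ[OF assms(1)] by blast
  then show ?thesis using assms(2) by (simp add: circle_deriv_def)
qed

lemma C_k_lift_of_circ:
  assumes "smooth_lift_pair f g"
  shows "C_k k (lift_of (circ f))"
proof -
  have f: "smooth_lift f" using assms by (simp add: smooth_lift_pair_def)
  obtain m where m: "\<And>i. (deriv ^^ i) (lift_of (circ f)) = (\<lambda>x. (deriv ^^ i) f x + (if i = 0 then of_int m else 0))"
    using deriv_iterate_lift_of_circ[OF assms] by blast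
  show ?thesis unfolding C_k_def m
  proof (intro conjI allI impI)
    show "(\<lambda>x. (deriv ^^ i) f x + (if i = 0 then of_int m else 0)) differentiable_on UNIV" for i
      unfolding differentiable_on_def
      by (intro ballI differentiable_add smooth_lift_higher(1)[OF f] differentiable_const)
    show "continuous_on UNIV (\<lambda>x. (deriv ^^ k) f x + (if k = 0 then of_int m else 0))"
      by (intro continuous_on_add smooth_lift_higher(2)[OF f] continuous_on_const)
  qed
qed

lemma circ_H_inf:
  assumes "smooth_lift_pair f g"
  shows "circ f \<in> H_inf"
  using C_k_lift_of_circ[OF assms] C_k_lift_of_circ[OF smooth_lift_pair_sym[OF assms]] circ_H_homeo[OF assms]
  by (auto simp: H_inf_def H_diff_def inv_circ[OF assms])

section \<open>Estimates for the smooth metric\<close>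

lemma deriv_iterate_diff:
  assumes "smooth_lift f" "smooth_lift g"
  shows "(deriv ^^ i) (\<lambda>x. f x - g x) = (\<lambda>x. (deriv ^^ i) f x - (deriv ^^ i) g x)"
proof (induction i)
  case (Suc i)
  have "deriv (\<lambda>x. (deriv ^^ i) f x - (deriv ^^ i) g x) = (\<lambda>x. deriv ((deriv ^^ i) f) x - deriv ((deriv ^^ i) g) x)"
    using assms[THEN smooth_lift_higher(1)]
    by (intro deriv_eqI DERIV_diff) (auto simp: DERIV_deriv_iff_real_differentiable)
  then show ?case using Suc by simp
qed simp

lemma norm_diff_circ_le:
  assumes "smooth_lift_pair f f'" "smooth_lift_pair g g'" "deriv_bound k (\<lambda>x. f x - g x) e"
  shows "norm_diff k (circ f) (circ g) \<le> e"
proof -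
  have fg: "smooth_lift f" "smooth_lift g" using assms by (auto simp: smooth_lift_pair_def)
  have "sup_diff i (circ f) (circ g) \<le> e" if "i \<le> k" for i
  proof (cases "i = 0")
    case True
    have "dist (circ f z) (circ g z) \<le> e" for z
      using dist_circle_le[of "f (rep_circle z)" "g (rep_circle z)"] deriv_bound_abs[OF assms(3), of "rep_circle z"]
      by (simp add: circ_def)
    then show ?thesis using True by (simp add: sup_diff_def cSUP_least)
  next
    case False
    have "\<bar>circle_deriv i (circ f) z - circle_deriv i (circ g) z\<bar> \<le> e" for z
      using deriv_bound_higher(1)[OF assms(3) that] False
      by (simp add: circle_deriv_circ[OF assms(1)] circle_deriv_circ[OF assms(2)] deriv_iterate_diff[OF fg])
    then show ?thesis using False by (simp add: sup_diff_def cSUP_least)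
  qed
  then show ?thesis by (simp add: norm_diff_def)
qed

lemma d_k_circ_le:
  assumes "smooth_lift_pair f f'" "smooth_lift_pair g g'"
    "deriv_bound k (\<lambda>x. f x - g x) e" "deriv_bound k (\<lambda>x. f' x - g' x) e"
  shows "d_k k (circ f) (circ g) \<le> e"
  using norm_diff_circ_le[OF assms(1-3)]
    norm_diff_circ_le[OF assms(1,2)[THEN smooth_lift_pair_sym] assms(4)]
  by (simp add: d_k_def inv_circ[OF assms(1)] inv_circ[OF assms(2)])

lemma d_k_mono: "j \<le> k \<Longrightarrow> d_k j f g \<le> d_k k f g"
  unfolding d_k_def norm_diff_def by (intro max.mono Max_mono image_mono) auto

text \<open>A single series dominates both ranges of the index: up to \<open>n\<close> a term is at
  most \<open>e\<close> times its weight, and beyond \<open>n\<close> the factorisation 1/2 = 3/4 *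
  2/3 turns the weight into \<open>(3/4) ^ n\<close> times a geometric term, with sum 2.\<close>

lemma d_inf_le:
  assumes fg: "f \<in> H_inf" "g \<in> H_inf" and e: "d_k n f g \<le> e"
  shows "d_inf f g \<le> e + 2 * (3/4) ^ n"
proof -
  have e0: "0 \<le> e" using e d_k_nonneg[OF fg, of n] by simp
  have "d_k (Suc k) f g / (2 ^ Suc k * (1 + d_k (Suc k) f g)) \<le> e * (1/2) ^ Suc k + (3/4) ^ n * (2/3) ^ Suc k" for k
  proof -
    let ?d = "d_k (Suc k) f g"
    have d0: "0 \<le> ?d" by (rule d_k_nonneg[OF fg])
    have eq: "?d / (2 ^ Suc k * (1 + ?d)) = (?d / (1 + ?d)) * (1/2) ^ Suc k"
      by (simp add: power_one_over field_simps)
    show ?thesis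
    proof (cases "Suc k \<le> n")
      case True
      have "?d / (1 + ?d) \<le> ?d" using d0 by (simp add: divide_le_eq mult_le_cancel_left1)
      also have "\<dots> \<le> e" using d_k_mono[OF True] e by (rule order_trans)
      finally have "(?d / (1 + ?d)) * (1/2) ^ Suc k \<le> e * (1/2) ^ Suc k" by (rule mult_right_mono) simp
      moreover have "(0 :: real) \<le> (3/4) ^ n * (2/3) ^ Suc k" by simp
      ultimately show ?thesis unfolding eq by linarith
    next
      case False
      have "(?d / (1 + ?d)) * (1/2) ^ Suc k \<le> 1 * (1/2) ^ Suc k"
        using d0 by (intro mult_right_mono) auto
      also have "1 * (1/2 :: real) ^ Suc k = (3/4) ^ Suc k * (2/3) ^ Suc k"
        by (simp only: mult_1 power_mult_distrib[symmetric]) simp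
      also have "\<dots> \<le> (3/4) ^ n * (2/3) ^ Suc k"
        using False by (intro mult_right_mono power_decreasing) auto
      finally show ?thesis unfolding eq using e0 by (simp add: add_increasing)
    qed
  qed
  moreover have s: "(\<lambda>k. e * (1/2) ^ Suc k + (3/4) ^ n * (2/3) ^ Suc k) sums (e * 1 + (3/4) ^ n * 2)"
  proof (intro sums_add sums_mult)
    show "(\<lambda>k. (1/2 :: real) ^ Suc k) sums 1" by (rule power_half_series)
    show "(\<lambda>k. (2/3 :: real) ^ Suc k) sums 2" 
      using sums_mult[OF geometric_sums[of "2/3 :: real"], of "2/3"] by simp
  qed
  ultimately have "(\<Sum>k. d_k (Suc k) f g / (2 ^ Suc k * (1 + d_k (Suc k) f g))) \<le> e * 1 + (3/4) ^ n * 2"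
    unfolding sums_unique[OF s] by (intro suminf_le d_inf_summable fg sums_summable[OF s]) auto
  then show ?thesis using fg by (simp add: d_inf_def)
qed

section \<open>Rotation numbers of conjugated rotations\<close>

lemma degree1_mono_near:
  fixes F :: "real \<Rightarrow> real"
  assumes "mono F" "\<And>x. F (x + 1) = F x + 1"
  shows "\<bar>F x - x - F 0\<bar> \<le> 1"
proof -
  have "F (of_int \<lfloor>x\<rfloor>) \<le> F x" "F x \<le> F (of_int \<lfloor>x\<rfloor> + 1)"
    by (rule monoD[OF assms(1)]; linarith)+
  then show ?thesis
    using degree1_int[of F, OF assms(2), of 0 "\<lfloor>x\<rfloor>"] assms(2)[of "of_int \<lfloor>x\<rfloor>"] by simp linarith
qed

text \<open>The n-th iterate of \<open>f\<close> is \<open>H (G x + n * a)\<close>, and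
  \<open>H\<close> stays at bounded distance from the identity, so averaging leaves
  \<open>a\<close>; the integer \<open>m\<close> of the chosen lift disappears modulo 1. Only order
  and degree of \<open>H\<close> enter, because limit conjugacies come with no derivatives.\<close>

lemma rotation_number_circ:
  assumes f: "smooth_lift_pair f f'" and H: "mono H" "\<And>x. H (x + 1) = H x + 1"
    and G: "\<And>x. G (H x) = x" "\<And>x. H (G x) = x" and eq: "\<And>x. f x = H (G x + a)"
  shows "rotation_number (circ f) = circle_of a"
proof -
  obtain m :: int where m: "lift_of (circ f) = (\<lambda>x. f x + of_int m)" by (rule lift_of_circ[OF f])
  have Gs: "G (x + of_int j) = G x + of_int j" for x j
    using degree1_int[of H, OF H(2), of "G x" j] G by metis
  have it: "((\<lambda>x. f x + of_int m) ^^ n) 0 = H (G 0 + real n * a) + of_int (int n * m)" for n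
  proof (induction n)
    case (Suc n)
    have "((\<lambda>x. f x + of_int m) ^^ Suc n) 0 = f (H (G 0 + real n * a) + of_int (int n * m)) + of_int m"
      using Suc by simp
    also have "\<dots> = H (G 0 + real n * a + of_int (int n * m) + a) + of_int m"
      unfolding eq Gs G ..
    also have "G 0 + real n * a + of_int (int n * m) + a = G 0 + real (Suc n) * a + of_int (int n * m)"
      by (simp add: algebra_simps)
    also have "H (G 0 + real (Suc n) * a + of_int (int n * m)) = H (G 0 + real (Suc n) * a) + of_int (int n * m)"
      by (rule degree1_int[of H, OF H(2)])
    finally show ?case by (simp add: algebra_simps)
  qed (simp add: G)
  have "(\<lambda>n. (((lift_of (circ f)) ^^ n) 0 - 0) / real n) \<longlonglongrightarrow> a + of_int m"
  proof (rule Lim_transform2)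
    show "(\<lambda>n. a + of_int m) \<longlonglongrightarrow> a + of_int m" by simp
    \<comment> \<open>By \<open>degree1_mono_near\<close>, \<open>H\<close> moves points by at most
      \<open>1 + \<bar>H 0\<bar>\<close>, and the orbit starts at \<open>G 0\<close>.\<close>
    define C where "C = 1 + \<bar>H 0\<bar> + \<bar>G 0\<bar>"
    have "(\<lambda>n. C * inverse (real n)) \<longlonglongrightarrow> 0"
      by (auto intro!: tendsto_mult_right_zero lim_inverse_n)
    then show "(\<lambda>n. (a + of_int m) - (((lift_of (circ f)) ^^ n) 0 - 0) / real n) \<longlonglongrightarrow> 0"
    proof (rule Lim_null_comparison[rotated])
      show "\<forall>\<^sub>F n in sequentially. norm ((a + of_int m) - (((lift_of (circ f)) ^^ n) 0 - 0) / real n) \<le> C * inverse (real n)"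
        using eventually_gt_at_top[of 0]
      proof eventually_elim
        case (elim n)
        have "(a + of_int m) - (((lift_of (circ f)) ^^ n) 0 - 0) / real n
            = (real n * a - H (G 0 + real n * a)) / real n"
          unfolding m it using elim by (simp add: field_simps)
        then have "norm ((a + of_int m) - (((lift_of (circ f)) ^^ n) 0 - 0) / real n)
            = \<bar>real n * a - H (G 0 + real n * a)\<bar> * inverse (real n)"
          by (simp add: divide_inverse abs_mult)
        also have "\<dots> \<le> C * inverse (real n)"
          using degree1_mono_near[OF H, of "G 0 + real n * a"]
          by (intro mult_right_mono) (auto simp: C_def)
        finally show ?case .
      qed
    qed
  qed
  then have "lim (\<lambda>n. (((lift_of (circ f)) ^^ n) 0 - 0) / real n) = a + of_int m" by (rule limI)
  then show ?thesis by (simp add: rotation_number_def circle_of_eq_iff)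
qed

section \<open>Regularity classes\<close>

lemma periodic_bounded:
  fixes G :: "real \<Rightarrow> real"
  assumes "continuous_on UNIV G" "\<And>x. G (x + 1) = G x"
  shows "\<exists>B\<ge>0. \<forall>x. \<bar>G x\<bar> \<le> B"
proof -
  have per: "G (x + of_int m) = G x" for x m
    \<comment> \<open>Adding the identity turns a periodic function into one of degree one.\<close>
    using degree1_int[of "\<lambda>x. G x + x" x m] assms(2) by simp
  have "compact (G ` {0..1})"
    by (intro compact_continuous_image continuous_on_subset[OF assms(1)]) auto
  then obtain B where B: "\<And>x. x \<in> {0..1} \<Longrightarrow> \<bar>G x\<bar> \<le> B"
    using compact_imp_bounded bounded_iff by (metis image_eqI real_norm_def)
  have "\<bar>G x\<bar> \<le> B" for x
    using B[of "frac x"] per[of "frac x" "\<lfloor>x\<rfloor>"] by (simp add: frac_def frac_lt_1[unfolded frac_def] less_imp_le)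
  then show ?thesis by (meson abs_ge_zero order_trans)
qed

lemma deriv_iterate_lift_lipschitz:
  assumes "f \<in> H_diff (Suc i)"
  shows "\<exists>L\<ge>0. \<forall>x y. \<bar>(deriv ^^ i) (lift_of f) x - (deriv ^^ i) (lift_of f) y\<bar> \<le> L * \<bar>x - y\<bar>"
proof -
  have f: "is_lift (lift_of f) f" and C: "C_k (Suc i) (lift_of f)"
    using assms by (auto simp: H_diff_def is_lift_lift_of)
  let ?G = "(deriv ^^ Suc i) (lift_of f)"
  obtain B where B: "0 \<le> B" "\<And>x. \<bar>?G x\<bar> \<le> B"
    using periodic_bounded[of ?G] C deriv_iterate_periodic[OF f, of i] unfolding C_k_def by blast
  have "norm ((deriv ^^ i) (lift_of f) x - (deriv ^^ i) (lift_of f) y) \<le> B * norm (x - y)" for x y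
  proof (rule field_differentiable_bound[of UNIV _ ?G])
    show "((deriv ^^ i) (lift_of f) has_field_derivative ?G z) (at z within UNIV)" for z
      using C by (simp add: C_k_def differentiable_on_def DERIV_deriv_iff_real_differentiable)
  qed (use B in auto)
  then show ?thesis using B(1) by auto
qed

text \<open>Distances on the circle are at most 1/2, and below 1 a power with exponent less than 1
  only increases them.\<close>

lemma lipschitz_imp_hoelder:
  fixes f :: "circle \<Rightarrow> 'a::metric_space"
  assumes "0 < b" "b < 1" "0 \<le> L" "\<And>x y. dist (f x) (f y) \<le> L * dist x y"
  shows "hoelder b f"
  unfolding hoelder_def
proof (intro exI allI)
  fix x y :: circle
  have "dist x y \<le> dist x y powr b"
  proof (cases "dist x y = 0")
    case False
    then have "0 < dist x y" using zero_le_dist[of x y] by linarith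
    then have "dist x y powr 1 \<le> dist x y powr b"
      using dist_circle_le_half[of x y] assms(2) by (intro powr_mono') auto
    then show ?thesis by simp
  qed simp
  then show "dist (f x) (f y) \<le> L * dist x y powr b"
    using assms(4)[of x y] mult_left_mono[OF _ assms(3)] by (meson order_trans)
qed

lemma hoelder_H_diff_1:
  assumes "f \<in> H_diff 1" "0 < b" "b < 1"
  shows "hoelder b f"
proof -
  obtain L where L: "0 \<le> L" "\<And>x y. \<bar>lift_of f x - lift_of f y\<bar> \<le> L * \<bar>x - y\<bar>"
    using deriv_iterate_lift_lipschitz[of f 0] assms(1) by auto
  have f: "circle_of (lift_of f x) = f (circle_of x)" for x
    using assms(1) is_lift_lift_of[of f] by (simp add: H_diff_def is_lift_def)
  show ?thesis
  proof (rule lipschitz_imp_hoelder[OF assms(2,3) L(1)])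
    fix z w :: circle
    obtain x y where "z = circle_of x" "w = circle_of y" "dist z w = \<bar>x - y\<bar>" by (rule circle_dist_cases)
    then show "dist (f z) (f w) \<le> L * dist z w"
      using dist_circle_le[of "lift_of f x" "lift_of f y"] L(2)[of x y] by (simp flip: f)
  qed
qed

lemma H_inf_subset_H_diff: "f \<in> H_inf \<Longrightarrow> f \<in> H_diff k"
proof (cases "k = 0")
  case True
  assume "f \<in> H_inf"
  then have "f \<in> H_diff 1" by (simp add: H_inf_def)
  then have "f \<in> H_homeo" by (simp add: H_diff_def)
  then show ?thesis using True by (simp add: H_diff_0)
qed (simp add: H_inf_def)

lemma hoelder_circle_deriv:
  assumes "f \<in> H_diff (Suc k)" "0 < k" "0 < b" "b < 1"
  shows "hoelder b (circle_deriv k f)"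
proof -
  obtain L where L: "0 \<le> L" "\<And>x y. \<bar>(deriv ^^ k) (lift_of f) x - (deriv ^^ k) (lift_of f) y\<bar> \<le> L * \<bar>x - y\<bar>"
    using deriv_iterate_lift_lipschitz[OF assms(1)] by auto
  have f: "is_lift (lift_of f) f" using assms(1) by (simp add: H_diff_def is_lift_lift_of)
  obtain j where j: "k = Suc j" using assms(2) by (cases k) auto
  have per: "(deriv ^^ k) (lift_of f) (x + of_int m) = (deriv ^^ k) (lift_of f) x" for x m
    using degree1_int[of "\<lambda>x. (deriv ^^ k) (lift_of f) x + x" x m] deriv_iterate_periodic[OF f, of j]
    unfolding j by simp
  have cd: "circle_deriv k f (circle_of x) = (deriv ^^ k) (lift_of f) x" for x
  proof -
    have "rep_circle (circle_of x) - x \<in> \<int>" by (simp flip: circle_of_eq_iff)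
    then obtain m where "rep_circle (circle_of x) = x + of_int m" by (auto elim!: Ints_cases simp: algebra_simps)
    then show ?thesis by (simp add: circle_deriv_def per)
  qed
  show ?thesis
  proof (rule lipschitz_imp_hoelder[OF assms(3,4) L(1)])
    fix z w :: circle
    obtain x y where "z = circle_of x" "w = circle_of y" "dist z w = \<bar>x - y\<bar>" by (rule circle_dist_cases)
    then show "dist (circle_deriv k f z) (circle_deriv k f w) \<le> L * dist z w"
      using L(2)[of x y] by (simp add: cd dist_real_def)
  qed
qed

lemma H_inf_subset_H_hoelder: 
  assumes "0 < b" "b < 1" shows "H_inf \<subseteq> H_hoelder k b"
  using hoelder_H_diff_1[OF H_inf_subset_H_diff] hoelder_circle_deriv[OF H_inf_subset_H_diff] assms
  by (auto simp: H_hoelder_def H_inf_subset_H_diff)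

text \<open>Together with \<open>regularity_class_hoelder\<close> this is all that the argument uses
  of \<open>D\<close>: conjugacies are built in the smallest class and excluded in the
  largest.\<close>

lemma H_inf_subset_regularity_class:
  assumes "D \<in> regularity_classes" shows "H_inf \<subseteq> D"
proof -
  consider "D = (\<Union>\<beta>\<in>{0<..<1}. H_hoelder 0 \<beta>)" | k b where "D = H_hoelder k b" "0 < b" "b < 1"
    | k where "D = H_diff k" | "D = H_inf"
    using assms unfolding regularity_classes_def by blast
  then show ?thesis
  proof cases
    case 1
    have "H_inf \<subseteq> H_hoelder 0 (1/2)" by (rule H_inf_subset_H_hoelder) auto
    then show ?thesis unfolding 1 by (rule subset_trans) (rule UN_upper, simp)
  qed (use H_inf_subset_H_hoelder H_inf_subset_H_diff in auto)
qed

lemma H_diff_hoelder: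
  assumes "f \<in> H_diff k" "0 < k" shows "hoelder (1/2) f"
proof -
  have "f \<in> H_diff 1"
  proof (cases "k = 1")
    case False
    then have k: "1 < k" using assms(2) by simp
    have *: "C_k 1 F" if "C_k k F" for F
    proof -
      have d: "deriv F differentiable_on UNIV" "F differentiable_on UNIV"
        using that k by (auto simp: C_k_def dest: spec[of _ 1] spec[of _ 0])
      then show ?thesis by (simp add: C_k_def differentiable_imp_continuous_on)
    qed
    show ?thesis using assms(1) * by (simp add: H_diff_def)
  qed (use assms in simp)
  then show ?thesis by (rule hoelder_H_diff_1) auto
qed

lemma regularity_class_hoelder:
  assumes "D \<in> regularity_classes" "f \<in> D"
  shows "f \<in> H_homeo \<and> (\<exists>b>0. hoelder b f)"
proof -
  consider b where "f \<in> H_hoelder 0 b" "0 < b" | k where "f \<in> H_diff k" "0 < k"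
    using assms unfolding regularity_classes_def H_hoelder_def H_inf_def
    by (force split: if_splits)
  then show ?thesis
  proof cases
    case (1 b)
    then show ?thesis by (auto simp: H_hoelder_def H_diff_def)
  next
    case (2 k)
    then show ?thesis using H_diff_hoelder[OF 2] by (auto simp: H_diff_def intro: exI[of _ "1/2"])
  qed
qed

section \<open>Conjugacies between irrational rotations\<close>

text \<open>The degree is 1 by injectivity: the intermediate value theorem gives x in [0, 1] with
  \<open>F x = F 0 + 1\<close>, so x and 0 are the same point of the circle, and only x = 1 is
  possible.\<close>

lemma H_homeo_lift:
  assumes "f \<in> H_homeo"
  obtains F where "is_lift F f" "strict_mono F" "\<And>x. F (x + 1) = F x + 1"
proof -
  obtain F where F: "is_lift F f" "strict_mono F" using assms by (auto simp: H_homeo_def)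
  obtain m :: int where m: "\<And>x. F (x + 1) = F x + of_int m" using is_lift_step[OF F(1)] by blast
  have "F 0 < F 1" using F(2) by (simp add: strict_mono_def)
  then have m1: "1 \<le> m" using m[of 0] by simp
  have "\<exists>x. 0 \<le> x \<and> x \<le> 1 \<and> F x = F 0 + 1"
    using m1 m[of 0] F(1) by (intro IVT') (auto simp: is_lift_def intro: continuous_on_subset)
  then obtain x where x: "0 \<le> x" "x \<le> 1" "F x = F 0 + 1" by blast
  have "f (circle_of x) = f (circle_of 0)"
  proof -
    have "circle_of (F x) = circle_of (F 0)" using x(3) by (simp add: circle_of_eq_iff)
    then show ?thesis using F(1) by (simp add: is_lift_def)
  qed
  then have "circle_of x = circle_of 0" using bij_H_homeo[OF assms] by (simp add: bij_def inj_eq)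
  then obtain j :: int where "x = of_int j" by (auto simp: circle_of_eq_iff elim: Ints_cases)
  with x have "x = 0 \<or> x = 1" by auto
  with x(3) m[of 0] have "m = 1" by auto
  then show thesis using that F m by simp
qed

lemma irrational_orbit_dense:
  assumes "a \<notin> \<rat>" "0 < e"
  obtains n :: nat and j :: int where "\<bar>x - (real n * a + of_int j)\<bar> < e"
proof -
  obtain h k where hk: "0 < k" "\<bar>of_int k * a - of_int h - x\<bar> < e"
    using sequence_of_fractional_parts_is_dense[OF assms] by blast
  show thesis
    by (rule that[of "nat k" "- h"]) (use hk in \<open>simp add: abs_minus_commute\<close>)
qed

text \<open>The expression in \<open>comm\<close> is continuous and integer valued, hence a constant
  \<open>c\<close>. Iteration produces the drift \<open>n * c\<close>, which is bounded because
  \<open>K\<close> stays within 1 of a translation, so \<open>c\<close> vanishes. Then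
  \<open>K x - x\<close> is invariant under \<open>a\<close> and 1, and density with continuity
  makes it constant. Commutation holds only modulo integers since it is read off from circle
  maps.\<close>

lemma rotation_centralizer:
  fixes K :: "real \<Rightarrow> real"
  assumes "continuous_on UNIV K" "mono K" "\<And>x. K (x + 1) = K x + 1"
    and comm: "\<And>x. K (x + a) - K x - a \<in> \<int>" and a: "a \<notin> \<rat>"
  obtains t where "\<And>x. K x = x + t"
proof -
  have cK: "continuous_on UNIV (\<lambda>x. K (x + a))"
    by (rule continuous_on_compose2[OF assms(1)]) (auto intro: continuous_intros)
  have "(\<lambda>x. K (x + a) - K x - a) constant_on UNIV"
  proof (rule continuous_discrete_range_constant[OF connected_UNIV])
    show "continuous_on UNIV (\<lambda>x. K (x + a) - K x - a)"
      by (intro continuous_intros cK assms)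
    show "\<exists>e>0. \<forall>y. y \<in> UNIV \<and> K (y + a) - K y - a \<noteq> K (x + a) - K x - a \<longrightarrow>
        e \<le> norm (K (y + a) - K y - a - (K (x + a) - K x - a))" for x
      using Ints_nonzero_abs_ge1[OF Ints_diff[OF comm comm], of _ x] by (intro exI[of _ 1]) auto
  qed
  then obtain c where c: "\<And>x. K (x + a) - K x - a = c" by (auto simp: constant_on_def)
  have it: "K (x + real n * a) = K x + real n * a + real n * c" for x n
  proof (induction n)
    case (Suc n)
    have "K (x + real (Suc n) * a) = K ((x + real n * a) + a)" by (simp add: algebra_simps)
    also have "\<dots> = K (x + real n * a) + a + c" using c[of "x + real n * a"] by linarith
    finally show ?case using Suc by (simp add: algebra_simps)
  qed simp
  have "\<bar>real n * c\<bar> \<le> 1" for n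
    using degree1_mono_near[OF assms(2,3), of "real n * a"] it[of 0 n] by simp
  then have c0: "c = 0"
  proof -
    obtain n :: nat where n: "1 < real n * \<bar>c\<bar>" if "c \<noteq> 0"
      using reals_Archimedean3[of "\<bar>c\<bar>"] by (metis zero_less_abs_iff)
    show ?thesis using n \<open>\<And>n. \<bar>real n * c\<bar> \<le> 1\<close>[of n] by (auto simp: abs_mult)
  qed
  have per: "K (x + (real n * a + of_int j)) - (x + (real n * a + of_int j)) = K x - x" for x n j
    using it[of x n] c0 degree1_int[of K, OF assms(3), of "x + real n * a" j] by (simp add: add.assoc)
  have "K x - x = K 0" for x
  proof (rule ccontr)
    assume ne: "K x - x \<noteq> K 0"
    have "isCont (\<lambda>y. K y - y) x"
      using assms(1) by (intro continuous_intros) (simp add: continuous_on_eq_continuous_at)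
    then have "(\<lambda>y. K y - y) \<midarrow>x\<rightarrow> K x - x" by (simp add: isCont_def)
    then obtain d where d: "d > 0" "\<And>y. y \<noteq> x \<Longrightarrow> \<bar>y - x\<bar> < d \<Longrightarrow> \<bar>(K y - y) - (K x - x)\<bar> < \<bar>K x - x - K 0\<bar>"
      using ne LIM_D[of "\<lambda>y. K y - y" "K x - x" x "\<bar>K x - x - K 0\<bar>"] by auto
    obtain n :: nat and j :: int where nj: "\<bar>x - (real n * a + of_int j)\<bar> < d"
      using irrational_orbit_dense[OF a d(1)] by blast
    show False
      using d(2)[of "real n * a + of_int j"] nj per[of 0 n j] ne by (auto simp: abs_minus_commute)
  qed
  then have "K x = x + K 0" for x by (metis add.commute diff_add_cancel)
  then show thesis by (rule that)
qed

text \<open>\<open>K\<close>, which is \<open>\<Gamma>\<close> seen in the coordinates of the two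
  rotations, commutes with the rotation by \<open>a\<close> up to integers. Every conjugacy is
  thereby known up to the parameter \<open>t\<close>, which later estimates must tolerate.\<close>

lemma conjugate_rotations:
  fixes H1 G1 H2 G2 :: "real \<Rightarrow> real"
  assumes g: "is_lift \<Gamma> g" "strict_mono \<Gamma>" "\<And>x. \<Gamma> (x + 1) = \<Gamma> x + 1"
    and H1: "mono H1" "\<And>x. H1 (x + 1) = H1 x + 1" "\<And>x. G1 (H1 x) = x" "\<And>x. H1 (G1 x) = x" 
    and H2: "continuous_on UNIV H2" "mono H2" "\<And>x. H2 (x + 1) = H2 x + 1" "\<And>x. G2 (H2 x) = x" "\<And>x. H2 (G2 x) = x" 
    and G1: "continuous_on UNIV G1" "mono G1"
    and F: "\<And>x. F1 x = H1 (G1 x + a)" "\<And>x. F2 x = H2 (G2 x + a)"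
    and FS: "\<And>x. F1 (x + 1) = F1 x + 1" "\<And>x. F2 (x + 1) = F2 x + 1"
    and bij: "bij g" and conj: "circ F1 = g \<circ> circ F2 \<circ> inv g" and a: "a \<notin> \<rat>"
  obtains t where "\<And>x. \<Gamma> x = H1 (G2 x + t)"
proof -
  define K where "K = (\<lambda>x. G1 (\<Gamma> (H2 x)))"
  have c\<Gamma>: "continuous_on UNIV \<Gamma>" and g\<Gamma>: "\<And>x. circle_of (\<Gamma> x) = g (circle_of x)"
    using g(1) by (auto simp: is_lift_def)
  have G1s: "G1 (x + of_int j) = G1 x + of_int j" for x j
    using degree1_int[of H1, OF H1(2), of "G1 x" j] H1 by metis
  have "continuous_on UNIV K" unfolding K_def
    by (rule continuous_on_compose2[OF G1(1) continuous_on_compose2[OF c\<Gamma> H2(1)]]) auto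
  moreover have "mono K" unfolding K_def
    using G1(2) H2(2) strict_mono_mono[OF g(2)] by (auto simp: mono_def)
  moreover have "K (x + 1) = K x + 1" for x
    using G1s[of _ 1] by (simp add: K_def H2 g(3))
  moreover have "K (x + a) - K x - a \<in> \<int>" for x
  proof -
    have "g \<circ> circ F2 = circ F1 \<circ> g"
      unfolding conj using bij by (auto simp: bij_def)
    then have "g (circ F2 (circle_of (H2 x))) = circ F1 (g (circle_of (H2 x)))" by (metis comp_apply)
    then have "circle_of (\<Gamma> (F2 (H2 x))) = circle_of (F1 (\<Gamma> (H2 x)))"
      by (simp add: g\<Gamma>[symmetric] circ_of[of F1, OF FS(1)] circ_of[of F2, OF FS(2)] )
    then obtain j :: int where "\<Gamma> (F2 (H2 x)) = F1 (\<Gamma> (H2 x)) + of_int j"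
      by (auto simp: circle_of_eq_iff elim!: Ints_cases) (metis add.commute diff_add_cancel)
    then have "\<Gamma> (H2 (x + a)) = H1 (K x + a) + of_int j" by (simp add: F H2 K_def)
    then have "K (x + a) = G1 (H1 (K x + a) + of_int j)" by (simp add: K_def)
    then show ?thesis by (simp add: G1s H1)
  qed
  ultimately obtain t where t: "\<And>x. K x = x + t" using rotation_centralizer[of K a] a by blast
  have "\<Gamma> x = H1 (G2 x + t)" for x
    using t[of "G2 x"] H1(4)[of "\<Gamma> x"] by (simp add: K_def H2)
  then show thesis by (rule that)
qed

section \<open>Small perturbations of a Liouville rotation\<close>

text \<open>The rotation by p/q passes through the cover and cancels, so the bound is linear in the
  remainder \<open>t\<close>, with a factor whose degree in q is independent of \<open>q\<close>,
  \<open>k\<close>, \<open>p\<close> and \<open>t\<close>.\<close>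

lemma moebius_cover_conj_rotation:
  "\<exists>c\<ge>1. \<exists>e. \<forall>q>0. \<forall>k p t. \<bar>k\<bar> = 1 - 1 / real q ^ N \<longrightarrow>
    deriv_bound n (\<lambda>x. moebius_cover k q (moebius_cover (- k) q x + (of_int p / real q + t)) - (x + (of_int p / real q + t)))
      (c * real q ^ e * \<bar>t\<bar>)"
proof -
  obtain c e where c: "1 \<le> c" and *: "\<And>q k. 0 < q \<Longrightarrow> \<bar>k\<bar> = 1 - 1 / real q ^ N \<Longrightarrow>
      deriv_bound n (deriv (moebius_cover k q)) (c * real q ^ e)"
    using moebius_cover_deriv_bound[of N n] by blast
  \<comment> \<open>The summand 1 absorbs the extra \<open>\<bar>t\<bar>\<close> that arises from
    subtracting the constant \<open>t\<close>.\<close>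
  define c' where "c' = c * (2 ^ Suc n * c) ^ Suc n + 1"
  define e' where "e' = e + e * Suc n"
  show ?thesis
  proof (intro exI[of _ c'] exI[of _ e'] conjI allI impI)
    show "1 \<le> c'" using c by (simp add: c'_def)
    fix q :: nat and k :: real and p :: int and t :: real
    assume q: "0 < q" and k: "\<bar>k\<bar> = 1 - 1 / real q ^ N"
    define A where "A = moebius_cover k q"
    define B where "B = moebius_cover (- k) q"
    have A: "smooth_lift A" and B: "smooth_lift B" and AB: "\<And>x. A (B x) = x"
      using moebius_cover_smooth_lift_pair[OF k q] by (auto simp: A_def B_def smooth_lift_pair_def)
    have As: "A (x + of_int p / real q) = A x + of_int p / real q" for x
      unfolding A_def by (rule moebius_cover_shift[OF q])
    have q1: "1 \<le> real q" using q by simp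
    have qe: "1 \<le> c * real q ^ e"
      using c one_le_power[OF q1, of e] mult_mono[of 1 c 1 "real q ^ e"] by simp
    have nA: "deriv_bound n (deriv A) (c * real q ^ e)" unfolding A_def by (rule *[OF q k])
    have nB: "deriv_bound n (deriv B) (c * real q ^ e)" unfolding B_def by (rule *[OF q]) (use k in simp)
    have "deriv_bound n (\<lambda>x. A (B x + t) - A (B x)) (c * real q ^ e * \<bar>t\<bar> * (2 ^ Suc n * (c * real q ^ e)) ^ Suc n)"
    proof (rule deriv_bound_compose_diff[OF _ nB _ nB smooth_lift_deriv[OF A] nA])
      show "((\<lambda>x. B x + t) has_field_derivative deriv B x) (at x)" for x
        using DERIV_add[OF smooth_lift_deriv[OF B] DERIV_const[of t]] by simp
      show "deriv_bound n (\<lambda>x. B x + t - B x) \<bar>t\<bar>" by (simp add: deriv_bound_const)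
    qed (use smooth_lift_deriv[OF B] qe in auto)
    from deriv_bound_diff[OF this deriv_bound_const[of t "\<bar>t\<bar>"]]
    have "deriv_bound n (\<lambda>x. A (B x + t) - A (B x) - t) (c * real q ^ e * \<bar>t\<bar> * (2 ^ Suc n * (c * real q ^ e)) ^ Suc n + \<bar>t\<bar>)"
      by simp
    then have "deriv_bound n (\<lambda>x. A (B x + t) - A (B x) - t) (c' * real q ^ e' * \<bar>t\<bar>)"
    proof (rule deriv_bound_mono)
      have "(2 ^ Suc n * (c * real q ^ e)) ^ Suc n = (2 ^ Suc n * c) ^ Suc n * (real q ^ e) ^ Suc n"
        by (simp only: power_mult_distrib[symmetric] mult.assoc)
      then have "c * real q ^ e * (2 ^ Suc n * (c * real q ^ e)) ^ Suc n + 1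
          = (c * (2 ^ Suc n * c) ^ Suc n) * real q ^ e' + 1"
        by (simp only: e'_def power_add power_mult) (simp only: mult_ac)
      also have "\<dots> \<le> c' * real q ^ e'"
        using one_le_power[OF q1, of e'] by (simp add: c'_def algebra_simps)
      finally have "(c * real q ^ e * (2 ^ Suc n * (c * real q ^ e)) ^ Suc n + 1) * \<bar>t\<bar> \<le> c' * real q ^ e' * \<bar>t\<bar>"
        by (rule mult_right_mono) simp
      then show "c * real q ^ e * \<bar>t\<bar> * (2 ^ Suc n * (c * real q ^ e)) ^ Suc n + \<bar>t\<bar> \<le> c' * real q ^ e' * \<bar>t\<bar>"
        by (simp add: algebra_simps)
    qed
    moreover have "(\<lambda>x. A (B x + t) - A (B x) - t) = (\<lambda>x. A (B x + (of_int p / real q + t)) - (x + (of_int p / real q + t)))"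
    proof
      fix x
      have "A (B x + (of_int p / real q + t)) = A (B x + t) + of_int p / real q"
        using As[of "B x + t"] by (simp only: ac_simps)
      then show "A (B x + t) - A (B x) - t = A (B x + (of_int p / real q + t)) - (x + (of_int p / real q + t))"
        by (simp add: AB)
    qed
    ultimately show "deriv_bound n (\<lambda>x. moebius_cover k q (moebius_cover (- k) q x + (of_int p / real q + t)) - (x + (of_int p / real q + t)))
        (c' * real q ^ e' * \<bar>t\<bar>)" by (simp add: A_def B_def)
  qed
qed

text \<open>\<open>C\<close> depends on the conjugating pair and on \<open>n\<close>, but not on
  \<open>f\<close>. One derivative is spent because composition bounds involve the derivative of
  \<open>f\<close>; the restriction on \<open>e\<close> keeps that derivative bounded by 2, so that
  the result is linear in \<open>e\<close>.\<close>

lemma conj_near_rotation: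
  assumes "smooth_lift h" "smooth_lift h'"
  shows "\<exists>C\<ge>0. \<forall>f s e. deriv_bound (Suc n) (\<lambda>x. f x - (x + s)) e \<longrightarrow> e \<le> 1 \<longrightarrow>
    deriv_bound n (\<lambda>x. h (f (h' x)) - h (h' x + s)) (C * e)"
proof -
  obtain F K where F: "1 \<le> F" "deriv_bound n (deriv h) F" and K: "1 \<le> K" "deriv_bound n (deriv h') K"
    using assms[THEN smooth_lift_deriv_bound] by metis
  show ?thesis
  proof (intro exI[of _ "F * (2 ^ Suc n * 2) ^ Suc n * (2 ^ n * K) ^ n"] conjI allI impI)
    show "0 \<le> F * (2 ^ Suc n * 2) ^ Suc n * (2 ^ n * K) ^ n" using F K by simp
    fix f :: "real \<Rightarrow> real" and s e :: real
    assume f: "deriv_bound (Suc n) (\<lambda>x. f x - (x + s)) e" and e: "e \<le> 1"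
    define u where "u = (\<lambda>x. f x - (x + s))"
    have fu: "f = (\<lambda>x. u x + (x + s))" by (auto simp: u_def)
    have u: "deriv_bound (Suc n) u e" using f by (simp add: u_def)
    have df: "(f has_field_derivative deriv u x + 1) (at x)" for x
      unfolding fu by (rule DERIV_add[OF deriv_bound_SucD[OF u]]) (auto intro!: derivative_eq_intros)
    have "deriv_bound n (\<lambda>x. deriv u x + 1) (e + 1)"
      using u by (intro deriv_bound_add deriv_bound_const) auto
    then have nf: "deriv_bound n (\<lambda>x. deriv u x + 1) 2" by (rule deriv_bound_mono) (use e in simp)
    have "deriv_bound n (\<lambda>x. h (f x) - h (x + s)) (F * e * (2 ^ Suc n * 2) ^ Suc n)"
    proof (rule deriv_bound_compose_diff[OF df nf _ _ smooth_lift_deriv[OF assms(1)] F(2)])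
      show "((\<lambda>x. x + s) has_field_derivative 1) (at x)" for x by (auto intro!: derivative_eq_intros)
      show "deriv_bound n (\<lambda>x. 1) 2" by (rule deriv_bound_const) simp
      show "deriv_bound n (\<lambda>x. f x - (x + s)) e" using f by (rule deriv_bound_Suc_imp)
    qed simp
    from deriv_bound_compose[OF smooth_lift_deriv[OF assms(2)] K(2,1) this]
    show "deriv_bound n (\<lambda>x. h (f (h' x)) - h (h' x + s)) (F * (2 ^ Suc n * 2) ^ Suc n * (2 ^ n * K) ^ n * e)"
      by (simp add: mult_ac)
  qed
qed

text \<open>A bound on the denominators leaves only finitely many of the fractions, since their
  numerators are then bounded too; hence the infinitely many approximations contain one with
  denominator at least \<open>Q\<close>.\<close>

lemma liouville_approximation:
  assumes "liouville_real a" "0 < C"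
  obtains p :: int and q :: nat where "Q \<le> q" "0 < q" "\<bar>a - of_int p / real q\<bar> < C / real q ^ m"
proof -
  let ?S = "{(p::int, q::nat). 0 < q \<and> 0 < \<bar>a - of_int p / of_nat q\<bar> \<and> \<bar>a - of_int p / of_nat q\<bar> < C / of_nat q ^ m}"
  have inf: "infinite ?S" using assms by (simp add: liouville_real_def)
  define B where "B = \<lceil>real Q * (\<bar>a\<bar> + C)\<rceil>"
  have "\<exists>(p, q)\<in>?S. Q \<le> q"
  proof (rule ccontr)
    assume no: "\<not> (\<exists>(p, q)\<in>?S. Q \<le> q)"
    have "?S \<subseteq> {-B..B} \<times> {0..Q}"
    proof
      fix z assume "z \<in> ?S"
      then obtain p q where z: "z = (p, q)" and "(p, q) \<in> ?S" by (cases z) simp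
      then have q: "0 < q" and lt: "\<bar>a - of_int p / real q\<bar> < C / real q ^ m" by auto
      have "\<not> Q \<le> q" using no \<open>(p, q) \<in> ?S\<close> by blast
      then have qQ: "q < Q" by simp
      have "C / real q ^ m \<le> C / 1"
        using q assms(2) by (intro divide_left_mono) auto
      then have "\<bar>of_int p / real q\<bar> \<le> \<bar>a\<bar> + C" using lt by linarith
      then have "\<bar>of_int p\<bar> \<le> real q * (\<bar>a\<bar> + C)" using q by (simp add: field_simps)
      also have "\<dots> \<le> real Q * (\<bar>a\<bar> + C)" using qQ assms(2) by (intro mult_right_mono) auto
      also have "\<dots> \<le> of_int B" unfolding B_def by (rule le_of_int_ceiling)
      finally show "z \<in> {-B..B} \<times> {0..Q}" using qQ z by auto
    qed
    then have "finite ?S" by (rule finite_subset) auto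
    then show False using inf by simp
  qed
  then show thesis using that by auto
qed

text \<open>The degree \<open>e\<close> comes from the stage maps and the constants \<open>C\<close>
  from the finitely many earlier conjugacies; none depends on \<open>q\<close>, which is chosen
  last. Both signs of \<open>a\<close> occur because inverse diffeomorphisms are conjugates of the
  rotation by \<open>- a\<close>.\<close>

lemma liouville_stage:
  assumes a: "liouville_real a" and P: "finite P" "\<And>h h'. (h, h') \<in> P \<Longrightarrow> smooth_lift h \<and> smooth_lift h'" and r: "0 < r"
  obtains q :: nat where "Q \<le> q" "0 < q"
    "\<And>h h' s. (h, h') \<in> P \<Longrightarrow> s \<in> {a, -a} \<Longrightarrow> 
      deriv_bound n (\<lambda>x. h (moebius_cover (1 - 1 / real q ^ N) q (moebius_cover (- (1 - 1 / real q ^ N)) q (h' x) + s)) - h (h' x + s)) r"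
proof -
  obtain c e where c: "1 \<le> c" and ce: "\<forall>q>0. \<forall>k p t. \<bar>k\<bar> = 1 - 1 / real q ^ N \<longrightarrow>
    deriv_bound (Suc n) (\<lambda>x. moebius_cover k q (moebius_cover (- k) q x + (of_int p / real q + t)) - (x + (of_int p / real q + t)))
      (c * real q ^ e * \<bar>t\<bar>)"
    using moebius_cover_conj_rotation[of N "Suc n"] by (elim exE conjE)
  have "\<forall>hh\<in>P. \<exists>C\<ge>0. \<forall>f s e. deriv_bound (Suc n) (\<lambda>x. f x - (x + s)) e \<longrightarrow> e \<le> 1 \<longrightarrow>
      deriv_bound n (\<lambda>x. fst hh (f (snd hh x)) - fst hh (snd hh x + s)) (C * e)"
  proof
    fix hh assume "hh \<in> P"
    then have "smooth_lift (fst hh)" "smooth_lift (snd hh)" using P(2)[of "fst hh" "snd hh"] by simp_all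
    then show "\<exists>C\<ge>0. \<forall>f s e. deriv_bound (Suc n) (\<lambda>x. f x - (x + s)) e \<longrightarrow> e \<le> 1 \<longrightarrow>
        deriv_bound n (\<lambda>x. fst hh (f (snd hh x)) - fst hh (snd hh x + s)) (C * e)"
      by (rule conj_near_rotation)
  qed
  from bchoice[OF this] obtain C where C0: "\<forall>hh\<in>P. C hh \<ge> 0 \<and>
      (\<forall>f s e. deriv_bound (Suc n) (\<lambda>x. f x - (x + s)) e \<longrightarrow> e \<le> 1 \<longrightarrow>
        deriv_bound n (\<lambda>x. fst hh (f (snd hh x)) - fst hh (snd hh x + s)) (C hh * e))" ..
  have C: "0 \<le> C hh" if "hh \<in> P" for hh
    using bspec[OF C0 that] by (rule conjunct1)
  have CD: "deriv_bound n (\<lambda>x. fst hh (f (snd hh x)) - fst hh (snd hh x + s)) (C hh * e)"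
    if "hh \<in> P" "deriv_bound (Suc n) (\<lambda>x. f x - (x + s)) e" "e \<le> 1" for hh f s e
    using bspec[OF C0 that(1), THEN conjunct2, rule_format, OF that(2,3)] .
  define S where "S = sum C P + 1"
  have S: "1 \<le> S" unfolding S_def using C by (simp add: sum_nonneg)
  have CS: "C hh \<le> S" if "hh \<in> P" for hh
    using member_le_sum[of hh P C] that C P(1) by (simp add: S_def)
  \<comment> \<open>Chosen so that the deviation is at most 1, as \<open>conj_near_rotation\<close>
    requires, and at most \<open>r / S\<close>, which leaves \<open>r\<close> after multiplication
    by the common constant \<open>S\<close>.\<close>
  define d where "d = min 1 (r / S) / c"
  have d: "0 < d" using c S r by (simp add: d_def)
  obtain p :: int and q :: nat where q: "Q \<le> q" "0 < q" and pq: "\<bar>a - of_int p / real q\<bar> < d / real q ^ e"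
    using liouville_approximation[OF a d] by blast
  show thesis
  proof (rule that[OF q])
    fix h h' s assume hh: "(h, h') \<in> P" and s: "s \<in> {a, -a}"
    define k where "k = 1 - 1 / real q ^ N"
    have "1 / real q ^ N \<le> 1" using q(2) by (simp add: divide_le_eq)
    then have k: "\<bar>k\<bar> = 1 - 1 / real q ^ N" by (simp add: k_def)
    obtain p' t where st: "s = of_int p' / real q + t" "\<bar>t\<bar> = \<bar>a - of_int p / real q\<bar>"
    proof (cases "s = a")
      case True
      then show thesis using that[of p "a - of_int p / real q"] by simp
    next
      case False
      then show thesis using that[of "- p" "of_int p / real q - a"] s by (simp add: abs_minus_commute)
    qed
    have "c * real q ^ e * \<bar>t\<bar> \<le> c * real q ^ e * (d / real q ^ e)"
      using pq st(2) c by (intro mult_left_mono) auto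
    also have "\<dots> = min 1 (r / S)" using q(2) c by (simp add: d_def)
    finally have b: "c * real q ^ e * \<bar>t\<bar> \<le> 1" "c * real q ^ e * \<bar>t\<bar> \<le> r / S" by auto
    have "deriv_bound n (\<lambda>x. h (moebius_cover k q (moebius_cover (- k) q (h' x) + s)) - h (h' x + s)) (C (h, h') * (c * real q ^ e * \<bar>t\<bar>))"
      using CD[OF hh ce[rule_format, OF q(2) k, of p' t] b(1)] by (simp add: st(1))
    then show "deriv_bound n (\<lambda>x. h (moebius_cover (1 - 1 / real q ^ N) q (moebius_cover (- (1 - 1 / real q ^ N)) q (h' x) + s)) - h (h' x + s)) r"
      unfolding k_def[symmetric]
    proof (rule deriv_bound_mono)
      have "C (h, h') * (c * real q ^ e * \<bar>t\<bar>) \<le> S * (r / S)"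
        using S CS[OF hh] b(2) c C[OF hh] by (intro mult_mono) auto
      then show "C (h, h') * (c * real q ^ e * \<bar>t\<bar>) \<le> r" using S by simp
    qed
  qed
qed

section \<open>The scales of the construction\<close>

text \<open>With this parameter \<open>moebius_cover_expands\<close> sends an interval of length
  q^-(n + 2) to one of length at least 1 / (4 q).\<close>

definition stage_map :: "nat \<Rightarrow> nat \<Rightarrow> real \<Rightarrow> real" where
  "stage_map n q = moebius_cover (1 - 1 / real q ^ Suc n) q"

definition stage_inv :: "nat \<Rightarrow> nat \<Rightarrow> real \<Rightarrow> real" where
  "stage_inv n q = moebius_cover (- (1 - 1 / real q ^ Suc n)) q"

text \<open>The new stage acts first, next to the rotation that it nearly commutes with. The earlier
  stages form a left factor, which can be exchanged without touching the tail.\<close>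

primrec partial_conj :: "(nat \<Rightarrow> nat) \<Rightarrow> nat \<Rightarrow> (nat \<Rightarrow> bool) \<Rightarrow> real \<Rightarrow> real" where
  "partial_conj q 0 x = id"
| "partial_conj q (Suc n) x = partial_conj q n x \<circ> (if x n then stage_map n (q n) else id)"

primrec partial_inv :: "(nat \<Rightarrow> nat) \<Rightarrow> nat \<Rightarrow> (nat \<Rightarrow> bool) \<Rightarrow> real \<Rightarrow> real" where
  "partial_inv q 0 x = id"
| "partial_inv q (Suc n) x = (if x n then stage_inv n (q n) else id) \<circ> partial_inv q n x"

lemma stage_pair:
  assumes "0 < q" shows "smooth_lift_pair (stage_map n q) (stage_inv n q)"
proof -
  have "1 \<le> real q ^ Suc n" using assms by (intro one_le_power) simp
  then have "1 / real q ^ Suc n \<le> 1" by (simp add: divide_le_eq del: power_Suc)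
  then show ?thesis unfolding stage_map_def stage_inv_def
    by (intro moebius_cover_smooth_lift_pair[where N = "Suc n"] assms) (simp del: power_Suc)
qed

lemma partial_pair:
  assumes "\<And>i. i < n \<Longrightarrow> 0 < q i"
  shows "smooth_lift_pair (partial_conj q n x) (partial_inv q n x)"
  using assms
proof (induction n)
  case (Suc n)
  then have IH: "smooth_lift_pair (partial_conj q n x) (partial_inv q n x)" by simp
  show ?case
    using smooth_lift_pair_comp[OF IH stage_pair[of "q n" n]] IH Suc.prems by (simp add: comp_def)
qed (simp add: smooth_lift_pair_id)

lemma partial_cong:
  assumes "\<And>i. i < n \<Longrightarrow> q i = q' i"
  shows "partial_conj q n = partial_conj q' n" "partial_inv q n = partial_inv q' n"
  using assms by (induction n) (auto intro!: ext)

text \<open>Only the first \<open>n\<close> coin tosses enter, so there are at most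
  \<open>2 ^ n\<close> pairs; one scale can then serve all \<open>x\<close> simultaneously.\<close>

lemma finite_partial_pairs: "finite (range (\<lambda>x. (partial_conj q n x, partial_inv q n x)))"
proof (induction n)
  case (Suc n)
  let ?f = "\<lambda>((h, h'), b). (h \<circ> (if b then stage_map n (q n) else id), (if b then stage_inv n (q n) else id) \<circ> h')"
  have "range (\<lambda>x. (partial_conj q (Suc n) x, partial_inv q (Suc n) x))
      \<subseteq> ?f ` (range (\<lambda>x. (partial_conj q n x, partial_inv q n x)) \<times> UNIV)"
  proof
    fix z assume "z \<in> range (\<lambda>x. (partial_conj q (Suc n) x, partial_inv q (Suc n) x))"
    then obtain x where "z = (partial_conj q (Suc n) x, partial_inv q (Suc n) x)" by blast
    then show "z \<in> ?f ` (range (\<lambda>x. (partial_conj q n x, partial_inv q n x)) \<times> UNIV)"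
      by (intro image_eqI[of _ _ "((partial_conj q n x, partial_inv q n x), x n)"]) simp_all
  qed
  then show ?case by (rule finite_subset) (intro finite_imageI finite_cartesian_product Suc finite)
qed simp

text \<open>The second clause makes all later stages negligible at the scale \<open>delta i\<close> on which stage \<open>i\<close>
  expands; the third one makes the partial conjugacies and their inverses converge uniformly; the
  last one gives convergence of the diffeomorphisms in the smooth topology.\<close>

definition good_scale :: "real \<Rightarrow> (nat \<Rightarrow> nat) \<Rightarrow> nat \<Rightarrow> nat \<Rightarrow> bool" where
  "good_scale a q n r \<longleftrightarrow> n + 40 \<le> r \<and>
    (\<forall>i<n. 2 ^ n * 8 * q i ^ (i + 2) \<le> r) \<and>
    (\<exists>L\<ge>1. 2 * L * 2 ^ n \<le> real r \<and> (\<forall>x y z. 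
      \<bar>partial_conj q n x y - partial_conj q n x z\<bar> \<le> L * \<bar>y - z\<bar> \<and>
      \<bar>partial_inv q n x y - partial_inv q n x z\<bar> \<le> L * \<bar>y - z\<bar>)) \<and>
    (\<forall>x. \<forall>s\<in>{a, -a}. deriv_bound n (\<lambda>y. 
       partial_conj q n x (stage_map n r (stage_inv n r (partial_inv q n x y) + s))
       - partial_conj q n x (partial_inv q n x y + s)) ((1/2) ^ n))"

lemma uniform_lipschitz:
  assumes "finite P" "\<And>h h'. (h, h') \<in> P \<Longrightarrow> smooth_lift h \<and> smooth_lift h'"
  shows "\<exists>L\<ge>1. \<forall>(h, h')\<in>P. \<forall>y z. \<bar>h y - h z\<bar> \<le> L * \<bar>y - z\<bar> \<and> \<bar>h' y - h' z\<bar> \<le> L * \<bar>y - z\<bar>"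
  using assms
proof (induction P)
  case empty
  show ?case by (auto intro!: exI[of _ 1])
next
  case (insert hh P)
  obtain h h' where hh: "hh = (h, h')" by (cases hh)
  obtain L where L: "L \<ge> 1" "\<And>h h' y z. (h, h') \<in> P \<Longrightarrow> \<bar>h y - h z\<bar> \<le> L * \<bar>y - z\<bar> \<and> \<bar>h' y - h' z\<bar> \<le> L * \<bar>y - z\<bar>"
    using insert by fastforce
  obtain L1 where L1: "L1 \<ge> 1" "\<And>y z. \<bar>h y - h z\<bar> \<le> L1 * \<bar>y - z\<bar>"
    using smooth_lift_lipschitz[of h] insert(4)[of h h'] hh by auto
  obtain L2 where L2: "L2 \<ge> 1" "\<And>y z. \<bar>h' y - h' z\<bar> \<le> L2 * \<bar>y - z\<bar>"
    using smooth_lift_lipschitz[of h'] insert(4)[of h h'] hh by auto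
  have le: "u \<le> (L + L1 + L2) * \<bar>w\<bar>" if "u \<le> L * \<bar>w\<bar> \<or> u \<le> L1 * \<bar>w\<bar> \<or> u \<le> L2 * \<bar>w\<bar>" for u w
  proof -
    have "0 \<le> L * \<bar>w\<bar>" "0 \<le> L1 * \<bar>w\<bar>" "0 \<le> L2 * \<bar>w\<bar>" using L(1) L1(1) L2(1) by auto
    then show ?thesis using that by (auto simp: algebra_simps)
  qed
  show ?case
    by (rule exI[of _ "L + L1 + L2"]) (use L L1 L2 hh in \<open>auto intro!: le\<close>)
qed

lemma good_scale_exists:
  assumes a: "liouville_real a" and q: "\<And>i. i < n \<Longrightarrow> 0 < q i"
  shows "\<exists>r. good_scale a q n r"
proof -
  let ?P = "range (\<lambda>x. (partial_conj q n x, partial_inv q n x))"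
  have P: "\<And>h h'. (h, h') \<in> ?P \<Longrightarrow> smooth_lift h \<and> smooth_lift h'"
    using partial_pair[of n q, OF q] by (auto simp: smooth_lift_pair_def)
  obtain L where L: "L \<ge> 1" "\<forall>(h, h')\<in>?P. \<forall>y z. \<bar>h y - h z\<bar> \<le> L * \<bar>y - z\<bar> \<and> \<bar>h' y - h' z\<bar> \<le> L * \<bar>y - z\<bar>"
    using uniform_lipschitz[OF finite_partial_pairs P] by blast
  \<comment> \<open>A sum of nonnegative terms, so that it dominates each lower bound on the scale
    in \<open>good_scale\<close>.\<close>
  define Q where "Q = n + 40 + (\<Sum>i<n. 2 ^ n * 8 * q i ^ (i + 2)) + nat \<lceil>2 * L * 2 ^ n\<rceil>"
  obtain r where r: "Q \<le> r" "0 < r" and nb: "\<And>h h' s. (h, h') \<in> ?P \<Longrightarrow> s \<in> {a, -a} \<Longrightarrow> 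
      deriv_bound n (\<lambda>x. h (moebius_cover (1 - 1 / real r ^ Suc n) r (moebius_cover (- (1 - 1 / real r ^ Suc n)) r (h' x) + s)) - h (h' x + s)) ((1/2) ^ n)"
    using liouville_stage[OF a finite_partial_pairs P, where r = "(1/2) ^ n" and Q = Q and n = n and N = "Suc n"]
    by (auto simp del: power_Suc)
  have "good_scale a q n r"
    unfolding good_scale_def
  proof (intro conjI allI impI ballI exI[of _ L])
    show "n + 40 \<le> r" using r(1) by (simp add: Q_def)
    show "2 ^ n * 8 * q i ^ (i + 2) \<le> r" if "i < n" for i
      using member_le_sum[of i "{..<n}" "\<lambda>i. 2 ^ n * 8 * q i ^ (i + 2)"] that r(1) by (simp add: Q_def)
    show "2 * L * 2 ^ n \<le> real r"
    proof -
      have "nat \<lceil>2 * L * 2 ^ n\<rceil> \<le> r" using r(1) unfolding Q_def by linarith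
      then show ?thesis by linarith
    qed
  qed (use L nb in \<open>auto simp: stage_map_def stage_inv_def simp del: power_Suc\<close>)
  then show ?thesis ..
qed

text \<open>The condition on each scale involves all earlier ones; by \<open>partial_cong\<close> it
  involves no later ones, which well-founded choice requires.\<close>

lemma good_scales:
  assumes "liouville_real a"
  obtains q where "\<And>n. good_scale a q n (q n)"
proof -
  have "\<exists>q. \<forall>n. good_scale a q n (q n)"
  proof (rule dependent_wf_choice[OF wf_less_than])
    fix f g :: "nat \<Rightarrow> nat" and n r
    assume eq: "\<And>z. (z, n) \<in> less_than \<Longrightarrow> f z = g z"
    then have "partial_conj f n = partial_conj g n" "partial_inv f n = partial_inv g n"
      by (intro partial_cong; simp)+
    then show "good_scale a f n r = good_scale a g n r" using eq by (simp add: good_scale_def)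
  next
    fix n and f :: "nat \<Rightarrow> nat"
    assume "\<And>y. (y, n) \<in> less_than \<Longrightarrow> good_scale a f y (f y)"
    then have "0 < f i" if "i < n" for i using that by (force simp: good_scale_def)
    then show "\<exists>r. good_scale a f n r" by (rule good_scale_exists[OF assms])
  qed
  then show thesis using that by blast
qed

section \<open>Limits of sequences with geometric steps\<close>

lemma smooth_lift_limit:
  assumes "\<And>n. smooth_lift (f n)" "\<And>k. \<exists>n C. deriv_bound k (\<lambda>x. F x - f n x) C"
    and "strict_mono F" "\<And>x. F (x + 1) = F x + 1"
  shows "smooth_lift F"
proof -
  have *: "(\<forall>x. F differentiable (at x)) \<and> (\<exists>C. deriv_bound k (deriv F) C)" for k
  proof -
    \<comment> \<open>The approximant may vary with the order \<open>k\<close>, because C^k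
      convergence is controlled only from stage \<open>k\<close> on.\<close>
    obtain n C where C: "deriv_bound (Suc k) (\<lambda>x. F x - f n x) C" using assms(2) by blast
    define u where "u = (\<lambda>x. F x - f n x)"
    have u: "deriv_bound (Suc k) u C" using C by (simp add: u_def)
    have d: "(F has_field_derivative deriv u x + deriv (f n) x) (at x)" for x
      using DERIV_add[OF deriv_bound_SucD[OF u] smooth_lift_deriv[OF assms(1)[of n]], of x] by (simp add: u_def)
    obtain K where "deriv_bound k (deriv (f n)) K" using assms(1)[of n] unfolding smooth_lift_def by blast
    moreover have "deriv_bound k (deriv u) C" using u by simp
    ultimately have "deriv_bound k (deriv F) (C + K)"
      unfolding deriv_eqI[OF d] by (intro deriv_bound_add)
    then show ?thesis using d by (auto simp: real_differentiable_def)
  qed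
  then show ?thesis using assms(3,4) unfolding smooth_lift_def by blast
qed

text \<open>The subtracted power is the exact remainder of the geometric series; it lets the
  induction close.\<close>

lemma geometric_telescope:
  assumes "\<And>n. N \<le> n \<Longrightarrow> \<bar>f (Suc n) - f n\<bar> \<le> (1/2 :: real) ^ n" "N \<le> n" "n \<le> m"
  shows "\<bar>f m - f n\<bar> \<le> 2 * (1/2) ^ n - 2 * (1/2) ^ m"
  using assms(3)
proof (induction m rule: dec_induct)
  case (step m)
  then show ?case using assms(1)[of m] assms(2) by simp
qed simp

lemma deriv_bound_geometric_telescope:
  assumes "\<And>n. N \<le> n \<Longrightarrow> deriv_bound k (\<lambda>x. f (Suc n) x - f n x) ((1/2) ^ n)" "N \<le> n" "n \<le> m"
  shows "deriv_bound k (\<lambda>x. f m x - f n x) (2 * (1/2) ^ n - 2 * (1/2) ^ m)"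
  using assms(3)
proof (induction m rule: dec_induct)
  case base
  show ?case by (simp add: deriv_bound_const)
next
  case (step m)
  then have "deriv_bound k (\<lambda>x. (f (Suc m) x - f m x) + (f m x - f n x)) ((1/2) ^ m + (2 * (1/2) ^ n - 2 * (1/2) ^ m))"
    using assms(1)[of m] assms(2) by (intro deriv_bound_add) auto
  then show ?case by simp
qed

lemma geometric_limit:
  fixes f :: "nat \<Rightarrow> real"
  assumes "\<And>n. \<bar>f (Suc n) - f n\<bar> \<le> (1/2) ^ n"
  shows "f \<longlonglongrightarrow> lim f" "\<bar>lim f - f n\<bar> \<le> 2 * (1/2) ^ n"
proof -
  have bd: "\<bar>f m - f n\<bar> \<le> 2 * (1/2) ^ n" if "n \<le> m" for n m
    using geometric_telescope[of 0 f n m] assms that by (smt (verit) le0 zero_le_power)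
  have e0: "(\<lambda>n. 2 * (1/2 :: real) ^ n) \<longlonglongrightarrow> 0" 
    by (intro tendsto_mult_right_zero LIMSEQ_realpow_zero) auto
  have "Cauchy f"
  proof (rule metric_CauchyI)
    fix e :: real assume "0 < e"
    then have "\<forall>\<^sub>F n in sequentially. 2 * (1/2 :: real) ^ n < e / 2" by (intro order_tendstoD[OF e0]) auto
    then obtain N where N: "2 * (1/2 :: real) ^ N < e / 2" by (auto simp: eventually_sequentially)
    show "\<exists>N. \<forall>m\<ge>N. \<forall>n\<ge>N. dist (f m) (f n) < e"
    proof (intro exI allI impI)
      fix m n assume "N \<le> m" "N \<le> n"
      then show "dist (f m) (f n) < e" using bd[of N m] bd[of N n] N by (auto simp: dist_real_def)
    qed
  qed
  then show lim: "f \<longlonglongrightarrow> lim f" by (simp add: Cauchy_convergent_iff convergent_LIMSEQ_iff)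
  show "\<bar>lim f - f n\<bar> \<le> 2 * (1/2) ^ n"
  proof (rule tendsto_upperbound)
    show "(\<lambda>m. \<bar>f m - f n\<bar>) \<longlonglongrightarrow> \<bar>lim f - f n\<bar>" by (intro tendsto_intros lim)
    show "\<forall>\<^sub>F m in sequentially. \<bar>f m - f n\<bar> \<le> 2 * (1/2) ^ n"
      using eventually_ge_at_top[of n] by eventually_elim (rule bd)
  qed simp
qed

lemma half_power_tendsto_0: "(\<lambda>n. 2 * (1/2 :: real) ^ n) \<longlonglongrightarrow> 0"
  by (intro tendsto_mult_right_zero LIMSEQ_realpow_zero) auto

text \<open>Uniform convergence lets the arguments move with \<open>n\<close>, which identifies
  limits of compositions such as \<open>h n x (h' n x y)\<close>.\<close>

lemma geometric_limit_continuous: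
  fixes f :: "nat \<Rightarrow> real \<Rightarrow> real"
  assumes "\<And>n. continuous_on UNIV (f n)" "\<And>n x. \<bar>F x - f n x\<bar> \<le> 2 * (1/2) ^ n"
  shows "continuous_on UNIV F" "y \<longlonglongrightarrow> z \<Longrightarrow> (\<lambda>n. f n (y n)) \<longlonglongrightarrow> F z"
proof -
  have "uniform_limit UNIV f F sequentially"
  proof (rule uniform_limitI)
    fix r :: real assume "0 < r"
    then have "\<forall>\<^sub>F n in sequentially. 2 * (1/2 :: real) ^ n < r" by (rule order_tendstoD[OF half_power_tendsto_0])
    then show "\<forall>\<^sub>F n in sequentially. \<forall>x\<in>UNIV. dist (f n x) (F x) < r"
    proof eventually_elim
      case (elim n)
      then show ?case using assms(2) by (auto simp: dist_real_def abs_minus_commute intro: le_less_trans)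
    qed
  qed
  then show c: "continuous_on UNIV F"
    by (rule uniform_limit_theorem[rotated]) (use assms(1) in auto)
  show "(\<lambda>n. f n (y n)) \<longlonglongrightarrow> F z" if y: "y \<longlonglongrightarrow> z"
  proof (rule Lim_transform2)
    show "(\<lambda>n. F (y n)) \<longlonglongrightarrow> F z"
      using c y by (simp add: continuous_on_eq_continuous_at isCont_tendsto_compose)
    show "(\<lambda>n. F (y n) - f n (y n)) \<longlonglongrightarrow> 0"
      by (rule Lim_null_comparison[OF _ half_power_tendsto_0]) (use assms(2) in auto)
  qed
qed

lemma partial_eq:
  assumes "\<And>i. i < n \<Longrightarrow> x i = y i"
  shows "partial_conj q n x = partial_conj q n y" "partial_inv q n x = partial_inv q n y"
  using assms by (induction n) auto

lemma dist_circle_eq: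
  assumes "\<bar>u - v\<bar> \<le> 1 / 2"
  shows "dist (circle_of u) (circle_of v) = \<bar>u - v\<bar>"
proof (rule antisym[OF dist_circle_le])
  have "\<bar>u - v\<bar> \<le> \<bar>u - v - of_int j\<bar>" for j :: int
  proof (cases "j = 0")
    case False
    then have "1 \<le> \<bar>of_int j :: real\<bar>" by simp
    then show ?thesis using assms by linarith
  qed simp
  then show "\<bar>u - v\<bar> \<le> dist (circle_of u) (circle_of v)" by (simp add: dist_circle.abs_eq)
qed

section \<open>The limit diffeomorphisms\<close>

locale anosov_katok =
  fixes a :: real and q :: "nat \<Rightarrow> nat"
  assumes irrational: "a \<notin> \<rat>" and good: "\<And>n. good_scale a q n (q n)"
begin

abbreviation "h \<equiv> partial_conj q"
abbreviation "h' \<equiv> partial_inv q"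

text \<open>The 40 matches the range of \<open>d\<close> in \<open>moebius_expands\<close>; the
  \<open>n\<close> makes the scales exceed any given constant.\<close>

lemma q_ge: "n + 40 \<le> q n"
  using good[of n] by (simp add: good_scale_def)

lemma q_pos: "0 < q n"
  using q_ge[of n] by simp

lemma pair: "smooth_lift_pair (h n x) (h' n x)"
  by (rule partial_pair) (rule q_pos)

lemma smooth: "smooth_lift (h n x)" "smooth_lift (h' n x)"
  and inverse: "h n x (h' n x y) = y" "h' n x (h n x y) = y"
  using pair[of n x] by (auto simp: smooth_lift_pair_def)

lemma lipschitz:
  obtains L where "1 \<le> L" "2 * L * 2 ^ n \<le> real (q n)"
    "\<And>x y z. \<bar>h n x y - h n x z\<bar> \<le> L * \<bar>y - z\<bar>" "\<And>x y z. \<bar>h' n x y - h' n x z\<bar> \<le> L * \<bar>y - z\<bar>"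
proof -
  from good[of n] have "\<exists>L\<ge>1. 2 * L * 2 ^ n \<le> real (q n) \<and> (\<forall>x y z.
      \<bar>h n x y - h n x z\<bar> \<le> L * \<bar>y - z\<bar> \<and> \<bar>h' n x y - h' n x z\<bar> \<le> L * \<bar>y - z\<bar>)"
    unfolding good_scale_def by (elim conjE)
  then show thesis by (elim exE conjE) (rule that; assumption?; simp)
qed

lemma stage_near: "\<bar>stage_map n (q n) y - y\<bar> \<le> 1 / (2 * real (q n))" "\<bar>stage_inv n (q n) y - y\<bar> \<le> 1 / (2 * real (q n))"
  unfolding stage_map_def stage_inv_def by (intro moebius_cover_near q_pos)+

text \<open>A stage moves points by at most 1 / (2 q n), and its scale was chosen after the
  Lipschitz constant \<open>L\<close> of the earlier stages, through which this displacement passes.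
  In \<open>h'\<close> the new stage acts last, so its displacement appears directly.\<close>

lemma h_step: "\<bar>h (Suc n) x y - h n x y\<bar> \<le> (1/2) ^ n"
  and h'_step: "\<bar>h' (Suc n) x y - h' n x y\<bar> \<le> (1/2) ^ n"
proof -
  obtain L where L: "1 \<le> L" "2 * L * 2 ^ n \<le> real (q n)" "\<And>x y z. \<bar>h n x y - h n x z\<bar> \<le> L * \<bar>y - z\<bar>"
    using lipschitz[of n] by metis
  have q: "0 < real (q n)" using q_pos by simp
  have "L * (1 / (2 * real (q n))) \<le> (1/2) ^ n"
    using L(2) q L(1) by (simp add: field_simps)
  moreover have "1 / (2 * real (q n)) \<le> L * (1 / (2 * real (q n)))"
    using L(1) q by (simp add: divide_right_mono)
  ultimately have b: "L * (1 / (2 * real (q n))) \<le> (1/2) ^ n" "1 / (2 * real (q n)) \<le> (1/2) ^ n" by linarith+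
  have "\<bar>h n x (stage_map n (q n) y) - h n x y\<bar> \<le> L * (1 / (2 * real (q n)))"
    using L(3)[of x "stage_map n (q n) y" y] stage_near(1)[of n y] L(1)
    by (meson mult_left_mono order_trans zero_le_one)
  then show "\<bar>h (Suc n) x y - h n x y\<bar> \<le> (1/2) ^ n" using b by auto
  show "\<bar>h' (Suc n) x y - h' n x y\<bar> \<le> (1/2) ^ n" using stage_near(2)[of n "h' n x y"] b by auto
qed

definition H :: "(nat \<Rightarrow> bool) \<Rightarrow> real \<Rightarrow> real" where "H x y = lim (\<lambda>n. h n x y)"
definition G :: "(nat \<Rightarrow> bool) \<Rightarrow> real \<Rightarrow> real" where "G x y = lim (\<lambda>n. h' n x y)"
definition F :: "real \<Rightarrow> (nat \<Rightarrow> bool) \<Rightarrow> real \<Rightarrow> real" where "F s x y = H x (G x y + s)"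
definition Fn :: "real \<Rightarrow> nat \<Rightarrow> (nat \<Rightarrow> bool) \<Rightarrow> real \<Rightarrow> real" where "Fn s n x y = h n x (h' n x y + s)"

lemma H_near: "\<bar>H x y - h n x y\<bar> \<le> 2 * (1/2) ^ n" and G_near: "\<bar>G x y - h' n x y\<bar> \<le> 2 * (1/2) ^ n"
  unfolding H_def G_def 
  by (rule geometric_limit(2)[of "\<lambda>n. h n x y", OF h_step], rule geometric_limit(2)[of "\<lambda>n. h' n x y", OF h'_step])

lemma H_continuous: "continuous_on UNIV (H x)" and H_tendsto: "y \<longlonglongrightarrow> z \<Longrightarrow> (\<lambda>n. h n x (y n)) \<longlonglongrightarrow> H x z"
proof -
  have c: "continuous_on UNIV (h n x)" for n by (intro smooth_lift_continuous smooth)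
  show "continuous_on UNIV (H x)" by (rule geometric_limit_continuous(1)[of "\<lambda>n. h n x", OF c H_near])
  show "(\<lambda>n. h n x (y n)) \<longlonglongrightarrow> H x z" if "y \<longlonglongrightarrow> z"
    by (rule geometric_limit_continuous(2)[of "\<lambda>n. h n x", OF c H_near that])
qed

lemma G_continuous: "continuous_on UNIV (G x)" and G_tendsto: "y \<longlonglongrightarrow> z \<Longrightarrow> (\<lambda>n. h' n x (y n)) \<longlonglongrightarrow> G x z"
proof -
  have c: "continuous_on UNIV (h' n x)" for n by (intro smooth_lift_continuous smooth)
  show "continuous_on UNIV (G x)" by (rule geometric_limit_continuous(1)[of "\<lambda>n. h' n x", OF c G_near])
  show "(\<lambda>n. h' n x (y n)) \<longlonglongrightarrow> G x z" if "y \<longlonglongrightarrow> z"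
    by (rule geometric_limit_continuous(2)[of "\<lambda>n. h' n x", OF c G_near that])
qed

lemma HG: "H x (G x y) = y"
proof -
  have "(\<lambda>n. h n x (h' n x y)) \<longlonglongrightarrow> H x (G x y)" by (intro H_tendsto G_tendsto tendsto_const)
  then show ?thesis unfolding inverse by (simp add: LIMSEQ_const_iff)
qed

lemma GH: "G x (H x y) = y"
proof -
  have "(\<lambda>n. h' n x (h n x y)) \<longlonglongrightarrow> G x (H x y)" by (intro G_tendsto H_tendsto tendsto_const)
  then show ?thesis unfolding inverse by (simp add: LIMSEQ_const_iff)
qed

lemma mono_h: "mono (h n x)" "mono (h' n x)"
  using smooth[of n x] unfolding smooth_lift_def by (blast intro: strict_mono_mono)+

lemma H_strict_mono: "strict_mono (H x)" and G_strict_mono: "strict_mono (G x)"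
proof -
  have "mono (H x)"
  proof (rule monoI)
    fix y z :: real assume "y \<le> z"
    then have "h n x y \<le> h n x z" for n by (rule monoD[OF mono_h(1)])
    then show "H x y \<le> H x z"
      by (intro LIMSEQ_le[OF H_tendsto[OF tendsto_const[of y]] H_tendsto[OF tendsto_const[of z]]]) auto
  qed
  moreover have "inj (H x)" by (rule inj_on_inverseI[of _ "G x"]) (rule GH)
  ultimately show "strict_mono (H x)" by (rule mono_imp_strict_mono)
  have "mono (G x)"
  proof (rule monoI)
    fix y z :: real assume "y \<le> z"
    then have "h' n x y \<le> h' n x z" for n by (rule monoD[OF mono_h(2)])
    then show "G x y \<le> G x z"
      by (intro LIMSEQ_le[OF G_tendsto[OF tendsto_const[of y]] G_tendsto[OF tendsto_const[of z]]]) auto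
  qed
  moreover have "inj (G x)" by (rule inj_on_inverseI[of _ "H x"]) (rule HG)
  ultimately show "strict_mono (G x)" by (rule mono_imp_strict_mono)
qed

lemma h_shift: "h n x (y + 1) = h n x y + 1" and h'_shift: "h' n x (y + 1) = h' n x y + 1"
  by (rule smooth_lift_step, rule smooth)+

lemma H_shift: "H x (y + 1) = H x y + 1" and G_shift: "G x (y + 1) = G x y + 1"
proof -
  have "(\<lambda>n. h n x y + 1) \<longlonglongrightarrow> H x y + 1" by (rule tendsto_add[OF H_tendsto[OF tendsto_const] tendsto_const])
  then have lim: "(\<lambda>n. h n x (y + 1)) \<longlonglongrightarrow> H x y + 1" unfolding h_shift .
  show "H x (y + 1) = H x y + 1" by (rule LIMSEQ_unique[OF H_tendsto[OF tendsto_const] lim])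
  have "(\<lambda>n. h' n x y + 1) \<longlonglongrightarrow> G x y + 1" by (rule tendsto_add[OF G_tendsto[OF tendsto_const] tendsto_const])
  then have lim: "(\<lambda>n. h' n x (y + 1)) \<longlonglongrightarrow> G x y + 1" unfolding h'_shift .
  show "G x (y + 1) = G x y + 1" by (rule LIMSEQ_unique[OF G_tendsto[OF tendsto_const] lim])
qed

lemma Fn_pair: "smooth_lift_pair (Fn s n x) (Fn (- s) n x)"
proof -
  have "smooth_lift_pair (h n x \<circ> (\<lambda>x. x + s) \<circ> h' n x) (h n x \<circ> ((\<lambda>x. x - s) \<circ> h' n x))"
    by (intro smooth_lift_pair_comp smooth_lift_pair_rotation pair smooth_lift_pair_sym[OF pair])
  then show ?thesis by (simp add: Fn_def[abs_def] comp_def)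
qed

lemma Fn_step:
  assumes "s \<in> {a, - a}"
  shows "deriv_bound n (\<lambda>y. Fn s (Suc n) x y - Fn s n x y) ((1/2) ^ n)"
proof (cases "x n")
  case True
  have "deriv_bound n (\<lambda>y. h n x (stage_map n (q n) (stage_inv n (q n) (h' n x y) + s)) - h n x (h' n x y + s)) ((1/2) ^ n)"
    using good[of n] assms unfolding good_scale_def by blast
  then show ?thesis using True by (simp add: Fn_def)
qed (simp add: Fn_def deriv_bound_const)

lemma F_near:
  assumes "s \<in> {a, - a}" "k \<le> n"
  shows "deriv_bound k (\<lambda>y. F s x y - Fn s n x y) (2 * (1/2) ^ n)"
proof -
  have tel: "deriv_bound k (\<lambda>y. Fn s m x y - Fn s n x y) (2 * (1/2) ^ n)" if "k \<le> n" "n \<le> m" for n m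
    by (rule deriv_bound_mono[OF deriv_bound_geometric_telescope[of k k "\<lambda>n. Fn s n x"]])
       (use that deriv_bound_le[OF Fn_step[OF assms(1)]] in auto)
  \<comment> \<open>Lifts are unbounded while \<open>deriv_bound_limit\<close> takes bounded
    functions, hence the subtraction of \<open>Fn s k x\<close>. The sequence starts at
    \<open>k\<close> because \<open>Fn_step\<close> controls C^k only from there on.\<close>
  have "deriv_bound k (\<lambda>y. (F s x y - Fn s k x y) - (Fn s (k + (n - k)) x y - Fn s k x y)) (2 * (1/2) ^ (k + (n - k)))"
  proof (rule deriv_bound_limit[of k "\<lambda>j y. Fn s (k + j) x y - Fn s k x y" "\<lambda>j. 2 * (1/2) ^ (k + j)"])
    show "deriv_bound k (\<lambda>y. Fn s (k + m) x y - Fn s k x y - (Fn s (k + n) x y - Fn s k x y)) (2 * (1/2) ^ (k + n))" if "n \<le> m" for n m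
      using tel[of "k + n" "k + m"] that by simp
    show "\<exists>C. deriv_bound k (\<lambda>y. Fn s (k + n) x y - Fn s k x y) C" for n
      using tel[of k "k + n"] by auto
    show "(\<lambda>j. 2 * (1/2 :: real) ^ (k + j)) \<longlonglongrightarrow> 0"
      using LIMSEQ_ignore_initial_segment[OF half_power_tendsto_0, of k] by (simp add: add.commute)
    show "(\<lambda>j. Fn s (k + j) x y - Fn s k x y) \<longlonglongrightarrow> F s x y - Fn s k x y" for y
    proof -
      have "(\<lambda>n. Fn s n x y) \<longlonglongrightarrow> F s x y"
        unfolding Fn_def F_def by (intro H_tendsto tendsto_add G_tendsto tendsto_const)
      from LIMSEQ_ignore_initial_segment[OF this, of k]
      show ?thesis by (intro tendsto_intros) (simp add: add.commute)
    qed
  qed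
  then show ?thesis using assms(2) by simp
qed

lemma F_shift: "F s x (y + 1) = F s x y + 1"
  using H_shift[of x "G x y + s"] unfolding F_def G_shift by (simp only: ac_simps)

lemma F_smooth:
  assumes "s \<in> {a, - a}" shows "smooth_lift (F s x)"
proof (rule smooth_lift_limit[of "\<lambda>n. Fn s n x"])
  show "smooth_lift (Fn s n x)" for n using Fn_pair by (simp add: smooth_lift_pair_def)
  show "\<exists>n C. deriv_bound k (\<lambda>y. F s x y - Fn s n x y) C" for k using F_near[OF assms order_refl] by blast
  show "strict_mono (F s x)"
    using H_strict_mono[of x] G_strict_mono[of x] by (simp add: strict_mono_def F_def)
qed (rule F_shift)

lemma F_pair: "smooth_lift_pair (F a x) (F (- a) x)"
  using F_smooth by (simp add: smooth_lift_pair_def F_def HG GH)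

definition Phi :: "(nat \<Rightarrow> bool) \<Rightarrow> circle \<Rightarrow> circle" where "Phi x = circ (F a x)"
definition Phin :: "nat \<Rightarrow> (nat \<Rightarrow> bool) \<Rightarrow> circle \<Rightarrow> circle" where "Phin n x = circ (Fn a n x)"

lemma Phi_H_inf: "Phi x \<in> H_inf" and Phin_H_inf: "Phin n x \<in> H_inf"
  unfolding Phi_def Phin_def by (rule circ_H_inf[OF F_pair], rule circ_H_inf[OF Fn_pair])

lemma Phi_rotation_number: "rotation_number (Phi x) = circle_of a"
  unfolding Phi_def
  by (rule rotation_number_circ[OF F_pair strict_mono_mono[OF H_strict_mono[of x]] H_shift GH HG F_def])

lemma d_inf_Phi: "d_inf (Phin n x) (Phi x) \<le> 2 * (1/2) ^ n + 2 * (3/4) ^ n"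
proof (rule d_inf_le[OF Phin_H_inf Phi_H_inf])
  have "d_k n (Phi x) (Phin n x) \<le> 2 * (1/2) ^ n"
    unfolding Phi_def Phin_def by (rule d_k_circ_le[OF F_pair Fn_pair]) (auto intro: F_near)
  then show "d_k n (Phin n x) (Phi x) \<le> 2 * (1/2) ^ n" by (simp add: d_k_commute)
qed

lemma Phin_eq: "(\<And>i. i < n \<Longrightarrow> x i = y i) \<Longrightarrow> Phin n x = Phin n y"
  using partial_eq[of n x y q] by (simp add: Phin_def Fn_def[abs_def])

text \<open>Stages from \<open>N\<close> on agree and act first, so \<open>H x\<close> is
  \<open>H y\<close> followed by the smooth map \<open>k\<close> that exchanges the first
  \<open>N\<close> stages. The limits themselves need not be smooth for this.\<close>

lemma tail_equivalent_conjugate: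
  assumes "\<And>i. N \<le> i \<Longrightarrow> x i = y i"
  shows "\<exists>k\<in>H_inf. Phi x = k \<circ> Phi y \<circ> inv k"
proof -
  define k where "k = h N x \<circ> h' N y"
  define k' where "k' = h N y \<circ> h' N x"
  have kk: "smooth_lift_pair k k'"
    unfolding k_def k'_def by (intro smooth_lift_pair_comp pair smooth_lift_pair_sym[OF pair])
  have ck: "continuous_on UNIV k" using kk by (simp add: smooth_lift_pair_def smooth_lift_continuous)
  have hk: "h m x z = k (h m y z)" if "N \<le> m" for m z
    using that
  proof (induction m arbitrary: z rule: dec_induct)
    case base
    show ?case by (simp add: k_def inverse)
  next
    case (step m)
    then show ?case using assms[of m] by simp
  qed
  have HK: "H x z = k (H y z)" for z
  proof (rule LIMSEQ_unique[OF H_tendsto[OF tendsto_const]])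
    have "(\<lambda>m. k (h m y z)) \<longlonglongrightarrow> k (H y z)"
      using ck by (intro isCont_tendsto_compose[OF _ H_tendsto[OF tendsto_const]])
        (simp add: continuous_on_eq_continuous_at)
    then show "(\<lambda>m. h m x z) \<longlonglongrightarrow> k (H y z)"
    proof (rule Lim_transform_eventually)
      show "\<forall>\<^sub>F m in sequentially. k (h m y z) = h m x z"
        using eventually_ge_at_top[of N] by eventually_elim (simp only: hk)
    qed
  qed
  have GK: "G x z = G y (k' z)" for z
  proof -
    have "H x (G y (k' z)) = z" using kk by (simp add: HK HG smooth_lift_pair_def)
    then show ?thesis by (metis GH)
  qed
  have "F a x = k \<circ> F a y \<circ> k'" by (auto simp: F_def HK GK)
  moreover have ks: "k (z + 1) = k z + 1" for z using kk by (simp add: smooth_lift_pair_def smooth_lift_def)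
  moreover have "(k \<circ> F a y) (z + 1) = (k \<circ> F a y) z + 1" for z by (simp add: F_shift ks)
  ultimately have "Phi x = circ k \<circ> Phi y \<circ> circ k'"
    unfolding Phi_def using circ_comp[of "k \<circ> F a y" k'] circ_comp[of k "F a y"] by simp
  then show ?thesis using circ_H_inf[OF kk] inv_circ[OF kk] by metis
qed

section \<open>Absence of Hoelder conjugacies\<close>

definition delta :: "nat \<Rightarrow> real" where "delta n = 1 / real (q n) ^ (n + 2)"

lemma delta_pos: "0 < delta n"
  using q_pos[of n] by (simp add: delta_def)

text \<open>The composition is the product of the stages from n + 1 to m - 1. Stage i moves points
  by at most 1 / (2 q i), which \<open>good_scale\<close> bounds by \<open>delta n / 8\<close> times
  (1/2)^(i + 1); these displacements add up to less than the stated bound.\<close>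

lemma tail_near:
  assumes "Suc n \<le> m"
  shows "\<bar>h' (Suc n) x (h m x y) - y\<bar> \<le> delta n / 8 * (1 - (1/2) ^ m)"
  using assms
proof (induction m arbitrary: y rule: dec_induct)
  case base
  show ?case using delta_pos[of n] power_le_one[of "1/2 :: real" "Suc n"] by (simp only: inverse) simp
next
  case (step m)
  have n: "n < m" using step.hyps by simp
  define B where "B = (if x m then stage_map m (q m) else id)"
  have q: "2 ^ m * 8 * q n ^ (n + 2) \<le> q m"
    using good[of m] n by (simp add: good_scale_def)
  then have "real (2 ^ m * 8 * q n ^ (n + 2)) \<le> real (q m)" by (rule of_nat_mono)
  then have "2 ^ m * 8 * real (q n) ^ (n + 2) \<le> real (q m)" by simp
  then have "1 / (2 * real (q m)) \<le> 1 / (2 * (2 ^ m * 8 * real (q n) ^ (n + 2)))"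
    using q_pos[of m] q_pos[of n] by (intro divide_left_mono mult_left_mono mult_pos_pos) auto
  also have "\<dots> = delta n / 8 * (1/2) ^ Suc m" by (simp add: delta_def power_one_over)
  finally have "\<bar>B y - y\<bar> \<le> delta n / 8 * (1/2) ^ Suc m"
    using stage_near(1)[of m y] delta_pos[of n] by (auto simp: B_def)
  moreover have "\<bar>h' (Suc n) x (h m x (B y)) - B y\<bar> \<le> delta n / 8 * (1 - (1/2) ^ m)" by (rule step.IH)
  moreover have hB: "h (Suc m) x y = h m x (B y)" by (simp add: B_def)
  ultimately have "\<bar>h' (Suc n) x (h (Suc m) x y) - y\<bar> \<le> delta n / 8 * (1 - (1/2) ^ m) + delta n / 8 * (1/2) ^ Suc m"
    unfolding hB by linarith
  also have "\<dots> = delta n / 8 * (1 - (1/2) ^ Suc m)" by (simp add: field_simps)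
  finally show ?case .
qed

lemma H_tail_near: "\<bar>h' (Suc n) x (H x y) - y\<bar> \<le> delta n / 8"
proof (rule tendsto_upperbound)
  have c: "isCont (h' (Suc n) x) z" for z
    using smooth_lift_continuous[OF smooth(2), of UNIV "Suc n" x]
    by (simp add: continuous_on_eq_continuous_at del: partial_inv.simps)
  show "(\<lambda>m. \<bar>h' (Suc n) x (h m x y) - y\<bar>) \<longlonglongrightarrow> \<bar>h' (Suc n) x (H x y) - y\<bar>"
    by (intro tendsto_intros isCont_tendsto_compose[OF c] H_tendsto)
  show "\<forall>\<^sub>F m in sequentially. \<bar>h' (Suc n) x (h m x y) - y\<bar> \<le> delta n / 8"
    using eventually_ge_at_top[of "Suc n"]
  proof eventually_elim
    case (elim m)
    have "delta n / 8 * (1 - (1/2) ^ m) \<le> delta n / 8 * 1"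
      using delta_pos[of n] by (intro mult_left_mono) auto
    then show ?case using tail_near[OF elim, of x y] by simp
  qed
qed simp

text \<open>Up to displacements \<open>delta n / 8\<close> by later stages, \<open>H x\<close> is
  the stage map followed by \<open>h n x\<close>, while \<open>H y\<close> is just
  \<open>h n y\<close>, since stage \<open>n\<close> is absent from \<open>y\<close>. Pulling back 0
  and \<open>delta n\<close> places the interval where the stage stretches, whatever
  \<open>t\<close> is. The Lipschitz constant of earlier stages is at most half of
  \<open>q n\<close>, so it costs one factor of order \<open>q n\<close> on either side.\<close>

lemma conjugacy_stretch:
  assumes n: "x n" "\<not> y n"
  obtains z w where "\<bar>z - w\<bar> \<le> 1 / real (q n) ^ (n + 1)"
    "1 / (2 * real (q n) ^ 2) \<le> dist (circle_of (H x (G y z + t))) (circle_of (H x (G y w + t)))"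
proof -
  obtain L where L: "1 \<le> L" "2 * L * 2 ^ n \<le> real (q n)" "\<And>x y z. \<bar>h n x y - h n x z\<bar> \<le> L * \<bar>y - z\<bar>" 
    "\<And>x y z. \<bar>h' n x y - h' n x z\<bar> \<le> L * \<bar>y - z\<bar>" using lipschitz[of n] by metis
  define Q where "Q = real (q n)"
  have Q: "40 \<le> Q" "0 < Q" using q_ge[of n] by (auto simp: Q_def)
  have LQ: "2 * L \<le> Q"
  proof -
    have "2 * L * 1 \<le> 2 * L * 2 ^ n" using L(1) by (intro mult_left_mono) auto
    then show ?thesis using L(2) by (simp add: Q_def)
  qed
  define d where "d = delta n"
  have d: "0 < d" using delta_pos by (simp add: d_def)
  define A where "A = stage_map n (q n)"
  have A0: "A 0 = 0" unfolding A_def stage_map_def by (rule moebius_cover_0)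
  have dQ: "d = (1 / Q ^ Suc n) / Q" by (simp add: d_def delta_def Q_def)
  have Qn: "40 \<le> Q ^ Suc n" using self_le_power[of Q "Suc n"] Q(1) by (simp del: power_Suc)
  have Ad: "1 / (4 * Q) \<le> A d"
    unfolding A_def stage_map_def dQ unfolding Q_def
    by (rule moebius_cover_expands) (use q_pos[of n] Qn in \<open>auto simp: Q_def field_simps simp del: power_Suc\<close>)
  have Ad2: "A d \<le> 1 / Q"
  proof -
    have "d \<le> (1 / 40) / Q" unfolding dQ using Q Qn by (intro divide_right_mono divide_left_mono) auto
    moreover have "A d \<le> d + 1 / (2 * Q)" using stage_near(1)[of n d] by (auto simp: A_def Q_def)
    moreover have "(1 / 40) / Q + 1 / (2 * Q) \<le> 1 / Q" using Q(2) by (simp add: field_simps)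
    ultimately show ?thesis by linarith
  qed
  have hA: "h (Suc n) x v = h n x (A v)" for v
    unfolding partial_conj.simps comp_apply if_P[OF n(1)] A_def ..
  \<comment> \<open>\<open>u v\<close> is the point that the stages after \<open>n\<close> carry to
    \<open>v\<close>, so \<open>H x\<close> sends it to \<open>h n x (A v)\<close> without
    error.\<close>
  define u where "u v = G x (h (Suc n) x v)" for v
  have Hu: "H x (u v) = h n x (A v)" for v by (simp only: u_def HG hA)
  have un: "\<bar>u v - v\<bar> \<le> d / 8" for v
  proof -
    have "H x (u v) = h (Suc n) x v" by (simp only: u_def HG)
    then show ?thesis using H_tail_near[of n x "u v"] by (simp only: inverse d_def abs_minus_commute)
  qed
  define z where "z v = H y (u v - t)" for v
  have z: "H x (G y (z v) + t) = h n x (A v)" for v by (simp only: z_def GH diff_add_cancel Hu)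
  define r where "r w = h' (Suc n) y (H y w)" for w
  have Hr: "H y w = h n y (r w)" for w
  proof -
    have "h (Suc n) y = h n y" using n(2) by simp
    then show ?thesis unfolding r_def using inverse(1)[of "Suc n" y "H y w"] by simp
  qed
  have rn: "\<bar>r w - w\<bar> \<le> d / 8" for w using H_tail_near[of n y w] by (simp only: r_def d_def)
  have "\<bar>z 0 - z d\<bar> \<le> L * \<bar>r (u 0 - t) - r (u d - t)\<bar>" unfolding z_def Hr by (rule L(3))
  also have "\<dots> \<le> L * (2 * d)"
  proof (rule mult_left_mono)
    \<comment> \<open>The error \<open>d / 8\<close> occurs four times, giving at most 3/2
      d.\<close>
    show "\<bar>r (u 0 - t) - r (u d - t)\<bar> \<le> 2 * d"
      using rn[of "u 0 - t"] rn[of "u d - t"] un[of 0] un[of d] d by linarith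
  qed (use L(1) in simp)
  also have "\<dots> = (2 * L) * d" by simp
  also have "\<dots> \<le> Q * d" using LQ d by (intro mult_right_mono) auto
  also have "\<dots> = 1 / Q ^ (n + 1)" using Q by (simp add: dQ)
  finally have 1: "\<bar>z 0 - z d\<bar> \<le> 1 / Q ^ (n + 1)" .
  let ?D = "\<bar>h n x (A 0) - h n x (A d)\<bar>"
  have "?D \<le> L * \<bar>A 0 - A d\<bar>" by (rule L(3))
  also have "\<dots> \<le> L * (1 / Q)"
    using Ad Ad2 A0 L(1) Q(2) by (intro mult_left_mono) (auto intro: order_trans[rotated])
  also have "\<dots> \<le> 1 / 2" using LQ Q by (simp add: field_simps)
  finally have 2: "dist (circle_of (h n x (A 0))) (circle_of (h n x (A d))) = ?D" by (rule dist_circle_eq)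
  have "1 / (4 * Q) \<le> \<bar>A 0 - A d\<bar>" using Ad A0 by simp
  also have "\<dots> \<le> L * ?D" using L(4)[of x "h n x (A 0)" "h n x (A d)"] by (simp add: inverse)
  finally have 3: "1 / (4 * Q) \<le> L * ?D" .
  have "1 / (2 * Q ^ 2) = (1 / (4 * Q)) / (Q / 2)" by (simp add: power2_eq_square)
  also have "\<dots> \<le> (1 / (4 * Q)) / L" using LQ L(1) Q by (intro divide_left_mono) auto
  also have "\<dots> \<le> L * ?D / L" using 3 L(1) by (intro divide_right_mono) auto
  also have "\<dots> = ?D" using L(1) by simp
  finally have "1 / (2 * Q ^ 2) \<le> ?D" .
  then show thesis
    using that[of "z 0" "z d"] 1 2 by (simp add: z Q_def)
qed

lemma not_conjugate:
  assumes D: "D \<in> regularity_classes" and inf: "infinite {n. x n \<and> \<not> y n}"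
  shows "\<not> conjugate_in D (Phi x) (Phi y)"
proof
  assume "conjugate_in D (Phi x) (Phi y)"
  then obtain g where g: "g \<in> D" "Phi x = g \<circ> Phi y \<circ> inv g" by (auto simp: conjugate_in_def)
  have gh: "g \<in> H_homeo" and "\<exists>b>0. hoelder b g" using regularity_class_hoelder[OF D g(1)] by auto
  then obtain b C where b: "0 < b" and C0: "\<And>u v. dist (g u) (g v) \<le> C * dist u v powr b"
    by (auto simp: hoelder_def)
  obtain W where W: "is_lift W g" "strict_mono W" "\<And>z. W (z + 1) = W z + 1" using H_homeo_lift[OF gh] by blast
  obtain t where t: "\<And>z. W z = H x (G y z + t)"
    using conjugate_rotations[OF W, of "H x" "G x" "H y" "G y" "F a x" a "F a y"]
      strict_mono_mono[OF H_strict_mono] H_shift GH HG H_continuous G_continuous strict_mono_mono[OF G_strict_mono]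
      F_def F_shift bij_H_homeo[OF gh] g(2)[unfolded Phi_def] irrational by metis
  obtain n where n: "x n" "\<not> y n" and nb: "3 / b \<le> real n" "2 * \<bar>C\<bar> < real n"
  proof -
    \<comment> \<open>For n b \<ge> 3 the Hoelder bound drops to |C| Q^-3 while the images stay Q^-2
      / 2 apart. This forces Q \<le> 2 |C|, contrary to 2 |C| < n \<le> Q.\<close>
    define N where "N = nat \<lceil>3 / b\<rceil> + nat \<lceil>2 * \<bar>C\<bar>\<rceil> + 1"
    obtain n where "N \<le> n" "x n" "\<not> y n" using inf unfolding infinite_nat_iff_unbounded_le by auto
    moreover have "3 / b \<le> real N" "2 * \<bar>C\<bar> < real N" unfolding N_def by linarith+
    ultimately show thesis using that[of n] by auto
  qed
  define Q where "Q = real (q n)"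
  have Q: "40 \<le> Q" "0 < Q" "2 * \<bar>C\<bar> < Q" using q_ge[of n] nb(2) by (auto simp: Q_def)
  obtain z w where zw: "\<bar>z - w\<bar> \<le> 1 / Q ^ (n + 1)"
      "1 / (2 * Q ^ 2) \<le> dist (circle_of (H x (G y z + t))) (circle_of (H x (G y w + t)))"
    using conjugacy_stretch[where x = x and y = y and n = n and t = t, OF n] unfolding Q_def by blast
  have "1 / (2 * Q ^ 2) \<le> dist (g (circle_of z)) (g (circle_of w))"
    using zw(2) W(1) by (simp add: is_lift_def flip: t)
  also have "\<dots> \<le> C * dist (circle_of z) (circle_of w) powr b" by (rule C0)
  also have "\<dots> \<le> \<bar>C\<bar> * (1 / Q ^ (n + 1)) powr b"
    using dist_circle_le[of z w] zw(1) b by (intro mult_mono powr_mono2) auto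
  also have "(1 / Q ^ (n + 1)) powr b = Q powr (- (real (n + 1) * b))"
  proof -
    have "1 / Q ^ (n + 1) = Q powr (- real (n + 1))"
      by (simp only: powr_minus_divide powr_realpow[OF Q(2)])
    then show ?thesis by (simp only: powr_powr mult_minus_left)
  qed
  also have "\<bar>C\<bar> * Q powr (- (real (n + 1) * b)) \<le> \<bar>C\<bar> * Q powr (- 3)"
  proof (intro mult_left_mono powr_mono)
    have "3 \<le> real n * b" using nb(1) b by (simp add: field_simps)
    also have "\<dots> \<le> real (n + 1) * b" using b by (intro mult_right_mono) auto
    finally show "- (real (n + 1) * b) \<le> - 3" by simp
  qed (use Q in auto)
  also have "Q powr (- 3) = 1 / Q ^ 3" by (simp only: powr_minus_divide powr_numeral[OF less_imp_le[OF Q(2)]])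
  finally have "1 / (2 * Q ^ 2) \<le> \<bar>C\<bar> * (1 / Q ^ 3)" .
  then have "Q \<le> 2 * \<bar>C\<bar>" using Q(2) by (simp add: field_simps power2_eq_square power3_eq_cube)
  then show False using Q(3) by simp
qed

end

section \<open>Tail-invariant functions of coin tosses\<close>

definition coin_space :: "(nat \<Rightarrow> bool) measure" where
  "coin_space = (\<Pi>\<^sub>M i\<in>UNIV. measure_pmf (bernoulli_pmf (1/2)))"

text \<open>On Boolean sequences this is the relation E_0 of descriptive set theory.\<close>

definition tail_equivalent :: "(nat \<Rightarrow> 'a) \<Rightarrow> (nat \<Rightarrow> 'a) \<Rightarrow> bool" where
  "tail_equivalent x y \<longleftrightarrow> (\<exists>N. \<forall>i\<ge>N. x i = y i)"

interpretation coins: product_prob_space "\<lambda>_. measure_pmf (bernoulli_pmf (1/2))" "UNIV :: nat set"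
  by (rule product_prob_spaceI) (rule prob_space_measure_pmf)

interpretation coin: prob_space coin_space
  unfolding coin_space_def by (rule coins.prob_space_axioms)

lemma space_coin_space: "space coin_space = UNIV"
  by (simp add: coin_space_def space_PiM)

lemma coin_measurable: "(\<lambda>x. x i) \<in> coin_space \<rightarrow>\<^sub>M measure_pmf (bernoulli_pmf (1/2))"
  unfolding coin_space_def by (rule measurable_component_singleton) simp

lemma coin_component_sets: "{x. x i = b} \<in> sets coin_space"
  using measurable_sets[OF coin_measurable, of "{b}" i] by (simp add: space_coin_space vimage_def)

lemma coin_indep: "coin.indep_sets (\<lambda>i. {(\<lambda>x. x i) -` S | S. True}) UNIV"
proof -
  have "coin.indep_vars (\<lambda>_. measure_pmf (bernoulli_pmf (1/2))) (\<lambda>i x. x i) (UNIV :: nat set)"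
  proof (subst coin.indep_vars_iff_distr_eq_PiM)
    have "distr coin_space (\<Pi>\<^sub>M i\<in>UNIV. measure_pmf (bernoulli_pmf (1/2))) (\<lambda>x. \<lambda>i\<in>UNIV. x i) = coin_space"
      by (simp add: coin_space_def restrict_def)
    also have "\<dots> = (\<Pi>\<^sub>M i\<in>UNIV. distr coin_space (measure_pmf (bernoulli_pmf (1/2))) (\<lambda>x. x i))"
      using coins.PiM_component unfolding coin_space_def by simp
    finally show "distr coin_space (\<Pi>\<^sub>M i\<in>UNIV. measure_pmf (bernoulli_pmf (1/2))) (\<lambda>x. \<lambda>i\<in>UNIV. x i)
        = (\<Pi>\<^sub>M i\<in>UNIV. distr coin_space (measure_pmf (bernoulli_pmf (1/2))) (\<lambda>x. x i))" .
  qed (use coin_measurable in auto)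
  then show ?thesis
    by (simp add: coin.indep_vars_def2 space_coin_space)
qed

text \<open>Overwriting the first \<open>n\<close> coordinates by \<open>False\<close> is a map
  \<open>T\<close> measurable with respect to the remaining ones, and by tail invariance
  \<open>X\<close> is its own preimage under \<open>T\<close>.\<close>

lemma tail_event:
  assumes X: "X \<in> sets coin_space" and inv: "\<And>x y. tail_equivalent x y \<Longrightarrow> x \<in> X \<Longrightarrow> y \<in> X"
  shows "X \<in> coin.tail_events (\<lambda>i. {(\<lambda>x. x i) -` S | S. True})"
  unfolding coin.tail_events_def
proof
  fix n :: nat
  let ?A = "\<Union>i\<in>{n..}. {(\<lambda>x :: nat \<Rightarrow> bool. x i) -` S | S. True}"
  define N where "N = sigma (UNIV :: (nat \<Rightarrow> bool) set) ?A"
  define T where "T = (\<lambda>(x :: nat \<Rightarrow> bool) i. if i < n then False else x i)"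
  have sN: "space N = UNIV" "sets N = sigma_sets UNIV ?A" by (auto simp: N_def)
  have "T \<in> N \<rightarrow>\<^sub>M coin_space"
    unfolding coin_space_def T_def
  proof (rule measurable_PiM_single')
    fix i :: nat
    show "(\<lambda>x. if i < n then False else x i) \<in> N \<rightarrow>\<^sub>M measure_pmf (bernoulli_pmf (1/2))"
    proof (cases "i < n")
      case False
      have "(\<lambda>x. x i) \<in> N \<rightarrow>\<^sub>M measure_pmf (bernoulli_pmf (1/2))"
      proof (rule measurableI)
        fix S :: "bool set"
        have "(\<lambda>x. x i) -` S \<in> ?A" using False by (intro UN_I[of i]) auto
        then show "(\<lambda>x. x i) -` S \<inter> space N \<in> sets N" unfolding sN by (simp add: sigma_sets.Basic)
      qed simp
      then show ?thesis using False by simp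
    qed simp
  qed (simp add: sN)
  then have "T -` X \<inter> space N \<in> sets N" using X by (rule measurable_sets)
  moreover have "T -` X = X"
  proof -
    have "tail_equivalent (T x) x" "tail_equivalent x (T x)" for x
      by (auto simp: tail_equivalent_def T_def intro!: exI[of _ n])
    then show ?thesis using inv by blast
  qed
  ultimately show "X \<in> sigma_sets (space coin_space) ?A" by (simp add: sN space_coin_space)
qed

lemma tail_invariant_0_1:
  assumes "X \<in> sets coin_space" "\<And>x y. tail_equivalent x y \<Longrightarrow> x \<in> X \<Longrightarrow> y \<in> X"
  shows "coin.prob X = 0 \<or> coin.prob X = 1"
proof (rule coin.kolmogorov_0_1_law[OF _ coin_indep tail_event[OF assms]])
  fix i :: nat
  have "sets (vimage_algebra UNIV (\<lambda>x :: nat \<Rightarrow> bool. x i) (count_space UNIV)) = {(\<lambda>x. x i) -` S | S. True}"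
    by (subst sets_vimage_algebra2) auto
  then show "sigma_algebra (space coin_space) {(\<lambda>x. x i) -` S | S. True}"
    using sets.sigma_algebra_axioms[of "vimage_algebra UNIV (\<lambda>x :: nat \<Rightarrow> bool. x i) (count_space UNIV)"]
    by (simp add: space_coin_space)
qed

text \<open>The class is the countable union of the sets \<open>C N\<close>, and testing
  \<open>m\<close> coordinates from \<open>N\<close> on bounds the probability of each by
  \<open>(1/2) ^ m\<close>, for every \<open>m\<close>.\<close>

lemma tail_class_null:
  "coin.prob {x. tail_equivalent z x} = 0" "{x. tail_equivalent z x} \<in> sets coin_space"
proof -
  define C where "C N = {x. \<forall>i\<ge>N. x i = z i}" for N
  have C: "C N \<in> sets coin_space" for N
  proof -
    have "C N = (\<Inter>i\<in>{N..}. {x. x i = z i})" by (auto simp: C_def)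
    also have "\<dots> \<in> sets coin_space" using coin_component_sets by (intro sets.countable_INT) auto
    finally show ?thesis .
  qed
  have U: "{x. tail_equivalent z x} = (\<Union>N. C N)"
    by (auto simp: tail_equivalent_def C_def eq_commute[of "z _"])
  show "{x. tail_equivalent z x} \<in> sets coin_space" unfolding U using C by auto
  have "coin.prob (C N) = 0" for N
  proof -
    have le: "coin.prob (C N) \<le> (1/2) ^ m" for m
    proof -
      let ?J = "{N..<N + m}"
      have "C N \<subseteq> {x. \<forall>i\<in>?J. x i \<in> {z i}}" by (auto simp: C_def)
      moreover have J: "{x. \<forall>i\<in>?J. x i \<in> {z i}} \<in> sets coin_space"
      proof (cases "m = 0")
        case False
        have "{x. \<forall>i\<in>?J. x i \<in> {z i}} = (\<Inter>i\<in>?J. {x. x i = z i})" by auto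
        also have "\<dots> \<in> sets coin_space" using False coin_component_sets by (intro sets.finite_INT) auto
        finally show ?thesis .
      qed (use sets.top[of coin_space] in \<open>simp add: space_coin_space\<close>)
      ultimately have 1: "coin.prob (C N) \<le> coin.prob {x. \<forall>i\<in>?J. x i \<in> {z i}}"
        by (intro coin.finite_measure_mono)
      have "emeasure coin_space {x\<in>space coin_space. \<forall>i\<in>?J. x i \<in> {z i}} = (\<Prod>i\<in>?J. emeasure (measure_pmf (bernoulli_pmf (1/2))) {z i})"
        unfolding coin_space_def by (rule coins.emeasure_PiM_Collect) auto
      also have "\<dots> = (\<Prod>i\<in>?J. ennreal (1/2))"
      proof (rule prod.cong[OF refl])
        fix i
        have "pmf (bernoulli_pmf (1/2)) (z i) = 1/2" by (cases "z i") auto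
        then show "emeasure (measure_pmf (bernoulli_pmf (1/2))) {z i} = ennreal (1/2)"
          by (simp only: emeasure_pmf_single)
      qed
      also have "\<dots> = ennreal (\<Prod>i\<in>?J. 1/2)" by (rule prod_ennreal) simp
      also have "(\<Prod>i\<in>?J. 1/2 :: real) = (1/2) ^ m" by simp
      finally have "emeasure coin_space {x. \<forall>i\<in>?J. x i \<in> {z i}} = ennreal ((1/2) ^ m)"
        by (simp only: space_coin_space UNIV_I simp_thms)
      then have "coin.prob {x. \<forall>i\<in>?J. x i \<in> {z i}} = (1/2) ^ m"
        unfolding measure_def by (simp only: enn2real_ennreal zero_le_power zero_le_divide_1_iff zero_le_numeral)
      then show ?thesis using 1 by simp
    qed
    have "(\<lambda>m. (1/2 :: real) ^ m) \<longlonglongrightarrow> 0" by (rule LIMSEQ_realpow_zero) auto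
    then have "coin.prob (C N) \<le> 0" by (rule tendsto_lowerbound[where F = sequentially]) (auto intro!: always_eventually le)
    then show ?thesis using measure_nonneg[of coin_space "C N"] by simp
  qed
  then have "AE x in coin_space. x \<notin> C N" for N using C by (simp add: coin.prob_eq_0)
  then have "AE x in coin_space. \<forall>N. x \<notin> C N" by (simp add: AE_all_countable)
  then have "AE x in coin_space. x \<notin> {x. tail_equivalent z x}" by (rule AE_mp) (auto simp: U)
  then show "coin.prob {x. tail_equivalent z x} = 0"
    using U C by (subst coin.prob_eq_0) auto
qed

text \<open>A measurable invariant is almost surely constant, because its rational sublevel sets are
  tail events.\<close>

lemma tail_equivalence_not_smooth:
  fixes f :: "(nat \<Rightarrow> bool) \<Rightarrow> real"
  assumes f: "f \<in> borel_measurable coin_space" and inv: "\<And>x y. tail_equivalent x y \<Longrightarrow> f x = f y"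
  obtains x y where "f x = f y" "\<not> tail_equivalent x y"
proof -
  have "\<exists>v. AE x in coin_space. (f x < of_rat r) = v" for r :: rat
  proof -
    let ?X = "{x. f x < of_rat r}"
    have X: "?X \<in> sets coin_space" using borel_measurable_less[OF f, of "\<lambda>_. of_rat r"] by (simp add: space_coin_space)
    have "coin.prob ?X = 0 \<or> coin.prob ?X = 1" using X inv by (intro tail_invariant_0_1) auto
    then have "(AE x in coin_space. x \<notin> ?X) \<or> (AE x in coin_space. x \<in> ?X)"
      using X by (simp add: coin.prob_eq_0 coin.prob_eq_1)
    then show ?thesis
      by (elim disjE) (intro exI[of _ False], simp, intro exI[of _ True], simp)
  qed
  then obtain v where v: "AE x in coin_space. (f x < of_rat r) = v r" for r :: rat by metis
  then have S: "AE x in coin_space. \<forall>r :: rat. (f x < of_rat r) = v r" by (simp add: AE_all_countable)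
  have const: "f x = f y" if "\<forall>r :: rat. (f x < of_rat r) = v r" "\<forall>r :: rat. (f y < of_rat r) = v r" for x y
  proof (rule ccontr)
    assume "f x \<noteq> f y"
    then have "min (f x) (f y) < max (f x) (f y)" by auto
    then obtain r :: rat where "min (f x) (f y) < of_rat r" "of_rat r < max (f x) (f y)" using of_rat_dense by blast
    moreover have "f x < of_rat r \<longleftrightarrow> f y < of_rat r" using that by simp
    ultimately show False by (auto simp: min_less_iff_disj less_max_iff_disj)
  qed
  have ne: "\<not> (AE x in coin_space. False)" by (simp add: coin.AE_False)
  obtain x where x: "\<forall>r :: rat. (f x < of_rat r) = v r"
  proof (rule ccontr)
    assume "\<not> thesis"
    then have *: "(\<forall>r :: rat. (f x < of_rat r) = v r) \<Longrightarrow> False" for x using that by blast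
    have "AE x in coin_space. False" using S by eventually_elim (rule *)
    then show False using ne by simp
  qed
  \<comment> \<open>Almost every point is typical, and almost every point avoids the null class of
    \<open>x\<close>; a point with both properties has the same value of \<open>f\<close>.\<close>
  have N: "AE y in coin_space. \<not> tail_equivalent x y" using tail_class_null[of x] by (simp add: coin.prob_eq_0)
  obtain y where y: "\<forall>r :: rat. (f y < of_rat r) = v r" "\<not> tail_equivalent x y"
  proof (rule ccontr)
    assume "\<not> thesis"
    then have *: "(\<forall>r :: rat. (f y < of_rat r) = v r) \<Longrightarrow> \<not> tail_equivalent x y \<Longrightarrow> False" for y using that by blast
    have "AE y in coin_space. False" using S N by eventually_elim (rule *)
    then show False using ne by simp
  qed
  show thesis using that const[OF x y(1)] y(2) by blast
qed

text \<open>Membership is decided by finitely many words of length \<open>n\<close>, so an arbitrary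
  such set is a finite union of cylinders, whatever condition defines it.\<close>

lemma cylinder_sets:
  assumes "\<And>x y. (\<And>i. i < n \<Longrightarrow> x i = y i) \<Longrightarrow> x \<in> A \<Longrightarrow> y \<in> A"
  shows "A \<in> sets coin_space"
proof -
  define W where "W = (\<lambda>x. restrict x {..<n}) ` A"
  have "finite W"
    by (rule finite_subset[of _ "PiE {..<n} (\<lambda>_. UNIV)"]) (auto simp: W_def intro!: finite_PiE)
  moreover have "{x. \<forall>i<n. x i = w i} \<in> sets coin_space" for w
  proof (cases "n = 0")
    case False
    have "{x. \<forall>i<n. x i = w i} = (\<Inter>i\<in>{..<n}. {x. x i = w i})" by auto
    also have "\<dots> \<in> sets coin_space" using False coin_component_sets by (intro sets.finite_INT) auto
    finally show ?thesis .
  qed (use sets.top[of coin_space] in \<open>simp add: space_coin_space\<close>)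
  moreover have "A = (\<Union>w\<in>W. {x. \<forall>i<n. x i = w i})"
  proof (intro equalityI subsetI)
    fix x assume "x \<in> A"
    then show "x \<in> (\<Union>w\<in>W. {x. \<forall>i<n. x i = w i})" by (auto simp: W_def)
  next
    fix x assume "x \<in> (\<Union>w\<in>W. {x. \<forall>i<n. x i = w i})"
    then obtain y where "y \<in> A" "\<forall>i<n. x i = y i" by (auto simp: W_def)
    then show "x \<in> A" using assms[of y x] by simp
  qed
  ultimately show ?thesis by auto
qed

section \<open>Measurability of the family and conclusion\<close>

context anosov_katok
begin

lemma Phi_in: "Phi x \<in> H_inf_rot (circle_of a)"
  by (simp add: H_inf_rot_def Phi_H_inf Phi_rotation_number)

text \<open>An open set contains \<open>Phi x\<close> exactly when it contains, for some
  \<open>n\<close>, the ball of radius \<open>e n\<close> about \<open>Phin n x\<close>: these balls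
  contain \<open>Phi x\<close> and shrink. For fixed \<open>n\<close> this depends on the first
  \<open>n\<close> tosses only, so preimages of open sets are countable unions of cylinder
  sets.\<close>

lemma Phi_measurable: "Phi \<in> coin_space \<rightarrow>\<^sub>M borel_of_topology (H_inf_rot_topology (circle_of a))"
proof -
  interpret M: Metric_space H_inf d_inf by (rule Metric_space_d_inf)
  have top: "topspace (H_inf_rot_topology (circle_of a)) = H_inf_rot (circle_of a)"
    by (auto simp: H_inf_rot_topology_def H_inf_rot_def)
  \<comment> \<open>The extra \<open>(1/2) ^ n\<close> makes the bound of \<open>d_inf_Phi\<close>
    strict, as open balls require.\<close>
  define e where "e n = 2 * (1/2 :: real) ^ n + 2 * (3/4) ^ n + (1/2) ^ n" for n
  have e0: "e \<longlonglongrightarrow> 0"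
    unfolding e_def[abs_def] by (intro tendsto_add_zero tendsto_mult_right_zero LIMSEQ_realpow_zero) auto
  have d: "d_inf (Phin n x) (Phi x) < e n" for n x
    using d_inf_Phi[of n x] zero_less_power[of "1/2 :: real" n] unfolding e_def by linarith
  have meas: "Phi -` V \<in> sets coin_space" if "openin M.mtopology V" for V
  proof -
    have "Phi -` V = (\<Union>n. {x. M.mball (Phin n x) (e n) \<subseteq> V})"
    proof (intro equalityI subsetI)
      fix x assume "x \<in> Phi -` V"
      then have "Phi x \<in> V" by (rule vimageD)
      have "\<exists>r>0. M.mball (Phi x) r \<subseteq> V"
        using that[unfolded M.openin_mtopology, THEN conjunct2, rule_format, OF \<open>Phi x \<in> V\<close>] .
      then obtain r where r: "0 < r" "M.mball (Phi x) r \<subseteq> V" by (elim exE conjE)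
      then have "\<forall>\<^sub>F n in sequentially. e n < r / 2" by (intro order_tendstoD[OF e0]) simp
      then obtain n where n: "e n < r / 2" by (auto simp: eventually_sequentially)
      have "M.mball (Phin n x) (e n) \<subseteq> M.mball (Phi x) r"
      proof
        fix z assume z: "z \<in> M.mball (Phin n x) (e n)"
        then have zH: "z \<in> H_inf" by simp
        have "d_inf (Phi x) z \<le> d_inf (Phi x) (Phin n x) + d_inf (Phin n x) z"
          by (rule M.triangle[OF Phi_H_inf Phin_H_inf zH])
        also have "\<dots> < r" using d[of n x] z n by (simp add: M.commute)
        finally show "z \<in> M.mball (Phi x) r" using zH Phi_H_inf by simp
      qed
      then show "x \<in> (\<Union>n. {x. M.mball (Phin n x) (e n) \<subseteq> V})" using r(2) by blast
    next
      fix x assume "x \<in> (\<Union>n. {x. M.mball (Phin n x) (e n) \<subseteq> V})"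
      then obtain n where "M.mball (Phin n x) (e n) \<subseteq> V" by blast
      moreover have "Phi x \<in> M.mball (Phin n x) (e n)" using d[of n x] Phi_H_inf Phin_H_inf by simp
      ultimately show "x \<in> Phi -` V" by blast
    qed
    moreover have "{x. M.mball (Phin n x) (e n) \<subseteq> V} \<in> sets coin_space" for n
    proof (rule cylinder_sets[of n])
      fix x y :: "nat \<Rightarrow> bool" assume "\<And>i. i < n \<Longrightarrow> x i = y i"
      then have "Phin n x = Phin n y" by (rule Phin_eq)
      then show "y \<in> {x. M.mball (Phin n x) (e n) \<subseteq> V}" if "x \<in> {x. M.mball (Phin n x) (e n) \<subseteq> V}" using that by simp
    qed
    ultimately show ?thesis by auto
  qed
  show ?thesis unfolding borel_of_topology_def
  proof (rule measurable_measure_of)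
    show "{U. openin (H_inf_rot_topology (circle_of a)) U} \<subseteq> Pow (topspace (H_inf_rot_topology (circle_of a)))"
      using openin_subset by auto
    show "Phi \<in> space coin_space \<rightarrow> topspace (H_inf_rot_topology (circle_of a))"
      using Phi_in by (simp add: top)
    fix U assume "U \<in> {U. openin (H_inf_rot_topology (circle_of a)) U}"
    then obtain V where "openin M.mtopology V" "U = V \<inter> H_inf_rot (circle_of a)"
      by (auto simp: H_inf_rot_topology_def openin_subtopology)
    moreover from this have "Phi -` U \<inter> space coin_space = Phi -` V" using Phi_in by (auto simp: space_coin_space)
    ultimately show "Phi -` U \<inter> space coin_space \<in> sets coin_space" using meas by simp
  qed
qed

end

theorem theorem3p3:
  fixes \<alpha> :: circle and D :: "(circle \<Rightarrow> circle) set"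
  assumes "liouville \<alpha>" and "D \<in> regularity_classes"
  shows "\<not> (\<exists>\<phi> :: (circle \<Rightarrow> circle) \<Rightarrow> real.
    \<phi> \<in> borel_measurable (borel_of_topology (H_inf_rot_topology \<alpha>)) \<and>
    (\<forall>S\<in>H_inf_rot \<alpha>. \<forall>T\<in>H_inf_rot \<alpha>. conjugate_in D S T \<longleftrightarrow> \<phi> S = \<phi> T))"
proof
  assume "\<exists>\<phi> :: (circle \<Rightarrow> circle) \<Rightarrow> real.
    \<phi> \<in> borel_measurable (borel_of_topology (H_inf_rot_topology \<alpha>)) \<and>
    (\<forall>S\<in>H_inf_rot \<alpha>. \<forall>T\<in>H_inf_rot \<alpha>. conjugate_in D S T \<longleftrightarrow> \<phi> S = \<phi> T)"
  then obtain \<phi> :: "(circle \<Rightarrow> circle) \<Rightarrow> real" where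
    \<phi>: "\<phi> \<in> borel_measurable (borel_of_topology (H_inf_rot_topology \<alpha>))"
    and inv: "\<And>S T. S \<in> H_inf_rot \<alpha> \<Longrightarrow> T \<in> H_inf_rot \<alpha> \<Longrightarrow> conjugate_in D S T \<longleftrightarrow> \<phi> S = \<phi> T"
    by blast
  obtain a where a: "\<alpha> = circle_of a" by (rule circle_cases)
  then have L: "liouville_real a" using assms(1) by (simp add: liouville.abs_eq)
  obtain q where "\<And>n. good_scale a q n (q n)" using good_scales[OF L] by blast
  then interpret anosov_katok a q
    using L by unfold_locales (auto simp: liouville_real_def)
  have in\<alpha>: "Phi x \<in> H_inf_rot \<alpha>" for x using Phi_in by (simp add: a)
  have "(\<lambda>x. \<phi> (Phi x)) \<in> borel_measurable coin_space"
    using measurable_compose[OF Phi_measurable \<phi>[unfolded a]] .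
  moreover have "\<phi> (Phi x) = \<phi> (Phi y)" if "tail_equivalent x y" for x y
  proof -
    obtain N where "\<And>i. N \<le> i \<Longrightarrow> x i = y i" using \<open>tail_equivalent x y\<close> by (auto simp: tail_equivalent_def)
    then have "\<exists>k\<in>H_inf. Phi x = k \<circ> Phi y \<circ> inv k" by (rule tail_equivalent_conjugate)
    then have "conjugate_in D (Phi x) (Phi y)"
      using H_inf_subset_regularity_class[OF assms(2)] by (auto simp: conjugate_in_def)
    then show ?thesis using inv[OF in\<alpha> in\<alpha>] by simp
  qed
  ultimately obtain x y where xy: "\<phi> (Phi x) = \<phi> (Phi y)" "\<not> tail_equivalent x y"
    by (rule tail_equivalence_not_smooth)
  \<comment> \<open>Equality of values is symmetric and gives conjugacies in both orders;
    \<open>not_conjugate\<close> refutes the order whose first sequence is infinitely often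
    \<open>True\<close> where the second is \<open>False\<close>.\<close>
  then have conj: "conjugate_in D (Phi x) (Phi y)" "conjugate_in D (Phi y) (Phi x)"
    using inv[OF in\<alpha> in\<alpha>] by simp_all
  have "infinite {n. x n \<and> \<not> y n} \<or> infinite {n. y n \<and> \<not> x n}"
  proof (rule ccontr)
    assume "\<not> ?thesis"
    then have "finite ({n. x n \<and> \<not> y n} \<union> {n. y n \<and> \<not> x n})" by simp
    then obtain N where "\<And>n. n \<in> {n. x n \<and> \<not> y n} \<union> {n. y n \<and> \<not> x n} \<Longrightarrow> n \<le> N"
      using finite_nat_set_iff_bounded_le by auto
    then have "tail_equivalent x y" unfolding tail_equivalent_def
      by (intro exI[of _ "Suc N"]) (force simp: Suc_le_eq)
    then show False using xy(2) by simp
  qed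
  then show False using not_conjugate[OF assms(2)] conj by blast
qed

end
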